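(* For every nonnegative integer $n$, \[ c\phi_3(75n+22)\equiv 0\pmod{25}\qquad\text{and}\qquad \overline{c\phi_3}(75n+72)\equiv 0\pmod{25}. \]
   Context: A generalized Frobenius partition of $n$ is a two-rowed array $\begin{pmatrix} a_1 & \cdots & a_k\\ b_1&\cdots& b_k\end{pmatrix}$ of nonnegative integers, each row non-increasing, with $n=\sum_{i=1}^k (a_i+b_i+1)$. A $3$-colored Frobenius partition is such an array whose entries are taken from $3$ distinct copies of the nonnegative integers distinguished by color, where each row is ordered first by size and then by color, and no two consecutive entries in a row are identical (same size and same color). $c\phi_3(n)$ denotes the number of $3$-colored Frobenius partitions of $n$. Let $p(n)$ be the ordinary partition function, with $p(\alpha)=0$ if $\alpha\notin\mathbb{Z}$, and define $\overline{c\phi_3}(n):=c\phi_3(n)-p(n/3)$. It is known (Kolitsch) that $\sum_{n\ge 0}\overline{c\phi_3}(n)q^n = 9q\prod_{n\ge1}\frac{(1-q^{9n})^3}{(1-q^{3n})(1-q^n)^3}$. *)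

theory Defs
  imports Main "HOL-Library.Multiset" "HOL-Number_Theory.Cong"
begin

text \<open>A coloured entry is a pair (size, colour), with the \<open>k\<close> colours taken to be
  \<open>0, \<dots>, k - 1\<close>. Entries are compared first by size and then by colour.\<close>

definition entry_ge :: "nat \<times> nat \<Rightarrow> nat \<times> nat \<Rightarrow> bool" where
  "entry_ge x y \<longleftrightarrow> fst y < fst x \<or> (fst x = fst y \<and> snd y \<le> snd x)"

definition coloured_row :: "nat \<Rightarrow> (nat \<times> nat) list \<Rightarrow> bool" where
  "coloured_row k r \<longleftrightarrow> (\<forall>x\<in>set r. snd x < k) \<and> sorted_wrt entry_ge r \<and> distinct_adj r"

text \<open>The two rows of the array are the lists \<open>a\<close> and \<open>b\<close>. The empty array is allowed;
  it is the only one for \<open>n = 0\<close>.\<close>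

definition coloured_frobenius_partitions ::
    "nat \<Rightarrow> nat \<Rightarrow> ((nat \<times> nat) list \<times> (nat \<times> nat) list) set" where
  "coloured_frobenius_partitions k n =
    {(a, b). length a = length b \<and> coloured_row k a \<and> coloured_row k b \<and>
             (\<Sum>i<length a. fst (a ! i) + fst (b ! i) + 1) = n}"

definition cphi :: "nat \<Rightarrow> nat \<Rightarrow> nat" where
  "cphi k n = card (coloured_frobenius_partitions k n)"

text \<open>Partitions of \<open>n\<close> are multisets of positive integers with sum \<open>n\<close>.\<close>

definition partition_number :: "nat \<Rightarrow> nat" where
  "partition_number n = card {M :: nat multiset. 0 \<notin># M \<and> sum_mset M = n}"

definition cphi3_bar :: "nat \<Rightarrow> int" where
  "cphi3_bar n = int (cphi 3 n) - (if 3 dvd n then int (partition_number (n div 3)) else 0)"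

text \<open>Both cardinalities are taken of finite sets, so \<^const>\<open>card\<close> is a genuine count.\<close>

lemma finite_coloured_frobenius_partitions: "finite (coloured_frobenius_partitions k n)"
proof -
  let ?L = "{r. set r \<subseteq> {..n} \<times> {..<k} \<and> length r \<le> n}"
  have "finite ?L"
    by (rule finite_lists_length_le) simp
  moreover have "coloured_frobenius_partitions k n \<subseteq> ?L \<times> ?L"
  proof (rule subrelI)
    fix a b assume "(a, b) \<in> coloured_frobenius_partitions k n"
    then have len: "length a = length b" and col: "coloured_row k a" "coloured_row k b"
      and sum: "(\<Sum>i<length a. fst (a ! i) + fst (b ! i) + 1) = n"
      by (auto simp: coloured_frobenius_partitions_def)
    have "length a \<le> n"
      unfolding sum[symmetric] sum.distrib by simp
    moreover have le: "fst (a ! i) + fst (b ! i) + 1 \<le> n" if "i < length a" for i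
      unfolding sum[symmetric]
      using that by (intro member_le_sum[of i "{..<length a}" "\<lambda>i. fst (a ! i) + fst (b ! i) + 1"]) auto
    have "set a \<subseteq> {..n} \<times> {..<k}" "set b \<subseteq> {..n} \<times> {..<k}"
      using col len le unfolding coloured_row_def
      by (fastforce simp: in_set_conv_nth mem_Times_iff)+
    ultimately show "(a, b) \<in> ?L \<times> ?L"
      using len by auto
  qed
  ultimately show ?thesis
    by (meson finite_SigmaI finite_subset)
qed

lemma finite_partitions: "finite {M :: nat multiset. 0 \<notin># M \<and> sum_mset M = n}"
proof (rule finite_subset)
  have size_le: "size M \<le> sum_mset M" if "0 \<notin># M" for M :: "nat multiset"
    using that by (induction M) auto
  have mem_le: "x \<le> sum_mset M" if "x \<in># M" for x and M :: "nat multiset"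
    using that by (auto dest!: multi_member_split)
  show "{M :: nat multiset. 0 \<notin># M \<and> sum_mset M = n} \<subseteq>
      mset ` {xs. set xs \<subseteq> {..n} \<and> length xs \<le> n}"
  proof
    fix M :: "nat multiset" assume M: "M \<in> {M. 0 \<notin># M \<and> sum_mset M = n}"
    obtain xs where xs: "mset xs = M" using ex_mset by blast
    have "set xs \<subseteq> {..n}" using M mem_le xs by auto
    moreover have "length xs \<le> n" using M size_le[of M] xs by auto
    ultimately show "M \<in> mset ` {xs. set xs \<subseteq> {..n} \<and> length xs \<le> n}"
      using xs by blast
  qed
  show "finite (mset ` {xs. set xs \<subseteq> {..n} \<and> length xs \<le> n})"
    by (intro finite_imageI finite_lists_length_le) simp
qed

end

theory Submission
  imports Defs Complex_Main "HOL-Computational_Algebra.Computational_Algebra"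
    "HOL-Library.Product_Lexorder"
begin

unbundle fps_syntax

text \<open>Let $E(q) = \prod_{n \ge 1} (1 - q^n)$. By Jacobi's triple product the generating function of
  the 3-coloured Frobenius partitions is $a(q) / E(q)^3$, where $a$ is the theta series of the
  hexagonal lattice. Twisting the same constant term by a cube root of unity gives
  $E(q)^3 = E(q^3) (a(q^3) - c(q^3))$, hence Borweins' relation $a^3 = b^3 + c^3$ with
  $b = E(q)^3 / E(q^3)$ and $c = 3 q^{1/3} E(q^3)^3 / E(q)$. The classes of 1 and 0 modulo 3 of the
  generating function (the latter without the partition numbers) are therefore
  $9 a^2 E(q^3)^6 / E^{11}$ and $81 q E(q^3)^{12} / E^{13}$. The Wronskian of $a$ and $c$
  expresses all derivatives in $a$, $b^3$, $c^3$ and $E_2$. Up to factors $E^{25}$, which are constants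
  for the derivation modulo 25, each of the two series is a derivative plus 5 times a form
  whose coefficients matter only modulo 5. There Jacobi's series for $E^3$ and the pentagonal series
  yield $E_4 = 1$ and $E_2^2 = 1 + b^9 c^3$, so that everything is a polynomial in $a$ and $1 / a$
  and $s = a^2$ satisfies $q ds/dq = 1 - s^4$; the required coefficients are seen to vanish by
  exhibiting the forms as derivatives plus fifth powers.\<close>

section \<open>Formal sums of powers of the variable\<close>

text \<open>The factor 25 is reached in two unequal stages. An exact identity over the integers
  splits off a derivative (up to a shift of the exponent), whose coefficients at the wanted places
  are divisible by 25, and leaves a form with an explicit factor 5. Only this form is reduced modulo
  5, so the remaining algebra takes place over a field. There it must vanish on a class modulo 25,
  whereas a derivative is controlled only through a class modulo 5. Hence the fifth powers: by
  Frobenius their coefficients are governed by those of the base at one fifth of the index, where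
  the same argument applies again.

  The classes are dictated by the derivations. Once the series are shifted so as to become forms
  divided by E^25, the wanted exponents are 25 (m + 1) and 25 m + 8. The second one is fitted to 3 q
  d/dq + 1, because c is used without its factor q^(1/3), and 3 (25 m + 8) + 1 = 25 (3 m + 1).

  Complex cube roots of unity serve only to prove identities between integer series.\<close>

definition qsum :: "'i set \<Rightarrow> ('i \<Rightarrow> int) \<Rightarrow> ('i \<Rightarrow> 'a::comm_ring_1) \<Rightarrow> 'a fps" where
  "qsum S Q w = Abs_fps (\<lambda>n. \<Sum>i | i \<in> S \<and> Q i = int n. w i)"

text \<open>Finite fibres make the coefficients of \<open>qsum\<close> genuine sums (a sum over an
  infinite set is 0 by convention), and nonnegative exponents ensure that no term is lost in
  products and shifts.\<close>

definition admissible :: "'i set \<Rightarrow> ('i \<Rightarrow> int) \<Rightarrow> bool" where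
  "admissible S Q \<longleftrightarrow> (\<forall>i\<in>S. 0 \<le> Q i) \<and> (\<forall>n::nat. finite {i \<in> S. Q i = int n})"

abbreviation subq :: "nat \<Rightarrow> 'a::idom fps \<Rightarrow> 'a fps" where
  "subq k F \<equiv> F oo fps_X ^ k"

lemma qsum_nth: "qsum S Q w $ n = (\<Sum>i | i \<in> S \<and> Q i = int n. w i)"
  by (simp add: qsum_def)

lemma admissibleI:
  assumes "\<And>i. i \<in> S \<Longrightarrow> 0 \<le> Q i" "\<And>n i. i \<in> S \<Longrightarrow> Q i = int n \<Longrightarrow> i \<in> B n" "\<And>n. finite (B n)"
  shows "admissible S Q"
proof -
  have "finite {i \<in> S. Q i = int n}" for n
    by (rule finite_subset[OF _ assms(3)[of n]]) (use assms(2) in auto)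
  then show ?thesis using assms(1) by (simp add: admissible_def)
qed

lemma admissible_subset: "admissible S Q \<Longrightarrow> T \<subseteq> S \<Longrightarrow> admissible T Q"
  by (rule admissibleI[where B = "\<lambda>n. {i \<in> S. Q i = int n}"]) (auto simp: admissible_def)

lemma qsum_cong:
  assumes "\<And>i. i \<in> S \<Longrightarrow> Q i = Q' i" "\<And>i. i \<in> S \<Longrightarrow> w i = w' i"
  shows "qsum S Q w = qsum S Q' w'"
  unfolding qsum_def by (intro arg_cong[where f = Abs_fps] ext sum.cong) (use assms in auto)

lemma qsum_add: "qsum S Q w + qsum S Q v = qsum S Q (\<lambda>i. w i + v i)"
  by (simp add: fps_eq_iff qsum_nth sum.distrib)

lemma qsum_diff: "qsum S Q w - qsum S Q v = qsum S Q (\<lambda>i. w i - v i)"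
  by (simp add: fps_eq_iff qsum_nth sum_subtractf)

lemma qsum_cmult: "fps_const c * qsum S Q w = qsum S Q (\<lambda>i. c * w i)"
  by (simp add: fps_eq_iff qsum_nth sum_distrib_left)

lemma qsum_reindex:
  assumes "bij_betw h S T" "\<And>i. i \<in> S \<Longrightarrow> Q' (h i) = Q i" "\<And>i. i \<in> S \<Longrightarrow> w' (h i) = w i"
  shows "qsum T Q' w' = qsum S Q w"
proof (rule fps_ext)
  fix n
  have "bij_betw h {i. i \<in> S \<and> Q i = int n} {i. i \<in> T \<and> Q' i = int n}"
    using assms(1,2) unfolding bij_betw_def inj_on_def by (auto simp: image_iff)
  then show "qsum T Q' w' $ n = qsum S Q w $ n"
    unfolding qsum_nth by (rule sum.reindex_bij_betw[symmetric, THEN trans])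
      (intro sum.cong; use assms(3) in auto)
qed

lemma qsum_Un:
  assumes "admissible (S \<union> T) Q" "S \<inter> T = {}"
  shows "qsum (S \<union> T) Q w = qsum S Q w + qsum T Q w"
proof (rule fps_ext)
  fix n
  have eq: "{i. i \<in> S \<union> T \<and> Q i = int n} = {i. i \<in> S \<and> Q i = int n} \<union> {i. i \<in> T \<and> Q i = int n}"
    by auto
  have "finite {i. i \<in> S \<union> T \<and> Q i = int n}"
    using assms(1) unfolding admissible_def by blast
  then have "finite {i. i \<in> S \<and> Q i = int n}" "finite {i. i \<in> T \<and> Q i = int n}"
    unfolding eq by auto
  then show "qsum (S \<union> T) Q w $ n = (qsum S Q w + qsum T Q w) $ n"
    unfolding qsum_nth fps_add_nth eq using assms(2) by (intro sum.union_disjoint) auto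
qed

lemma qsum_shift:
  assumes "\<And>i. i \<in> S \<Longrightarrow> 0 \<le> Q i"
  shows "fps_X ^ m * qsum S Q w = qsum S (\<lambda>i. Q i + int m) w"
proof (rule fps_ext)
  fix n
  show "(fps_X ^ m * qsum S Q w) $ n = qsum S (\<lambda>i. Q i + int m) w $ n"
  proof (cases "n < m")
    case True
    then have *: "{i. i \<in> S \<and> Q i + int m = int n} = {}" using assms by force
    show ?thesis unfolding qsum_nth * using True by (simp add: fps_X_power_mult_nth)
  next
    case False
    then have *: "{i. i \<in> S \<and> Q i + int m = int n} = {i. i \<in> S \<and> Q i = int (n - m)}" by auto
    show ?thesis unfolding fps_X_power_mult_nth qsum_nth * using False by simp
  qed
qed

lemma qsum_mult:
  assumes "admissible S Q" "admissible S' Q'"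
  shows "qsum S Q w * qsum S' Q' w' =
    qsum (S \<times> S') (\<lambda>(i, j). Q i + Q' j) (\<lambda>(i, j). w i * w' j)"
proof (rule fps_ext)
  fix n
  let ?A = "\<lambda>k. {i. i \<in> S \<and> Q i = int k}" and ?B = "\<lambda>k. {i. i \<in> S' \<and> Q' i = int k}"
  have fin: "finite (?A k)" "finite (?B k)" for k
    using assms unfolding admissible_def by blast+
  have "(qsum S Q w * qsum S' Q' w') $ n = (\<Sum>k=0..n. \<Sum>p\<in>?A k \<times> ?B (n - k). w (fst p) * w' (snd p))"
    unfolding fps_mult_nth qsum_nth sum_product sum.cartesian_product
    by (simp add: case_prod_unfold)
  also have "\<dots> = (\<Sum>p\<in>(\<Union>k\<in>{0..n}. ?A k \<times> ?B (n - k)). w (fst p) * w' (snd p))"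
    by (rule sum.UNION_disjoint[symmetric]) (use fin in \<open>auto intro!: finite_cartesian_product simp del: of_nat_diff\<close>)
  also have "(\<Union>k\<in>{0..n}. ?A k \<times> ?B (n - k)) =
      {p. p \<in> S \<times> S' \<and> (case p of (i, j) \<Rightarrow> Q i + Q' j) = int n}" (is "?L = ?R")
  proof
    show "?L \<subseteq> ?R" by (auto simp: of_nat_diff)
    show "?R \<subseteq> ?L"
    proof
      fix p assume p: "p \<in> ?R"
      then obtain i j where ij: "p = (i, j)" "i \<in> S" "j \<in> S'" "Q i + Q' j = int n" by auto
      have "0 \<le> Q i" "0 \<le> Q' j" using assms ij unfolding admissible_def by auto
      then have "nat (Q i) \<in> {0..n}" "i \<in> ?A (nat (Q i))" "j \<in> ?B (n - nat (Q i))"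
        using ij by auto
      then show "p \<in> ?L" unfolding ij(1) by blast
    qed
  qed
  finally show "(qsum S Q w * qsum S' Q' w') $ n =
      qsum (S \<times> S') (\<lambda>(i, j). Q i + Q' j) (\<lambda>(i, j). w i * w' j) $ n"
    by (simp add: qsum_nth case_prod_unfold)
qed

lemma qsum_subq:
  assumes "0 < k"
  shows "subq k (qsum S Q w) = qsum S (\<lambda>i. int k * Q i) w"
proof (rule fps_ext)
  fix n
  show "subq k (qsum S Q w) $ n = qsum S (\<lambda>i. int k * Q i) w $ n"
  proof (cases "k dvd n")
    case True
    then obtain m where m: "n = k * m" by blast
    have *: "{i. i \<in> S \<and> int k * Q i = int n} = {i. i \<in> S \<and> Q i = int m}"
      unfolding m using assms by simp
    show ?thesis unfolding qsum_nth * using assms m by (simp add: fps_nth_compose_X_power qsum_nth)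
  next
    case False
    have "int k * Q i \<noteq> int n" for i
      using False dvdI[of "int n" "int k" "Q i"] by (metis int_dvd_int_iff)
    then have *: "{i. i \<in> S \<and> int k * Q i = int n} = {}" by auto
    show ?thesis unfolding qsum_nth * using False by (simp add: fps_nth_compose_X_power)
  qed
qed

section \<open>The derivation q d/dq\<close>

lemma qsum_XD: "fps_XD (qsum S Q w :: int fps) = qsum S Q (\<lambda>i. Q i * w i)"
  by (simp add: fps_eq_iff qsum_nth sum_distrib_left)

lemma fps_XD_mult: "fps_XD (F * G) = fps_XD F * G + F * fps_XD (G :: 'a::comm_ring_1 fps)"
  by (simp add: fps_XD_def algebra_simps)

lemma fps_XD_diff: "fps_XD (F - G) = fps_XD F - fps_XD (G :: 'a::comm_ring_1 fps)"
  by (simp add: fps_XD_def algebra_simps)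

lemma fps_XD_power: "fps_XD (F ^ Suc n) = of_nat (Suc n) * F ^ n * fps_XD (F :: 'a::comm_ring_1 fps)"
  by (induction n) (simp_all add: fps_XD_mult algebra_simps)

lemma fps_XD_numeral_mult: "fps_XD (numeral c * F) = numeral c * fps_XD (F :: 'a::comm_ring_1 fps)"
  by (simp add: fps_XD_def numeral_fps_const)

lemma fps_XD_X: "fps_XD (fps_X :: 'a::comm_ring_1 fps) = fps_X"
  by (simp add: fps_XD_def)

lemma fps_XD_of_const: "fps_XD (1 :: 'a::comm_ring_1 fps) = 0" "fps_XD (numeral c :: 'a fps) = 0"
  by (simp_all add: fps_XD_def)

lemma fps_XD_subq: "fps_XD (subq k F) = of_nat k * subq k (fps_XD (F :: 'a::idom fps))"
proof (rule fps_ext)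
  fix n
  show "fps_XD (subq k F) $ n = (of_nat k * subq k (fps_XD F)) $ n"
  proof (cases "k dvd n")
    case True
    then obtain m where "n = k * m" by blast
    then show ?thesis
      by (cases "k = 0") (simp_all add: fps_nth_compose_X_power fps_of_nat[symmetric] mult.assoc)
  next
    case False
    then show ?thesis by (simp add: fps_nth_compose_X_power fps_of_nat[symmetric])
  qed
qed

section \<open>The Euler product\<close>

definition qfact :: "'a::comm_ring_1 \<Rightarrow> nat \<Rightarrow> 'a" where
  "qfact q M = (\<Prod>i<M. 1 - q ^ Suc i)"

text \<open>The infinite product as a diagonal: later factors no longer change the coefficient at n
  (\<open>agree_qfact\<close>).\<close>

definition euler :: "'a::comm_ring_1 fps" where
  "euler = Abs_fps (\<lambda>n. qfact fps_X n $ n)"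

text \<open>Congruence modulo \<open>fps_X ^ M\<close>; passing to the limit in a finite identity
  means showing it for every \<open>M\<close>.\<close>

definition agree :: "nat \<Rightarrow> 'a::comm_ring_1 fps \<Rightarrow> 'a fps \<Rightarrow> bool" where
  "agree M F G \<longleftrightarrow> (\<forall>n<M. F $ n = G $ n)"

lemma agree_refl [simp]: "agree M F F"
  and agree_sym: "agree M F G \<Longrightarrow> agree M G F"
  and agree_trans [trans]: "agree M F G \<Longrightarrow> agree M G H \<Longrightarrow> agree M F H"
  and agree_mono: "agree M F G \<Longrightarrow> M' \<le> M \<Longrightarrow> agree M' F G"
  by (auto simp: agree_def)

lemma agree_mult: "agree M F G \<Longrightarrow> agree M F' G' \<Longrightarrow> agree M (F * F') (G * G')"
  unfolding agree_def fps_mult_nth by (intro allI impI sum.cong) auto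

lemma agree_power: "agree M F G \<Longrightarrow> agree M (F ^ k) (G ^ k)"
  by (induction k) (auto intro: agree_mult)

lemma agree_sum: "(\<And>i. i \<in> S \<Longrightarrow> agree M (F i) (G i)) \<Longrightarrow> agree M (\<Sum>i\<in>S. F i) (\<Sum>i\<in>S. G i)"
  unfolding agree_def fps_sum_nth by (auto intro!: sum.cong)

lemma agree_eqI: "(\<And>M. agree M F G) \<Longrightarrow> F = G"
  by (auto simp: agree_def fps_eq_iff)

lemma agree_X_power_mult: "agree M F G \<Longrightarrow> agree (M + k) (fps_X ^ k * F) (fps_X ^ k * G)"
  by (auto simp: agree_def fps_X_power_mult_nth)

lemma agree_subq: "agree M F G \<Longrightarrow> 0 < k \<Longrightarrow> agree M (subq k F) (subq k G)"
  unfolding agree_def fps_nth_compose_X_power by (auto intro: le_less_trans[OF div_le_dividend])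

lemma qfact_0 [simp]: "qfact q 0 = 1"
  and qfact_Suc: "qfact q (Suc M) = qfact q M * (1 - q ^ Suc M)"
  by (simp_all add: qfact_def)

lemma agree_qfact: "M \<le> N \<Longrightarrow> agree (Suc M) (qfact fps_X N) (qfact fps_X M)"
proof (induction N rule: dec_induct)
  case (step N)
  have "agree (Suc M) (1 - fps_X ^ Suc N) (1 :: 'a fps)"
    using step.hyps by (auto simp: agree_def fps_X_power_nth)
  from agree_mult[OF step.IH this] show ?case by (simp add: qfact_Suc)
qed simp

lemma agree_euler: "agree (Suc M) euler (qfact fps_X M)"
  unfolding agree_def
proof (intro allI impI)
  fix n assume "n < Suc M"
  then have "agree (Suc n) (qfact fps_X M) (qfact fps_X n :: 'a fps)"
    by (intro agree_qfact) simp
  then show "euler $ n = (qfact fps_X M :: 'a fps) $ n" by (simp add: euler_def agree_def)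
qed

lemma euler_nth_0 [simp]: "(euler :: 'a::comm_ring_1 fps) $ 0 = 1"
  by (simp add: euler_def)

lemma euler_nonzero [simp]: "(euler :: 'a::comm_ring_1 fps) \<noteq> 0"
  by (metis euler_nth_0 fps_zero_nth zero_neq_one)

lemma subq_X [simp]: "0 < k \<Longrightarrow> subq k fps_X = (fps_X ^ k :: 'a::idom fps)"
  by (rule fps_X_fps_compose_startby0) simp

lemma subq_simps:
  fixes F G :: "'a::idom fps"
  assumes "0 < k"
  shows "subq k (F * G) = subq k F * subq k G" "subq k (F ^ m) = subq k F ^ m"
    "subq k (F + G) = subq k F + subq k G" "subq k (F - G) = subq k F - subq k G"
    "subq k (numeral c) = numeral c" "subq k 1 = 1"
  using assms
  by (simp_all add: fps_compose_mult_distrib fps_compose_power fps_compose_add_distrib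
      fps_compose_sub_distrib numeral_fps_const)

lemma subq_nth_mult [simp]: "0 < k \<Longrightarrow> subq k F $ (k * n) = F $ n"
  by (simp add: fps_nth_compose_X_power)

lemma subq_subq:
  assumes "0 < k" "0 < l"
  shows "subq k (subq l F) = subq (k * l) (F :: 'a::idom fps)"
proof -
  have "subq k (subq l F) = F oo subq k (fps_X ^ l)"
    using assms by (intro fps_compose_assoc[symmetric]) auto
  then show ?thesis using assms by (simp add: subq_simps power_mult)
qed

lemma subq_inj: "0 < k \<Longrightarrow> subq k F = subq k G \<Longrightarrow> F = (G :: 'a::idom fps)"
  by (metis fps_ext subq_nth_mult)

lemma subq_qfact: "0 < k \<Longrightarrow> subq k (qfact fps_X M) = qfact (fps_X ^ k :: 'a::idom fps) M"
  by (simp add: qfact_def fps_compose_prod_distrib subq_simps)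

lemma subq_euler_nth_0: "0 < k \<Longrightarrow> subq k (euler :: 'a::idom fps) $ 0 = 1"
  by (simp add: fps_nth_compose_X_power)

lemma agree_subq_euler: "0 < k \<Longrightarrow> agree (Suc M) (subq k euler) (qfact (fps_X ^ k :: 'a::idom fps) M)"
  using agree_subq[OF agree_euler, of k M] by (simp add: subq_qfact)

lemma agree_cancel:
  assumes "agree M (F * U) (G * U)" "U $ 0 = (1 :: 'a::comm_ring_1)"
  shows "agree M F G"
proof -
  have "n < M \<Longrightarrow> F $ n = G $ n" for n
  proof (induction n rule: less_induct)
    case (less n)
    have "(\<Sum>i\<in>{0..<n}. F $ i * U $ (n - i)) = (\<Sum>i\<in>{0..<n}. G $ i * U $ (n - i))"
      using less by (intro sum.cong) auto
    moreover have "(F * U) $ n = (G * U) $ n" using assms(1) less.prems by (simp add: agree_def)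
    ultimately show ?case
      using assms(2) by (simp add: fps_mult_nth atLeastLessThanSuc_atLeastAtMost[symmetric])
  qed
  then show ?thesis by (simp add: agree_def)
qed

section \<open>The finite Jacobi triple product\<close>

text \<open>The Gaussian binomial coefficient, given by its Pascal rule: this makes sense for every
  ring element \<open>q\<close>, where a quotient of q-factorials does not.\<close>

fun gbin :: "'a::comm_ring_1 \<Rightarrow> nat \<Rightarrow> nat \<Rightarrow> 'a" where
  "gbin q n 0 = 1"
| "gbin q 0 (Suc k) = 0"
| "gbin q (Suc n) (Suc k) = gbin q n (Suc k) + q ^ (n - k) * gbin q n k"

lemma gbin_eq_0: "n < k \<Longrightarrow> gbin q n k = 0"
  by (induction q n k rule: gbin.induct) auto

lemma gbin_qfact: "k \<le> n \<Longrightarrow> gbin q n k * (qfact q k * qfact q (n - k)) = qfact q n"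
proof (induction q n k rule: gbin.induct)
  case (3 q n k)
  show ?case
  proof (cases "k = n")
    case True
    then have "gbin q n k * qfact q n = qfact q n" using 3 by simp
    then show ?thesis unfolding True by (simp add: gbin_eq_0 qfact_Suc flip: mult.assoc)
  next
    case False
    then obtain d where d: "n = Suc (k + d)" using "3.prems" by (metis Suc_leI less_iff_Suc_add le_neq_implies_less not_less_eq_eq)
    have 1: "gbin q n (Suc k) * (qfact q (Suc k) * qfact q d) = qfact q n"
      and 2: "gbin q n k * (qfact q k * qfact q (Suc d)) = qfact q n"
      using 3 d by simp_all
    have "gbin q (Suc n) (Suc k) * (qfact q (Suc k) * qfact q (Suc n - Suc k)) =
        gbin q n (Suc k) * (qfact q (Suc k) * qfact q d) * (1 - q ^ Suc d) +
        q ^ Suc d * (1 - q ^ Suc k) * (gbin q n k * (qfact q k * qfact q (Suc d)))"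
      using d by (simp add: qfact_Suc algebra_simps)
    also have "\<dots> = qfact q n * ((1 - q ^ Suc d) + q ^ Suc d * (1 - q ^ Suc k))"
      unfolding 1 2 by (simp add: algebra_simps)
    also have "(1 - q ^ Suc d) + q ^ Suc d * (1 - q ^ Suc k) = 1 - q ^ Suc n"
      by (simp add: algebra_simps d power_add)
    finally show ?thesis by (simp add: qfact_Suc)
  qed
qed auto

text \<open>The homogeneous form lets \<open>x\<close> be a power of \<open>q\<close>, which
  replaces the negative powers in the usual derivation of the triple product.\<close>

lemma gauss_binomial:
  "(\<Prod>i<M. x + y * q ^ i) = (\<Sum>k\<le>M. gbin q M k * q ^ (k choose 2) * x ^ (M - k) * y ^ k)"
proof (induction M)
  case (Suc M)
  let ?t = "\<lambda>M k. gbin q M k * q ^ (k choose 2) * x ^ (M - k) * y ^ k"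
  have "(\<Sum>k\<le>Suc M. ?t (Suc M) k) = x ^ Suc M + (\<Sum>k\<le>M. ?t (Suc M) (Suc k))"
    by (subst sum.atMost_Suc_shift) (simp add: numeral_2_eq_2)
  also have "(\<Sum>k\<le>M. ?t (Suc M) (Suc k)) =
      (\<Sum>k\<le>M. gbin q M (Suc k) * q ^ (Suc k choose 2) * x ^ (M - k) * y ^ Suc k) +
      (\<Sum>k\<le>M. ?t M k * (y * q ^ M))"
  proof (subst sum.distrib[symmetric], rule sum.cong)
    fix k assume "k \<in> {..M}"
    then obtain d where "M = k + d" by (metis atMost_iff le_Suc_ex)
    moreover have "Suc k choose 2 = (k choose 2) + k" by (simp add: numeral_2_eq_2)
    ultimately show "?t (Suc M) (Suc k) =
        gbin q M (Suc k) * q ^ (Suc k choose 2) * x ^ (M - k) * y ^ Suc k + ?t M k * (y * q ^ M)"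
      by (simp add: algebra_simps power_add)
  qed simp
  also have "x ^ Suc M + (A + B) = (A + x ^ Suc M) + B" for A B :: 'a
    by simp
  also have "(\<Sum>k\<le>M. gbin q M (Suc k) * q ^ (Suc k choose 2) * x ^ (M - k) * y ^ Suc k) + x ^ Suc M =
      (\<Sum>k\<le>M. ?t M k * x)"
  proof (cases M)
    case (Suc m)
    have "(\<Sum>k\<le>M. ?t M k * x) = x ^ Suc M + (\<Sum>k\<le>m. ?t M (Suc k) * x)"
      unfolding Suc by (subst sum.atMost_Suc_shift) (simp add: mult.commute numeral_2_eq_2)
    also have "(\<Sum>k\<le>m. ?t M (Suc k) * x) =
        (\<Sum>k\<le>m. gbin q M (Suc k) * q ^ (Suc k choose 2) * x ^ (M - k) * y ^ Suc k)"
    proof (rule sum.cong)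
      fix k assume "k \<in> {..m}"
      then have "M - k = Suc (M - Suc k)" using Suc by auto
      then show "?t M (Suc k) * x = gbin q M (Suc k) * q ^ (Suc k choose 2) * x ^ (M - k) * y ^ Suc k"
        by (simp add: mult_ac)
    qed simp
    finally show ?thesis unfolding Suc by (simp add: gbin_eq_0)
  qed (simp add: numeral_2_eq_2)
  finally have "(\<Sum>k\<le>Suc M. ?t (Suc M) k) = (\<Sum>k\<le>M. ?t M k * x) + (\<Sum>k\<le>M. ?t M k * (y * q ^ M))" .
  also have "\<dots> = (\<Sum>k\<le>M. ?t M k) * (x + y * q ^ M)"
    unfolding sum_distrib_right[symmetric] by (simp only: distrib_left)
  finally show ?case by (simp add: Suc.IH)
qed (simp add: numeral_2_eq_2)

text \<open>Far from both ends a Gaussian binomial coefficient tends to 1 / E: each of the three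
  q-factorials in \<open>gbin_qfact\<close> may be replaced by E, up to the distance of
  \<open>k\<close> from 0 and from \<open>n\<close>.\<close>

lemma agree_gbin_euler:
  assumes "0 < r" "k \<le> n" "M \<le> k" "M \<le> n - k"
  shows "agree (Suc M) (gbin (fps_X ^ r) n k * subq r euler) (1 :: 'a::idom fps)"
proof -
  let ?E = "subq r euler :: 'a fps" and ?q = "fps_X ^ r :: 'a fps"
  have q: "agree (Suc M) ?E (qfact ?q N)" if "M \<le> N" for N
    by (rule agree_mono[OF agree_subq_euler[OF assms(1)]]) (use that in simp)
  have "agree (Suc M) (gbin ?q n k * (?E * ?E)) (gbin ?q n k * (qfact ?q k * qfact ?q (n - k)))"
    by (intro agree_mult agree_refl q assms)
  also have "gbin ?q n k * (qfact ?q k * qfact ?q (n - k)) = qfact ?q n"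
    by (rule gbin_qfact) (use assms in auto)
  also have "agree (Suc M) (qfact ?q n) ?E"
    by (rule agree_sym, rule q) (use assms in auto)
  finally have "agree (Suc M) (gbin ?q n k * ?E * ?E) (1 * ?E)" by (simp add: mult.assoc)
  then show ?thesis by (rule agree_cancel) (simp add: subq_euler_nth_0 assms)
qed

definition tri :: "int \<Rightarrow> int" where
  "tri k = k * (k + 1) div 2"

lemma two_tri: "2 * tri k = k * (k + 1)"
  unfolding tri_def by (rule dvd_mult_div_cancel) simp

lemma tri_bounds: "0 \<le> tri k" "\<bar>k\<bar> \<le> tri k + 1"
proof -
  have a: "k * k + k \<ge> 0"
  proof (cases "0 \<le> k")
    case False
    then have "(- k) * (- k - 1) \<ge> 0" by (intro mult_nonneg_nonneg) auto
    then show ?thesis by (simp add: algebra_simps)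
  qed simp
  then show "0 \<le> tri k" using two_tri[of k] by (simp add: algebra_simps)
  have "k * k + k \<ge> 2 * \<bar>k\<bar> - 2"
  proof (cases "0 \<le> k")
    case True
    have "0 \<le> (k - 1) * (k - 1)" by simp
    then show ?thesis using True by (simp add: algebra_simps)
  next
    case False
    then have "(- k - 1) * (- k - 2) \<ge> 0"
      by (cases "k = -1") (auto intro: mult_nonneg_nonneg)
    then show ?thesis using False by (simp add: algebra_simps)
  qed
  then show "\<bar>k\<bar> \<le> tri k + 1" using two_tri[of k] by (simp add: algebra_simps)
qed

lemma prod_shifted_split: "(\<Prod>i<2 * N. f i) = (\<Prod>i<N. f (N - Suc i)) * (\<Prod>i<N. f (N + i))"
  for f :: "nat \<Rightarrow> 'a::comm_monoid_mult"
proof -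
  have "(\<Prod>i<2 * N. f i) = (\<Prod>i<N. f i) * (\<Prod>i=N..<N + N. f i)"
    using prod.atLeastLessThan_concat[of 0 N "N + N" f] by (simp add: mult_2 atLeast0LessThan)
  also have "(\<Prod>i=N..<N + N. f i) = (\<Prod>i<N. f (N + i))"
    using prod.shift_bounds_nat_ivl[of f 0 N N] by (simp add: add.commute atLeast0LessThan)
  also have "(\<Prod>i<N. f i) = (\<Prod>i<N. f (N - Suc i))"
    by (rule prod.nat_diff_reindex[symmetric])
  finally show ?thesis .
qed

lemma double_choose_two: "2 * int (n choose 2) = int n * (int n - 1)"
proof -
  have "2 * (n choose 2) = n * (n - 1)"
    unfolding choose_two by (rule dvd_mult_div_cancel) (cases n; simp)
  then show ?thesis by (cases n) (auto simp: algebra_simps simp flip: of_nat_mult of_nat_add of_nat_Suc)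
qed

section \<open>Euler's pentagonal number theorem\<close>

lemma pentagonal_finite:
  "(\<Prod>i<N. (1 - fps_X ^ (3 * i + 1)) * (1 - fps_X ^ (3 * i + 2))) =
   (\<Sum>k\<le>2 * N. (-1) ^ (k + N) * (fps_X ^ nat ((int k - int N) * (3 * (int k - int N) - 1) div 2) *
      gbin (fps_X ^ 3) (2 * N) k) :: 'a::idom fps)" (is "?P = (\<Sum>k\<le>2 * N. ?s k)")
proof -
  let ?X = "fps_X :: 'a fps"
  \<comment> \<open>The power of q taken out of the factors q^(3 N) - q^(3 i + 1): the lower half of
    the indices gives up the second term with its sign, the upper half the first. The exponents of
    \<open>gauss_binomial\<close> then exceed \<open>e\<close> by the pentagonal numbers of k -
    N.\<close>
  define e where "e = 3 * (N choose 2) + N + 3 * N * N"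
  have "(\<Prod>i<2 * N. ?X ^ (3 * N) + (- ?X) * (?X ^ 3) ^ i) =
      (\<Prod>i<N. ?X ^ (3 * N) + (- ?X) * (?X ^ 3) ^ (N - Suc i)) *
      (\<Prod>i<N. ?X ^ (3 * N) + (- ?X) * (?X ^ 3) ^ (N + i))"
    by (rule prod_shifted_split)
  also have "(\<Prod>i<N. ?X ^ (3 * N) + (- ?X) * (?X ^ 3) ^ (N + i)) =
      (\<Prod>i<N. ?X ^ (3 * N) * (1 - ?X ^ (3 * i + 1)))"
    by (intro prod.cong) (simp_all add: algebra_simps power_add flip: power_mult)
  also have "(\<Prod>i<N. ?X ^ (3 * N) + (- ?X) * (?X ^ 3) ^ (N - Suc i)) =
      (\<Prod>i<N. (- ?X) * (?X ^ 3) ^ (N - Suc i) * (1 - ?X ^ (3 * i + 2)))"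
  proof (rule prod.cong)
    fix i assume "i \<in> {..<N}"
    then obtain d where "N = Suc (i + d)" by (metis lessThan_iff less_imp_Suc_add)
    then have "3 * N = Suc (3 * d + (3 * i + 2))" "N - Suc i = d" by auto
    moreover have "?X ^ Suc (3 * d + (3 * i + 2)) = ?X * (?X ^ 3) ^ d * ?X ^ (3 * i + 2)"
      by (simp only: power_Suc power_add power_mult mult.assoc)
    ultimately show "?X ^ (3 * N) + (- ?X) * (?X ^ 3) ^ (N - Suc i) =
        (- ?X) * (?X ^ 3) ^ (N - Suc i) * (1 - ?X ^ (3 * i + 2))"
      by (simp only: right_diff_distrib) simp
  qed simp
  also have "(\<Prod>i<N. (- ?X) * (?X ^ 3) ^ (N - Suc i) * (1 - ?X ^ (3 * i + 2))) *
      (\<Prod>i<N. ?X ^ (3 * N) * (1 - ?X ^ (3 * i + 1))) =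
      (\<Prod>i<N. (- ?X) * (?X ^ 3) ^ (N - Suc i)) * ?X ^ (3 * N * N) * ?P"
    unfolding prod.distrib prod_constant card_lessThan power_mult[of ?X "3 * N" N] by (simp only: mult_ac)
  also have "(\<Prod>i<N. (- ?X) * (?X ^ 3) ^ (N - Suc i)) = (- ?X) ^ N * (?X ^ 3) ^ (\<Sum>i<N. i)"
    unfolding prod.distrib prod_constant card_lessThan power_sum prod.nat_diff_reindex[of "\<lambda>i. (?X ^ 3) ^ i"] ..
  also have "(\<Sum>i<N. i) = N choose 2"
    using Sum_Ico_nat[of 0 N] by (simp add: atLeast0LessThan choose_two)
  also have "(- ?X) ^ N * (?X ^ 3) ^ (N choose 2) * ?X ^ (3 * N * N) = (-1) ^ N * ?X ^ e"
    unfolding e_def power_minus[of ?X] by (simp add: power_add mult_ac flip: power_mult)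
  finally have "(-1) ^ N * ?X ^ e * ?P = (\<Sum>k\<le>2 * N. gbin (?X ^ 3) (2 * N) k * (?X ^ 3) ^ (k choose 2) *
      (?X ^ (3 * N)) ^ (2 * N - k) * (- ?X) ^ k)"
    by (simp only: gauss_binomial)
  also have "\<dots> = (\<Sum>k\<le>2 * N. (-1) ^ N * ?X ^ e * ?s k)"
  proof (rule sum.cong)
    fix k assume k: "k \<in> {..2 * N}"
    define j where "j = int k - int N"
    define p where "p = j * (3 * j - 1) div 2"
    have p2: "2 * p = j * (3 * j - 1)" unfolding p_def by (rule dvd_mult_div_cancel) simp
    have "p \<ge> 0"
    proof -
      have "0 \<le> j * (3 * j - 1)"
        by (cases "0 < j") (auto intro: mult_nonneg_nonneg mult_nonpos_nonpos)
      then show ?thesis using p2 by simp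
    qed
    have "int (3 * (k choose 2) + 3 * N * (2 * N - k) + k) = int e + p"
    proof -
      have "int (2 * N - k) = 2 * int N - int k" using k by simp
      then show ?thesis
        using p2 double_choose_two[of k] double_choose_two[of N]
        unfolding j_def e_def of_nat_add of_nat_mult by (simp add: algebra_simps)
    qed
    then have "3 * (k choose 2) + 3 * N * (2 * N - k) + k = e + nat p"
      using \<open>p \<ge> 0\<close> by (metis nat_0_le nat_int of_nat_add)
    then have "(?X ^ 3) ^ (k choose 2) * (?X ^ (3 * N)) ^ (2 * N - k) * ?X ^ k = ?X ^ e * ?X ^ nat p"
      by (simp flip: power_add power_mult)
    moreover have "(-1) ^ N * ((-1) ^ (k + N) :: 'a fps) = (-1) ^ k"
      by (simp add: power_add mult.left_commute flip: power_mult_distrib)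
    ultimately have "gbin (?X ^ 3) (2 * N) k * ((-1) ^ k * ((?X ^ 3) ^ (k choose 2) *
      (?X ^ (3 * N)) ^ (2 * N - k) * ?X ^ k)) =
      gbin (?X ^ 3) (2 * N) k * ((-1) ^ N * (-1) ^ (k + N) * (?X ^ e * ?X ^ nat p))"
      by simp
    then show "gbin (?X ^ 3) (2 * N) k * (?X ^ 3) ^ (k choose 2) *
      (?X ^ (3 * N)) ^ (2 * N - k) * (- ?X) ^ k = (-1) ^ N * ?X ^ e * ?s k"
      unfolding power_minus[of ?X] p_def j_def by (simp only: mult_ac)
  qed simp
  finally have "((-1) ^ N * ?X ^ e) * ?P = ((-1) ^ N * ?X ^ e) * (\<Sum>k\<le>2 * N. ?s k)"
    by (simp add: sum_distrib_left)
  moreover have "(-1) ^ N * ?X ^ e \<noteq> 0" by simp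
  ultimately show ?thesis using mult_left_cancel by blast
qed

lemma sum_int_interval_shift: "(\<Sum>k\<le>2 * N. f (int k - int N)) = (\<Sum>j\<in>{- int N..int N}. f j)"
  by (rule sum.reindex_bij_witness[of _ "\<lambda>j. nat (j + int N)" "\<lambda>k. int k - int N"]) auto

text \<open>Dominated convergence for formal series: the factors \<open>g i\<close> tend to 1, and
  as the term of \<open>i\<close> starts only at the exponent \<open>Q i\<close>, it suffices to
  control \<open>g i\<close> up to \<open>M - Q i\<close>.\<close>

lemma agree_qsum_window:
  assumes "admissible S Q" "W \<subseteq> S" "finite W" "\<And>i. i \<in> S - W \<Longrightarrow> int M \<le> Q i"
    "\<And>i. i \<in> W \<Longrightarrow> agree (M - nat (Q i)) (g i) 1"
  shows "agree M (\<Sum>i\<in>W. fps_const (w i) * (fps_X ^ nat (Q i) * g i)) (qsum S Q w)"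
proof -
  have "agree M (\<Sum>i\<in>W. fps_const (w i) * (fps_X ^ nat (Q i) * g i))
      (\<Sum>i\<in>W. fps_const (w i) * (fps_X ^ nat (Q i) * 1))"
  proof (rule agree_sum, rule agree_mult[OF agree_refl])
    fix i assume "i \<in> W"
    from agree_X_power_mult[OF assms(5)[OF this], of "nat (Q i)"]
    show "agree M (fps_X ^ nat (Q i) * g i) (fps_X ^ nat (Q i) * 1)"
      by (rule agree_mono) simp
  qed
  moreover have "agree M (\<Sum>i\<in>W. fps_const (w i) * (fps_X ^ nat (Q i) * 1)) (qsum S Q w)"
    unfolding agree_def
  proof (intro allI impI)
    fix n assume n: "n < M"
    have "(\<Sum>i\<in>W. fps_const (w i) * (fps_X ^ nat (Q i) * 1)) $ n = (\<Sum>i\<in>W. if n = nat (Q i) then w i else 0)"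
      by (simp add: fps_sum_nth fps_X_power_nth) (intro sum.cong; simp)
    also have "\<dots> = (\<Sum>i\<in>{i\<in>W. n = nat (Q i)}. w i)"
      using assms(3) by (simp add: sum.If_cases Int_def)
    also have "{i\<in>W. n = nat (Q i)} = {i. i \<in> S \<and> Q i = int n}"
      using assms(1,2,4) n unfolding admissible_def by force
    finally show "(\<Sum>i\<in>W. fps_const (w i) * (fps_X ^ nat (Q i) * 1)) $ n = qsum S Q w $ n"
      by (simp add: qsum_nth)
  qed
  ultimately show ?thesis by (rule agree_trans)
qed

definition parity_sign :: "int \<Rightarrow> 'a::comm_ring_1" where
  "parity_sign k = (if even k then 1 else -1)"

lemma parity_sign_nat: "(-1) ^ n = (parity_sign (int n) :: 'a::comm_ring_1)"
  by (simp add: parity_sign_def uminus_power_if)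

definition penta :: "int \<Rightarrow> int" where
  "penta k = k * (3 * k - 1) div 2"

lemma two_penta: "2 * penta k = k * (3 * k - 1)"
  unfolding penta_def by (rule dvd_mult_div_cancel) simp

lemma penta_bounds: "0 \<le> penta k" "\<bar>k\<bar> \<le> penta k"
proof -
  have "2 * \<bar>k\<bar> \<le> k * (3 * k - 1)"
  proof (cases "0 < k")
    case True
    then have "k * 2 \<le> k * (3 * k - 1)" by (intro mult_left_mono) auto
    then show ?thesis using True by simp
  next
    case False
    then have "(- k) * 2 \<le> (- k) * (1 - 3 * k)" 
      by (cases "k = 0") (auto intro!: mult_left_mono simp del: mult_minus_left)
    then show ?thesis using False by (simp add: algebra_simps)
  qed
  then show "\<bar>k\<bar> \<le> penta k" unfolding two_penta[symmetric] by simp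
  then show "0 \<le> penta k" by linarith
qed

lemma admissible_penta: "admissible UNIV penta"
proof (rule admissibleI[where B = "\<lambda>n. {- int n..int n}"])
  fix n i assume "penta i = int n"
  then show "i \<in> {- int n..int n}" using penta_bounds(2)[of i] by auto
qed (use penta_bounds in auto)

lemma admissible_tri: "admissible UNIV tri"
proof (rule admissibleI[where B = "\<lambda>n. {- int n - 1..int n + 1}"])
  fix n i assume "tri i = int n"
  then show "i \<in> {- int n - 1..int n + 1}" using tri_bounds(2)[of i] by auto
qed (use tri_bounds in auto)

theorem pentagonal: "euler = qsum UNIV penta (parity_sign :: int \<Rightarrow> 'a::idom)"
proof (rule agree_eqI)
  fix M
  let ?X = "fps_X :: 'a fps"
  have q: "qfact ?X (3 * N) = (\<Prod>i<N. (1 - ?X ^ (3 * i + 1)) * (1 - ?X ^ (3 * i + 2))) * qfact (?X ^ 3) N" for N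
  proof (induction N)
    case (Suc N)
    have "3 * Suc N = Suc (Suc (Suc (3 * N)))" by simp
    have "qfact ?X (3 * Suc N) = qfact ?X (3 * N) *
        ((1 - ?X ^ (3 * N + 1)) * (1 - ?X ^ (3 * N + 2)) * (1 - ?X ^ (3 * Suc N)))"
      unfolding \<open>3 * Suc N = Suc (Suc (Suc (3 * N)))\<close> qfact_Suc by (simp add: mult.assoc)
    also have "?X ^ (3 * Suc N) = (?X ^ 3) ^ Suc N" by (rule power_mult)
    finally show ?case unfolding Suc.IH qfact_Suc prod.lessThan_Suc by (simp only: mult_ac)
  qed simp
  have "agree M euler (qfact ?X (3 * M))"
    by (rule agree_mono[OF agree_euler]) simp
  also have "agree M (qfact ?X (3 * M)) ((\<Prod>i<M. (1 - ?X ^ (3 * i + 1)) * (1 - ?X ^ (3 * i + 2))) * subq 3 euler)"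
    unfolding q by (intro agree_mult agree_refl agree_mono[OF agree_sym[OF agree_subq_euler]]) auto
  also have "(\<Prod>i<M. (1 - ?X ^ (3 * i + 1)) * (1 - ?X ^ (3 * i + 2))) * subq 3 euler =
      (\<Sum>k\<le>2 * M. fps_const (parity_sign (int k - int M)) * (fps_X ^ nat (penta (int k - int M)) *
        (gbin (?X ^ 3) (2 * M) (nat (int k - int M + int M)) * subq 3 euler)))"
    unfolding pentagonal_finite sum_distrib_right
    by (intro sum.cong) (auto simp: parity_sign_nat parity_sign_def penta_def mult_ac simp flip: fps_const_neg)
  also have "\<dots> = (\<Sum>j\<in>{- int M..int M}. fps_const (parity_sign j) * (fps_X ^ nat (penta j) *
        (gbin (?X ^ 3) (2 * M) (nat (j + int M)) * subq 3 euler)))"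
    by (rule sum_int_interval_shift)
  also have "agree M \<dots> (qsum UNIV penta parity_sign)"
  proof (rule agree_qsum_window[OF admissible_penta])
    fix j assume "j \<in> UNIV - {- int M..int M}"
    then show "int M \<le> penta j" using penta_bounds(2)[of j] by auto
  next
    fix j assume j: "j \<in> {- int M..int M}"
    \<comment> \<open>The index j + M is at distance M - |j| from the nearer end, which suffices
      because |j| is at most \<open>penta j\<close>.\<close>
    show "agree (M - nat (penta j)) (gbin (?X ^ 3) (2 * M) (nat (j + int M)) * subq 3 euler) 1"
      by (rule agree_mono[OF agree_gbin_euler[where M = "M - nat \<bar>j\<bar>"]]) (use j penta_bounds(2)[of j] in auto)
  qed auto
  finally show "agree M euler (qsum UNIV penta (parity_sign :: int \<Rightarrow> 'a))" .
qed

section \<open>The triple product and Jacobi's series for the cube\<close>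

lemma gbin_const_poly: "gbin [:q:] n k = [:gbin q n k:]"
  by (induction q n k rule: gbin.induct) (simp_all add: pCons_one poly_const_pow mult.commute)

text \<open>Polynomials in z stand for Laurent polynomials: \<open>[:q ^ i, 1:]\<close> is z (1 +
  q^i / z), so the symmetric product appears multiplied by z^N, and degree \<open>j\<close> belongs
  to z^(j - N).\<close>

lemma triple_product_finite:
  fixes q :: "'a::idom"
  assumes "q \<noteq> 0"
  shows "(\<Prod>i<N. [:1, q ^ Suc i:] * [:q ^ i, 1:]) =
   (\<Sum>j\<le>2 * N. monom (q ^ nat (tri (int j - int N)) * gbin q (2 * N) j) j
)" (is "?P = (\<Sum>j\<le>2 * N. ?s j)")
proof -
  define e where "e = (Suc N choose 2) + N * N"
  let ?f = "\<lambda>i. [:q ^ N:] + [:0, q:] * [:q:] ^ i"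
  have "(\<Prod>i<2 * N. ?f i) = (\<Prod>i<N. ?f (N - Suc i)) * (\<Prod>i<N. ?f (N + i))"
    by (rule prod_shifted_split)
  also have "(\<Prod>i<N. ?f (N + i)) = (\<Prod>i<N. [:q ^ N:] * [:1, q ^ Suc i:])"
    by (intro prod.cong) (simp_all add: poly_const_pow power_add mult.left_commute)
  also have "(\<Prod>i<N. ?f (N - Suc i)) = (\<Prod>i<N. [:q ^ Suc (N - Suc i):] * [:q ^ i, 1:])"
  proof (rule prod.cong)
    fix i assume "i \<in> {..<N}"
    then obtain d where "N = Suc (i + d)" by (metis lessThan_iff less_imp_Suc_add)
    then show "?f (N - Suc i) = [:q ^ Suc (N - Suc i):] * [:q ^ i, 1:]"
      by (simp add: poly_const_pow power_add mult_ac)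
  qed simp
  also have "(\<Prod>i<N. [:q ^ Suc (N - Suc i):] * [:q ^ i, 1:]) * (\<Prod>i<N. [:q ^ N:] * [:1, q ^ Suc i:]) =
      (\<Prod>i<N. [:q ^ Suc (N - Suc i):]) * [:q ^ N:] ^ N * ?P"
    unfolding prod.distrib prod_constant card_lessThan by (simp only: mult_ac)
  also have "(\<Prod>i<N. [:q ^ Suc (N - Suc i):]) = [:q ^ (Suc N choose 2):]"
    unfolding prod.nat_diff_reindex[of "\<lambda>i. [:q ^ Suc i:]"]
    by (induction N) (simp_all add: numeral_2_eq_2 power_add mult_ac)
  also have "[:q ^ (Suc N choose 2):] * [:q ^ N:] ^ N = [:q ^ e:]"
    by (simp add: e_def poly_const_pow power_add mult_ac flip: power_mult)
  finally have "[:q ^ e:] * ?P = (\<Sum>k\<le>2 * N. gbin [:q:] (2 * N) k * [:q:] ^ (k choose 2) *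
      [:q ^ N:] ^ (2 * N - k) * [:0, q:] ^ k)"
    by (simp only: gauss_binomial)
  also have "\<dots> = (\<Sum>k\<le>2 * N. [:q ^ e:] * ?s k)"
  proof (rule sum.cong)
    fix k assume k: "k \<in> {..2 * N}"
    have "int ((k choose 2) + N * (2 * N - k) + k) = int e + tri (int k - int N)"
    proof -
      have "int (2 * N - k) = 2 * int N - int k" using k by simp
      then show ?thesis
        using two_tri[of "int k - int N"] double_choose_two[of k] double_choose_two[of "Suc N"]
        unfolding e_def of_nat_add of_nat_mult by (simp add: algebra_simps)
    qed
    then have "(k choose 2) + N * (2 * N - k) + k = e + nat (tri (int k - int N))"
      using tri_bounds(1)[of "int k - int N"] by (metis nat_0_le nat_int of_nat_add)
    then have "q ^ (k choose 2) * q ^ (N * (2 * N - k)) * q ^ k = q ^ e * q ^ nat (tri (int k - int N))"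
      by (simp flip: power_add)
    moreover have "[:0, q:] ^ k = monom (q ^ k) k"
      using monom_power[of q 1 k] by (simp add: monom_altdef)
    ultimately show "gbin [:q:] (2 * N) k * [:q:] ^ (k choose 2) *
      [:q ^ N:] ^ (2 * N - k) * [:0, q:] ^ k = [:q ^ e:] * ?s k"
      by (simp add: gbin_const_poly poly_const_pow smult_monom mult_ac flip: power_mult)
  qed simp
  finally have "[:q ^ e:] * ?P = [:q ^ e:] * (\<Sum>k\<le>2 * N. ?s k)"
    by (simp only: sum_distrib_left)
  moreover have "[:q ^ e:] \<noteq> 0" using assms by simp
  ultimately show ?thesis using mult_left_cancel by blast
qed

lemma jacobi_finite:
  "qfact fps_X N * qfact fps_X (Suc N) =
    (\<Sum>j\<in>{- int (Suc N)..int (Suc N)}. fps_const (parity_sign j * of_int j) *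
      (fps_X ^ nat (tri j) * gbin fps_X (2 * Suc N) (nat (j + int (Suc N)))) :: 'a::idom fps)"
proof -
  let ?X = "fps_X :: 'a fps"
  let ?c = "\<lambda>j. ?X ^ nat (tri (int j - int (Suc N))) * gbin ?X (2 * Suc N) j"
  define P where "P = (\<Prod>i<Suc N. [:1, ?X ^ Suc i:] * [:?X ^ i, 1:])"
  define R where "R = (\<Prod>i<Suc N. [:1, ?X ^ Suc i:]) * (\<Prod>i<N. [:?X ^ Suc i, 1:])"
  have PR: "P = [:1, 1:] * R"
    unfolding P_def R_def prod.distrib prod.lessThan_Suc_shift[of "\<lambda>i. [:?X ^ i, 1:]"]
    by (simp only: power_0 mult_ac)
  \<comment> \<open>At z = -1 the factor \<open>[:1, 1:]\<close> vanishes, so the derivative sees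
    only the cofactor \<open>R\<close>, up to sign a product of two q-factorials.\<close>
  have "poly (pderiv P) (-1) = poly R (-1)"
    unfolding PR pderiv_mult by (simp add: pderiv_pCons)
  also have "poly R (-1) = qfact ?X (Suc N) * (\<Prod>i<N. - (1 - ?X ^ Suc i))"
    by (simp add: R_def poly_prod qfact_def del: prod.lessThan_Suc)
  also have "(\<Prod>i<N. - (1 - ?X ^ Suc i)) = (-1) ^ N * qfact ?X N"
    unfolding qfact_def prod_uminus by simp
  finally have 1: "poly (pderiv P) (-1) = (-1) ^ N * (qfact ?X N * qfact ?X (Suc N))" by (simp add: mult_ac)
  have P2: "P = (\<Sum>j\<le>2 * Suc N. monom (?c j) j)"
    unfolding P_def by (rule triple_product_finite) simp
  have 0: "(\<Sum>j\<le>2 * Suc N. (-1) ^ j * ?c j) = 0"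
  proof -
    have "poly P (-1) = 0" by (simp add: PR)
    then show ?thesis unfolding P2 poly_sum poly_monom by (simp only: mult.commute)
  qed
  have "poly (pderiv P) (-1) = (\<Sum>j\<le>2 * Suc N. of_nat j * ?c j * (-1) ^ (j - 1))"
  proof -
    have "pderiv (sum f A) = (\<Sum>i\<in>A. pderiv (f i))" for A and f :: "nat \<Rightarrow> 'a fps poly"
      by (induction A rule: infinite_finite_induct) (simp_all add: pderiv_add)
    then show ?thesis unfolding P2 by (simp add: pderiv_monom poly_sum poly_monom del: sum.atMost_Suc)
  qed
  also have "\<dots> = - (\<Sum>j\<le>2 * Suc N. of_nat j * ((-1) ^ j * ?c j))"
    unfolding sum_negf[symmetric] 
  proof (rule sum.cong)
    fix j
    show "of_nat j * ?c j * (-1) ^ (j - 1) = - (of_nat j * ((-1) ^ j * ?c j))"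
      by (cases j) simp_all
  qed simp
  \<comment> \<open>The alternating sum without weights is the value of \<open>P\<close> at -1,
    which is 0; subtracting N + 1 times it centres the weight j at the middle index.\<close>
  also have "\<dots> = - ((\<Sum>j\<le>2 * Suc N. of_nat j * ((-1) ^ j * ?c j)) - of_nat (Suc N) * (\<Sum>j\<le>2 * Suc N. (-1) ^ j * ?c j))"
    unfolding 0 by simp
  also have "\<dots> = (\<Sum>j\<le>2 * Suc N. - (of_int (int j - int (Suc N)) * ((-1) ^ j * ?c j)))"
    unfolding sum_distrib_left sum_subtractf[symmetric] sum_negf[symmetric]
    by (intro sum.cong) (simp_all add: algebra_simps)
  also have "\<dots> = (-1) ^ N * (\<Sum>j\<le>2 * Suc N. fps_const (parity_sign (int j - int (Suc N)) * of_int (int j - int (Suc N))) *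
      (?X ^ nat (tri (int j - int (Suc N))) * gbin ?X (2 * Suc N) (nat (int j - int (Suc N) + int (Suc N)))))"
    unfolding sum_distrib_left
  proof (rule sum.cong)
    fix j
    have *: "- ((-1) ^ j) = (-1) ^ N * fps_const (parity_sign (int j - int (Suc N)) :: 'a)"
      by (auto simp: uminus_power_if parity_sign_def simp flip: fps_const_neg)
    have neg: "- (c * ((-1) ^ j * t)) = c * (- ((-1) ^ j) * t)" for c t :: "'a fps" by simp
    show "- (of_int (int j - int (Suc N)) * ((-1) ^ j * ?c j)) = (-1) ^ N * (fps_const (parity_sign (int j - int (Suc N)) * of_int (int j - int (Suc N))) *
      (?X ^ nat (tri (int j - int (Suc N))) * gbin ?X (2 * Suc N) (nat (int j - int (Suc N) + int (Suc N)))))"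
        unfolding fps_const_mult[symmetric] fps_of_int diff_add_cancel nat_int
      by (subst neg, subst *) (simp only: mult_ac)
  qed simp
  also have "(\<Sum>j\<le>2 * Suc N. fps_const (parity_sign (int j - int (Suc N)) * of_int (int j - int (Suc N))) *
      (?X ^ nat (tri (int j - int (Suc N))) * gbin ?X (2 * Suc N) (nat (int j - int (Suc N) + int (Suc N))))) =
    (\<Sum>j\<in>{- int (Suc N)..int (Suc N)}. fps_const (parity_sign j * of_int j) *
      (fps_X ^ nat (tri j) * gbin fps_X (2 * Suc N) (nat (j + int (Suc N)))))"
    by (rule sum_int_interval_shift)
  finally show ?thesis unfolding 1 by simp
qed

text \<open>The customary weight 2 k + 1 over k >= 0 arises by pairing k with -1 - k, which has the
  same triangular number and the opposite sign.\<close>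

theorem jacobi: "euler ^ 3 = qsum UNIV tri (\<lambda>k. parity_sign k * of_int k :: 'a::idom)"
proof (rule agree_eqI)
  fix M
  let ?X = "fps_X :: 'a fps"
  let ?g = "\<lambda>j. gbin ?X (2 * Suc M) (nat (j + int (Suc M))) * euler"
  have "agree M (euler * euler * euler) (qfact ?X M * qfact ?X (Suc M) * euler)"
    by (intro agree_mult agree_refl agree_mono[OF agree_euler]) auto
  also have "qfact ?X M * qfact ?X (Suc M) * euler = (\<Sum>j\<in>{- int (Suc M)..int (Suc M)}.
      fps_const (parity_sign j * of_int j) * (fps_X ^ nat (tri j) * ?g j))"
    unfolding jacobi_finite sum_distrib_right by (simp add: mult_ac)
  also have "agree M \<dots> (qsum UNIV tri (\<lambda>k. parity_sign k * of_int k))"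
  proof (rule agree_qsum_window[OF admissible_tri])
    fix j assume "j \<in> UNIV - {- int (Suc M)..int (Suc M)}"
    then show "int M \<le> tri j" using tri_bounds(2)[of j] by auto
  next
    fix j assume j: "j \<in> {- int (Suc M)..int (Suc M)}"
    have "agree (Suc (Suc M - nat \<bar>j\<bar>)) (gbin (?X ^ 1) (2 * Suc M) (nat (j + int (Suc M))) * subq 1 euler) 1"
      by (rule agree_gbin_euler) (use j in auto)
    then have "agree (Suc (Suc M - nat \<bar>j\<bar>)) (?g j) 1" by simp
    then show "agree (M - nat (tri j)) (?g j) 1"
      by (rule agree_mono) (use j tri_bounds(2)[of j] in auto)
  qed auto
  finally show "agree M (euler ^ 3) (qsum UNIV tri (\<lambda>k. parity_sign k * of_int k :: 'a))"
    by (simp add: power3_eq_cube)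
qed

section \<open>Constant terms\<close>

definition hexa :: "int \<times> int \<Rightarrow> int" where
  "hexa = (\<lambda>(m, n). m * m + m * n + n * n)"

text \<open>For u^3 = 1 this is u^(m - n); the exponent is reduced modulo 3 to become a natural
  number.\<close>

definition chi :: "'a::comm_ring_1 \<Rightarrow> int \<times> int \<Rightarrow> 'a" where
  "chi u = (\<lambda>(m, n). u ^ nat ((m - n) mod 3))"

lemma abs_le_square: "\<bar>x\<bar> \<le> x * (x::int)"
proof (cases "x = 0")
  case False
  then have "1 * \<bar>x\<bar> \<le> \<bar>x\<bar> * \<bar>x\<bar>" by (intro mult_right_mono) auto
  then show ?thesis by simp
qed simp

lemma hexa_bounds: "\<bar>m\<bar> \<le> hexa (m, n)" "\<bar>n\<bar> \<le> hexa (m, n)" "\<bar>m + n\<bar> \<le> hexa (m, n)"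
proof -
  have "2 * hexa (m, n) = m * m + n * n + (m + n) * (m + n)"
    by (simp add: hexa_def algebra_simps)
  with abs_le_square[of m] abs_le_square[of n] abs_le_square[of "m + n"]
  have "\<bar>m\<bar> + \<bar>n\<bar> + \<bar>m + n\<bar> \<le> 2 * hexa (m, n)" by linarith
  then show "\<bar>m\<bar> \<le> hexa (m, n)" "\<bar>n\<bar> \<le> hexa (m, n)" "\<bar>m + n\<bar> \<le> hexa (m, n)" by linarith+
qed

lemma admissible_hexa: "admissible UNIV hexa"
proof (rule admissibleI[where B = "\<lambda>n. {- int n..int n} \<times> {- int n..int n}"])
  fix n i assume *: "hexa i = int n"
  obtain a b where "i = (a, b)" by fastforce
  then show "i \<in> {- int n..int n} \<times> {- int n..int n}"
    using hexa_bounds[where m = a and n = b] * by auto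
next
  fix i show "0 \<le> hexa i" using hexa_bounds(1)[where m = "fst i" and n = "snd i"] by simp
qed auto

lemma tri_sum: "tri m + tri n + tri (- m - n) = hexa (m, n)"
proof -
  have "2 * (tri m + tri n + tri (- m - n)) = 2 * hexa (m, n)"
    unfolding distrib_left two_tri by (simp add: hexa_def algebra_simps)
  then show ?thesis by simp
qed

lemma pcompose_monom: "monom c n \<circ>\<^sub>p p = smult c (p ^ n)"
  by (induction n) (simp_all add: monom_0 monom_Suc pcompose_pCons)

definition twist :: "'a::comm_ring_1 \<Rightarrow> 'a fps poly \<Rightarrow> 'a fps poly" where
  "twist u p = p \<circ>\<^sub>p [:0, fps_const u:]"

lemma twist_mult: "twist u (p * q) = twist u p * twist u q"
  by (simp add: twist_def pcompose_mult)

lemma twist_prod: "twist u (\<Prod>i\<in>A. p i) = (\<Prod>i\<in>A. twist u (p i))"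
  by (simp add: twist_def pcompose_prod)

lemma twist_pCons: "twist u [:a, b:] = [:a, fps_const u * b:]"
  by (simp add: twist_def pcompose_pCons)

lemma twist_1: "twist 1 p = p"
proof -
  show ?thesis by (simp add: twist_def pcompose_idR)
qed

lemma twist_monom: "twist u (monom c j) = monom (fps_const (u ^ j) * c) j"
proof -
  have "[:0, fps_const u:] = monom (fps_const u) 1" by (simp add: monom_altdef)
  then show ?thesis
    by (simp add: twist_def pcompose_monom monom_power smult_monom mult.commute fps_const_power)
qed

lemma twist_sum: "twist u (\<Sum>i\<in>A. p i) = (\<Sum>i\<in>A. twist u (p i))"
  by (simp add: twist_def pcompose_sum)

definition triple_poly :: "'a::idom \<Rightarrow> nat \<Rightarrow> 'a poly" where
  "triple_poly q N = (\<Prod>i<N. [:1, q ^ Suc i:] * [:q ^ i, 1:])"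

text \<open>Each factor is centred at degree N, so degree 3 N is the constant term in z, and it
  forces the third index to be - m - n.\<close>

lemma coeff_triple_monoms:
  fixes a b c :: "nat \<Rightarrow> 'a::comm_ring_1"
  shows "coeff ((\<Sum>i\<le>2 * N. monom (a i) i) * (\<Sum>j\<le>2 * N. monom (b j) j) * (\<Sum>k\<le>2 * N. monom (c k) k)) (3 * N) =
   (\<Sum>(m, n)\<in>{(m, n). \<bar>m\<bar> \<le> int N \<and> \<bar>n\<bar> \<le> int N \<and> \<bar>m + n\<bar> \<le> int N}.
      a (nat (m + int N)) * b (nat (n + int N)) * c (nat (- m - n + int N)))"
    (is "coeff ?P _ = sum ?f ?W")
proof -
  let ?T = "{..2 * N} \<times> {..2 * N} \<times> {..2 * N}"
  have "?P = (\<Sum>(i, j, k)\<in>?T. monom (a i * b j * c k) (i + j + k))"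
  proof -
    have prod2: "sum f A * sum g B = (\<Sum>p\<in>A \<times> B. f (fst p) * g (snd p))"
      for f :: "'b \<Rightarrow> 'a poly" and g :: "'c \<Rightarrow> 'a poly" and A B
      by (simp only: sum_product sum.cartesian_product case_prod_unfold)
    show ?thesis
      by (subst mult.assoc) (simp add: prod2 mult_monom case_prod_unfold mult.assoc add.assoc)
  qed
  then have "coeff ?P (3 * N) = (\<Sum>t\<in>?T. if fst t + fst (snd t) + snd (snd t) = 3 * N
      then a (fst t) * b (fst (snd t)) * c (snd (snd t)) else 0)"
    by (simp add: coeff_sum case_prod_unfold)
  also have "\<dots> = (\<Sum>t\<in>{t\<in>?T. fst t + fst (snd t) + snd (snd t) = 3 * N}. a (fst t) * b (fst (snd t)) * c (snd (snd t)))"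
    by (simp add: sum.If_cases Int_def)
  also have "\<dots> = sum ?f ?W"
  proof (rule sum.reindex_bij_witness[of _ "\<lambda>(m, n). (nat (m + int N), nat (n + int N), nat (- m - n + int N))"
      "\<lambda>t. (int (fst t) - int N, int (fst (snd t)) - int N)"])
    fix t assume "t \<in> {t\<in>?T. fst t + fst (snd t) + snd (snd t) = 3 * N}"
    moreover from this have "nat (- (int (fst t) - int N) - (int (fst (snd t)) - int N) + int N) = snd (snd t)"
      by auto
    ultimately show "(\<lambda>(m, n). (nat (m + int N), nat (n + int N), nat (- m - n + int N)))
        (int (fst t) - int N, int (fst (snd t)) - int N) = t"
      "?f (int (fst t) - int N, int (fst (snd t)) - int N) = a (fst t) * b (fst (snd t)) * c (snd (snd t))"
      by (simp_all add: prod_eq_iff)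
  qed auto
  finally show ?thesis .
qed

lemma power_chi:
  assumes "u ^ 3 = (1 :: 'a::comm_ring_1)" "int i + 2 * int j = m + 2 * n + 3 * int N"
  shows "u ^ i * (u ^ 2) ^ j = chi u (m, n)"
proof -
  have "u ^ i * (u ^ 2) ^ j = u ^ (i + 2 * j)" by (simp add: power_add power_mult)
  also have "\<dots> = u ^ (3 * ((i + 2 * j) div 3) + (i + 2 * j) mod 3)"
    by (simp only: mult_div_mod_eq)
  also have "\<dots> = u ^ ((i + 2 * j) mod 3)"
    unfolding power_add power_mult assms(1) by simp
  finally have 1: "u ^ i * (u ^ 2) ^ j = u ^ ((i + 2 * j) mod 3)" .
  have "int ((i + 2 * j) mod 3) = (m + 2 * n + 3 * int N) mod 3"
    unfolding assms(2)[symmetric] by (simp only: zmod_int of_nat_add of_nat_mult of_nat_numeral)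
  also have "\<dots> = (m - n + 3 * (n + int N)) mod 3" by (simp add: algebra_simps)
  also have "\<dots> = (m - n) mod 3" by (rule mod_mult_self2)
  finally have "nat (int ((i + 2 * j) mod 3)) = nat ((m - n) mod 3)" by (rule arg_cong)
  then show ?thesis unfolding 1 chi_def nat_int by (simp only: case_prod_conv)
qed

text \<open>The three triangular exponents add up to the hexagonal norm (\<open>tri_sum\<close>),
  and the twists by u and u^2 contribute u^(m + 2 n) = u^(m - n). The case u = 1 counts Frobenius
  partitions; for a primitive cube root of unity the product simplifies.\<close>

lemma constant_term_limit:
  fixes u :: "'a::idom" and N :: nat
  assumes "u ^ 3 = 1"
  defines "P \<equiv> triple_poly fps_X N"
  shows "agree N (coeff (twist u P * twist (u ^ 2) P * P) (3 * N) * euler ^ 3) (qsum UNIV hexa (chi u))"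
proof -
  let ?W = "{(m, n). \<bar>m\<bar> \<le> int N \<and> \<bar>n\<bar> \<le> int N \<and> \<bar>m + n\<bar> \<le> int N}"
  define c :: "nat \<Rightarrow> 'a fps" where "c j = fps_X ^ nat (tri (int j - int N)) * gbin fps_X (2 * N) j" for j
  define g :: "int \<Rightarrow> 'a fps" where "g m = gbin fps_X (2 * N) (nat (m + int N)) * euler" for m
  have P: "P = (\<Sum>j\<le>2 * N. monom (c j) j)"
    unfolding P_def triple_poly_def c_def by (rule triple_product_finite) simp
  have finW: "finite ?W"
    by (rule finite_subset[of _ "{- int N..int N} \<times> {- int N..int N}"]) (auto simp: abs_le_iff)
  have "coeff (twist u P * twist (u ^ 2) P * P) (3 * N) * euler ^ 3 =
      (\<Sum>(m, n)\<in>?W. fps_const (u ^ nat (m + int N)) * c (nat (m + int N)) *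
        (fps_const ((u ^ 2) ^ nat (n + int N)) * c (nat (n + int N))) * c (nat (- m - n + int N))) * euler ^ 3"
    unfolding P twist_sum twist_monom coeff_triple_monoms ..
  also have "\<dots> = (\<Sum>p\<in>?W. fps_const (chi u p) * (fps_X ^ nat (hexa p) *
      (g (fst p) * g (snd p) * g (- fst p - snd p))))"
    unfolding sum_distrib_right
  proof (rule sum.cong)
    fix p assume "p \<in> ?W"
    then obtain m n where p: "p = (m, n)" and mn: "\<bar>m\<bar> \<le> int N" "\<bar>n\<bar> \<le> int N" "\<bar>m + n\<bar> \<le> int N" by auto
    have mn3: "\<bar>- m - n\<bar> \<le> int N" using mn(3) by linarith
    have 1: "u ^ nat (m + int N) * (u ^ 2) ^ nat (n + int N) = chi u (m, n)"
      by (rule power_chi[where N = N]) (use assms mn in auto)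
    have "nat (hexa (m, n)) = nat (tri m) + nat (tri n) + nat (tri (- m - n))"
      unfolding tri_sum[symmetric] using tri_bounds(1)[of m] tri_bounds(1)[of n] tri_bounds(1)[of "- m - n"]
      by (simp add: nat_add_distrib)
    then have 2: "fps_X ^ nat (tri m) * fps_X ^ nat (tri n) * fps_X ^ nat (tri (- m - n)) = (fps_X ^ nat (hexa (m, n)) :: 'a fps)"
      by (simp add: power_add)
    have 3: "c (nat (k + int N)) * euler = fps_X ^ nat (tri k) * g k" if "\<bar>k\<bar> \<le> int N" for k
      using that by (simp add: c_def g_def mult_ac)
    have "fps_const (u ^ nat (m + int N)) * c (nat (m + int N)) *
        (fps_const ((u ^ 2) ^ nat (n + int N)) * c (nat (n + int N))) * c (nat (- m - n + int N)) * euler ^ 3 =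
        fps_const (u ^ nat (m + int N) * (u ^ 2) ^ nat (n + int N)) *
        ((c (nat (m + int N)) * euler) * (c (nat (n + int N)) * euler) * (c (nat (- m - n + int N)) * euler))"
      by (simp only: fps_const_mult[symmetric] power3_eq_cube mult_ac)
    also have "\<dots> = fps_const (chi u (m, n)) * ((fps_X ^ nat (tri m) * g m) * (fps_X ^ nat (tri n) * g n) *
        (fps_X ^ nat (tri (- m - n)) * g (- m - n)))"
      unfolding 1 3[OF mn(1)] 3[OF mn(2)] 3[OF mn3] ..
    also have "\<dots> = fps_const (chi u p) * (fps_X ^ nat (hexa p) * (g (fst p) * g (snd p) * g (- fst p - snd p)))"
      unfolding p 2[symmetric] by (simp only: fst_conv snd_conv mult_ac)
    finally show "(case p of (m, n) \<Rightarrow> fps_const (u ^ nat (m + int N)) * c (nat (m + int N)) *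
        (fps_const ((u ^ 2) ^ nat (n + int N)) * c (nat (n + int N))) * c (nat (- m - n + int N))) * euler ^ 3 =
        fps_const (chi u p) * (fps_X ^ nat (hexa p) * (g (fst p) * g (snd p) * g (- fst p - snd p)))"
      unfolding p by simp
  qed simp
  also have "agree N \<dots> (qsum UNIV hexa (chi u))"
  proof (rule agree_qsum_window[OF admissible_hexa _ finW])
    fix p assume "p \<in> UNIV - ?W"
    then show "int N \<le> hexa p" using hexa_bounds[where m = "fst p" and n = "snd p"] by (cases p) auto
  next
    fix p assume p: "p \<in> ?W"
    have "agree (N - nat (hexa p)) (g k) 1" if "\<bar>k\<bar> \<le> hexa p" "\<bar>k\<bar> \<le> int N" for k
    proof -
      have "agree (Suc (N - nat \<bar>k\<bar>)) (gbin (fps_X ^ 1) (2 * N) (nat (k + int N)) * subq 1 euler) (1 :: 'a fps)"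
        by (rule agree_gbin_euler) (use that in auto)
      then have "agree (Suc (N - nat \<bar>k\<bar>)) (g k) 1" by (simp add: g_def)
      then show ?thesis by (rule agree_mono) (use that in auto)
    qed
    moreover have "\<bar>- fst p - snd p\<bar> \<le> hexa p" "\<bar>- fst p - snd p\<bar> \<le> int N" "\<bar>fst p\<bar> \<le> hexa p"
        "\<bar>snd p\<bar> \<le> hexa p" "\<bar>fst p\<bar> \<le> int N" "\<bar>snd p\<bar> \<le> int N"
    proof -
      have "\<bar>fst p\<bar> \<le> int N" "\<bar>snd p\<bar> \<le> int N" "\<bar>fst p + snd p\<bar> \<le> int N" using p by auto
      moreover have "\<bar>- x - y\<bar> = \<bar>x + y\<bar>" for x y :: int by linarith
      ultimately show "\<bar>- fst p - snd p\<bar> \<le> hexa p" "\<bar>- fst p - snd p\<bar> \<le> int N" "\<bar>fst p\<bar> \<le> hexa p"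
        "\<bar>snd p\<bar> \<le> hexa p" "\<bar>fst p\<bar> \<le> int N" "\<bar>snd p\<bar> \<le> int N"
        using hexa_bounds[where m = "fst p" and n = "snd p"] by simp_all
    qed
    ultimately have "agree (N - nat (hexa p)) (g (fst p)) 1" "agree (N - nat (hexa p)) (g (snd p)) 1"
      "agree (N - nat (hexa p)) (g (- fst p - snd p)) 1"
      by blast+
    then have "agree (N - nat (hexa p)) (g (fst p) * g (snd p) * g (- fst p - snd p)) (1 * 1 * 1)"
      by (intro agree_mult)
    then show "agree (N - nat (hexa p)) (g (fst p) * g (snd p) * g (- fst p - snd p)) 1" by simp
  qed auto
  finally show ?thesis .
qed

lemma cyclotomic_product:
  fixes w a b :: "'a::comm_ring_1"
  assumes "1 + w + w * w = 0"
  shows "[:a, w * b:] * [:a, w * w * b:] * [:a, b:] = [:a ^ 3, 0, 0, b ^ 3:]"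
proof -
  have 1: "w * w = - 1 - w" using assms by (simp add: eq_neg_iff_add_eq_0 algebra_simps)
  have 2: "w * (w * x) = - x - w * x" for x
    unfolding mult.assoc[symmetric] 1 by (simp add: algebra_simps)
  show ?thesis by (simp add: algebra_simps 1 2 power3_eq_cube)
qed

text \<open>The factors at z, u z and u^2 z combine to one in z^3 and q^3, so the product is the
  triple product at these arguments. Its constant term is a middle Gaussian binomial coefficient,
  which tends to 1 / E(q^3).\<close>

theorem euler_cube_twisted:
  assumes "1 + u + u ^ 2 = (0 :: 'a::idom)"
  shows "euler ^ 3 = subq 3 euler * qsum UNIV hexa (chi u)"
proof (rule agree_eqI)
  fix N
  let ?X = "fps_X :: 'a fps" and ?P = "triple_poly fps_X N :: 'a fps poly" and ?u = "fps_const u"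
  have u2: "u ^ 2 = - 1 - u" using assms by (simp add: eq_neg_iff_add_eq_0 algebra_simps)
  have u3: "u ^ 3 = 1"
  proof -
    have "u ^ 3 = u * u ^ 2" by (simp add: power3_eq_cube power2_eq_square)
    also have "\<dots> = - u - u ^ 2" by (subst u2) (simp add: right_diff_distrib power2_eq_square)
    finally show ?thesis unfolding u2 by simp
  qed
  let ?R = "\<Sum>j\<le>2 * N. monom ((?X ^ 3) ^ nat (tri (int j - int N)) * gbin (?X ^ 3) (2 * N) j) j"
  have w: "fps_const (u ^ 2) = ?u * ?u" "1 + ?u + ?u * ?u = 0"
    using arg_cong[OF assms, of fps_const] by (simp_all add: power2_eq_square fps_const_add[symmetric] del: fps_const_add)
  have fac: "[:a, fps_const u * b:] * [:a, fps_const (u ^ 2) * b:] * [:a, b:] = [:a ^ 3, 0, 0, b ^ 3:]" for a b :: "'a fps"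
    unfolding w(1) by (rule cyclotomic_product[OF w(2)])
  have "twist u ?P * twist (u ^ 2) ?P * ?P = (\<Prod>i<N.
      ([:1, fps_const u * ?X ^ Suc i:] * [:1, fps_const (u ^ 2) * ?X ^ Suc i:] * [:1, ?X ^ Suc i:]) *
      ([:?X ^ i, fps_const u * 1:] * [:?X ^ i, fps_const (u ^ 2) * 1:] * [:?X ^ i, 1:]))"
    unfolding triple_poly_def twist_prod twist_mult twist_pCons prod.distrib[symmetric]
    by (simp only: mult_ac)
  also have "\<dots> = (\<Prod>i<N. [:1, 0, 0, (?X ^ 3) ^ Suc i:] * [:(?X ^ 3) ^ i, 0, 0, 1:])"
    unfolding fac power_one power_mult[symmetric] by (simp only: mult.commute)
  also have "\<dots> = (\<Prod>i<N. [:1, (?X ^ 3) ^ Suc i:] * [:(?X ^ 3) ^ i, 1:]) \<circ>\<^sub>p monom 1 3"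
    unfolding pcompose_prod pcompose_mult
    by (intro prod.cong refl arg_cong2[where f = "(*)"]) (simp_all add: pcompose_pCons monom_altdef numeral_3_eq_3)
  also have "(\<Prod>i<N. [:1, (?X ^ 3) ^ Suc i:] * [:(?X ^ 3) ^ i, 1:]) = ?R"
    by (rule triple_product_finite) simp
  also have "?R \<circ>\<^sub>p monom 1 3 = (\<Sum>j\<le>2 * N. monom ((?X ^ 3) ^ nat (tri (int j - int N)) * gbin (?X ^ 3) (2 * N) j) (3 * j))"
    by (simp add: pcompose_sum pcompose_monom monom_power smult_monom)
  finally have "coeff (twist u ?P * twist (u ^ 2) ?P * ?P) (3 * N) = gbin (?X ^ 3) (2 * N) N"
    by (simp add: coeff_sum tri_def)
  with constant_term_limit[OF u3, of N]
  have "agree N (gbin (?X ^ 3) (2 * N) N * euler ^ 3) (qsum UNIV hexa (chi u))" by simp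
  then have "agree N (gbin (?X ^ 3) (2 * N) N * euler ^ 3 * subq 3 euler) (qsum UNIV hexa (chi u) * subq 3 euler)"
    by (rule agree_mult) simp
  then have 1: "agree N ((gbin (?X ^ 3) (2 * N) N * subq 3 euler) * euler ^ 3) (subq 3 euler * qsum UNIV hexa (chi u))"
    by (simp only: mult_ac)
  have "agree N ((gbin (?X ^ 3) (2 * N) N * subq 3 euler) * euler ^ 3) (1 * euler ^ 3)"
    by (intro agree_mult agree_mono[OF agree_gbin_euler[where M = N]]) auto
  then have "agree N (1 * euler ^ 3) (subq 3 euler * qsum UNIV hexa (chi u))"
    using 1 by (rule agree_trans[OF agree_sym])
  then show "agree N (euler ^ 3) (subq 3 euler * qsum UNIV hexa (chi u))" by simp
qed

section \<open>Coloured Frobenius partitions\<close>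

lemma sorted_distinct_adj_imp_distinct: "sorted xs \<Longrightarrow> distinct_adj xs \<Longrightarrow> distinct xs"
proof (induction xs)
  case (Cons x xs)
  then show ?case by (cases xs) (fastforce simp: distinct_adj_Cons)+
qed simp

lemma distinct_imp_adj: "distinct xs \<Longrightarrow> distinct_adj xs"
  by (auto simp: distinct_adj_conv_nth nth_eq_iff_index_eq)

text \<open>Sorted without adjacent repetition means strictly decreasing, so a row is the decreasing
  list of a finite set, and sets can be counted instead of lists.\<close>

lemma coloured_row_iff: "coloured_row k r \<longleftrightarrow> set r \<subseteq> UNIV \<times> {..<k} \<and> r = rev (sorted_list_of_set (set r))"
proof -
  have ge: "entry_ge x y \<longleftrightarrow> y \<le> x" for x y
    by (auto simp: entry_ge_def less_eq_prod_def)
  have "sorted_wrt entry_ge r \<longleftrightarrow> sorted (rev r)"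
    unfolding sorted_wrt_rev by (simp add: ge sorted_wrt_iff_nth_less)
  moreover have "sorted (rev r) \<and> distinct_adj r \<longleftrightarrow> r = rev (sorted_list_of_set (set r))"
  proof
    assume *: "sorted (rev r) \<and> distinct_adj r"
    then have "distinct (rev r)" by (intro sorted_distinct_adj_imp_distinct) auto
    with * have "sorted_list_of_set (set (rev r)) = rev r"
      by (intro sorted_list_of_set_unique[THEN iffD1]) (auto simp: strict_sorted_iff distinct_card)
    then show "r = rev (sorted_list_of_set (set r))" by simp
  next
    assume *: "r = rev (sorted_list_of_set (set r))"
    have "sorted (sorted_list_of_set (set r))" "distinct (sorted_list_of_set (set r))" by auto
    then show "sorted (rev r) \<and> distinct_adj r"
      by (metis * distinct_adj_rev rev_rev_ident distinct_imp_adj)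
  qed
  ultimately show ?thesis unfolding coloured_row_def by auto
qed

lemma sum_list_rev_sorted: "finite A \<Longrightarrow>
    (\<Sum>i<length (rev (sorted_list_of_set A)). f (rev (sorted_list_of_set A) ! i)) = sum f A"
  using sum_list_distinct_conv_sum_set[of "rev (sorted_list_of_set A)" f]
  by (simp add: sum_list_sum_nth atLeast0LessThan)

definition frobenius_pairs :: "nat \<Rightarrow> nat \<Rightarrow> nat \<Rightarrow> ((nat \<times> nat) set \<times> (nat \<times> nat) set) set" where
  "frobenius_pairs k N n = {(A, B). A \<subseteq> {..<N} \<times> {..<k} \<and> B \<subseteq> {..<N} \<times> {..<k} \<and> card A = card B \<and>
     (\<Sum>x\<in>A. Suc (fst x)) + (\<Sum>x\<in>B. fst x) = n}"

lemma cphi_frobenius_pairs: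
  assumes "n \<le> N"
  shows "cphi k n = card (frobenius_pairs k N n)"
proof -
  let ?h = "\<lambda>(a, b). (set a, set (b :: (nat \<times> nat) list))"
  let ?g = "\<lambda>A. rev (sorted_list_of_set (A :: (nat \<times> nat) set))"
  have sum_eq: "(\<Sum>i<length (?g A). fst (?g A ! i) + fst (?g B ! i) + 1) = (\<Sum>x\<in>A. Suc (fst x)) + (\<Sum>x\<in>B. fst x)"
    if "finite A" "finite B" "card A = card B" for A B
  proof -
    have "(\<Sum>i<length (?g A). fst (?g A ! i) + fst (?g B ! i) + 1) =
        (\<Sum>i<length (?g A). Suc (fst (?g A ! i))) + (\<Sum>i<length (?g B). fst (?g B ! i))"
      using that by (simp add: sum.distrib[symmetric])
    then show ?thesis
      using sum_list_rev_sorted[OF that(1), of "\<lambda>x. Suc (fst x)"] sum_list_rev_sorted[OF that(2), of fst] by simp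
  qed
  have "bij_betw ?h (coloured_frobenius_partitions k n) (frobenius_pairs k N n)"
  proof (rule bij_betw_byWitness[where f' = "\<lambda>(A, B). (?g A, ?g B)"])
    show "\<forall>p\<in>coloured_frobenius_partitions k n. (\<lambda>(A, B). (?g A, ?g B)) (?h p) = p"
      by (auto simp: coloured_frobenius_partitions_def coloured_row_iff)
    have fin: "finite A" if "A \<subseteq> {..<N} \<times> {..<k}" for A
      using that by (rule finite_subset) auto
    show "\<forall>p\<in>frobenius_pairs k N n. ?h ((\<lambda>(A, B). (?g A, ?g B)) p) = p"
      by (auto simp: frobenius_pairs_def fin)
    show "?h ` coloured_frobenius_partitions k n \<subseteq> frobenius_pairs k N n"
    proof
      fix p assume "p \<in> ?h ` coloured_frobenius_partitions k n"
      then obtain a b where p: "p = (set a, set b)" and ab: "length a = length b" "coloured_row k a" "coloured_row k b"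
        "(\<Sum>i<length a. fst (a ! i) + fst (b ! i) + 1) = n"
        by (auto simp: coloured_frobenius_partitions_def)
      have g: "a = ?g (set a)" "b = ?g (set b)" and col: "set a \<subseteq> UNIV \<times> {..<k}" "set b \<subseteq> UNIV \<times> {..<k}"
        using ab(2,3) unfolding coloured_row_iff by auto
      have c: "card (set a) = card (set b)"
        using ab(1) g by (metis length_rev length_sorted_list_of_set)
      have s: "(\<Sum>x\<in>set a. Suc (fst x)) + (\<Sum>x\<in>set b. fst x) = n"
        using sum_eq[of "set a" "set b"] c g ab(4) by simp
      have "fst x < N" if "x \<in> set a" for x
        using member_le_sum[of x "set a" "\<lambda>x. Suc (fst x)"] that s assms by auto
      moreover have "fst x < N" if x: "x \<in> set b" for x
      proof -
        \<comment> \<open>There is at least one column, so the top row uses up at least 1 of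
          \<open>n\<close>, and the entry of \<open>b\<close> is strictly below
          \<open>n\<close>.\<close>
        have "set a \<noteq> {}" using c x by (metis card_eq_0_iff equals0D finite_set List.finite_set)
        then have "(\<Sum>x\<in>set a. Suc (fst x)) > 0" by (intro sum_pos) auto
        then show ?thesis using member_le_sum[of x "set b" fst] x s assms by auto
      qed
      ultimately show "p \<in> frobenius_pairs k N n"
        unfolding p frobenius_pairs_def using c s col by auto
    qed
    show "(\<lambda>(A, B). (?g A, ?g B)) ` frobenius_pairs k N n \<subseteq> coloured_frobenius_partitions k n"
    proof
      fix p assume "p \<in> (\<lambda>(A, B). (?g A, ?g B)) ` frobenius_pairs k N n"
      then obtain A B where p: "p = (?g A, ?g B)" and AB: "A \<subseteq> {..<N} \<times> {..<k}" "B \<subseteq> {..<N} \<times> {..<k}" "card A = card B"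
        "(\<Sum>x\<in>A. Suc (fst x)) + (\<Sum>x\<in>B. fst x) = n"
        unfolding frobenius_pairs_def by auto
      have f: "finite A" "finite B" using AB fin by auto
      have "coloured_row k (?g A)" "coloured_row k (?g B)"
        unfolding coloured_row_iff using AB f by auto
      then show "p \<in> coloured_frobenius_partitions k n"
        unfolding p coloured_frobenius_partitions_def using sum_eq[OF f] AB f by simp
    qed
  qed
  then show ?thesis unfolding cphi_def by (rule bij_betw_same_card)
qed

text \<open>In the expanded product over all pairs of size and colour, \<open>A\<close> collects the
  factors 1 + q^(i + 1) z that contribute their second term, \<open>B\<close> the factors q^i + z
  that contribute their first. The degree is |A| + k N - |B|, so the middle coefficient selects |A|
  = |B|.\<close>

lemma coeff_triple_poly_power:
  "coeff (triple_poly fps_X N ^ k :: 'a::idom fps poly) (k * N) $ n = of_nat (card (frobenius_pairs k N n))"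
proof -
  let ?X = "fps_X :: 'a fps" and ?S = "{..<N} \<times> {..<k}"
  have prodS: "(\<Prod>x\<in>?S. h (fst x)) = (\<Prod>i<N. h i) ^ k" for h :: "nat \<Rightarrow> 'a fps poly"
  proof -
    have "(\<Prod>x\<in>?S. h (fst x)) = (\<Prod>i<N. \<Prod>c<k. h i)"
      by (simp only: prod.cartesian_product case_prod_unfold)
    then show ?thesis by (simp add: prod_power_distrib)
  qed
  have m1: "(\<Prod>x\<in>A. monom (h x) (Suc 0)) = monom (\<Prod>x\<in>A. h x) (card A)" if "finite A" for A :: "(nat \<times> nat) set" and h :: "_ \<Rightarrow> 'a fps"
    using that by (induction A rule: finite_induct) (simp_all add: mult_monom)
  have finS: "finite A" if "A \<subseteq> ?S" for A using that by (rule finite_subset) auto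
  have m0: "(\<Prod>x\<in>A. [:h x:]) = [:\<Prod>x\<in>A. h x:]" for A :: "(nat \<times> nat) set" and h :: "_ \<Rightarrow> 'a fps"
    by (induction A rule: infinite_finite_induct) (simp_all add: mult_ac)
  have "triple_poly ?X N ^ k = (\<Prod>x\<in>?S. monom (?X ^ Suc (fst x)) 1 + 1) * (\<Prod>x\<in>?S. [:?X ^ fst x:] + monom 1 1)"
    unfolding prodS[of "\<lambda>i. monom (?X ^ Suc i) 1 + 1"] prodS[of "\<lambda>i. [:?X ^ i:] + monom 1 1"] power_mult_distrib[symmetric]
      triple_poly_def prod.distrib[symmetric]
    by (simp add: monom_altdef one_pCons)
  also have "(\<Prod>x\<in>?S. monom (?X ^ Suc (fst x)) 1 + 1) = (\<Sum>A\<in>Pow ?S. monom (?X ^ (\<Sum>x\<in>A. Suc (fst x))) (card A))"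
    by (subst prod_add) (auto intro!: sum.cong simp: m1 finS power_sum)
  also have "(\<Prod>x\<in>?S. [:?X ^ fst x:] + monom 1 1) = (\<Sum>B\<in>Pow ?S. monom (?X ^ (\<Sum>x\<in>B. fst x)) (k * N - card B))"
    by (subst prod_add) (auto intro!: sum.cong simp: m1 m0 finS power_sum card_Diff_subset smult_monom monom_power mult.commute)
  also have "(\<Sum>A\<in>Pow ?S. monom (?X ^ (\<Sum>x\<in>A. Suc (fst x))) (card A)) *
      (\<Sum>B\<in>Pow ?S. monom (?X ^ (\<Sum>x\<in>B. fst x)) (k * N - card B)) =
      (\<Sum>(A, B)\<in>Pow ?S \<times> Pow ?S. monom (?X ^ ((\<Sum>x\<in>A. Suc (fst x)) + (\<Sum>x\<in>B. fst x))) (card A + (k * N - card B)))"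
    by (simp add: sum_product sum.cartesian_product mult_monom power_add)
  finally have "coeff (triple_poly ?X N ^ k) (k * N) $ n =
      (\<Sum>p\<in>Pow ?S \<times> Pow ?S. if card (fst p) + (k * N - card (snd p)) = k * N \<and>
        n = (\<Sum>x\<in>fst p. Suc (fst x)) + (\<Sum>x\<in>snd p. fst x) then 1 else 0)"
    by (simp add: coeff_sum fps_sum_nth case_prod_unfold) (intro sum.cong; simp add: fps_X_power_nth)
  also have "\<dots> = of_nat (card {p \<in> Pow ?S \<times> Pow ?S. card (fst p) + (k * N - card (snd p)) = k * N \<and>
        n = (\<Sum>x\<in>fst p. Suc (fst x)) + (\<Sum>x\<in>snd p. fst x)})"
    by (subst sum.inter_filter[symmetric]) auto
  also have "{p \<in> Pow ?S \<times> Pow ?S. card (fst p) + (k * N - card (snd p)) = k * N \<and>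
        n = (\<Sum>x\<in>fst p. Suc (fst x)) + (\<Sum>x\<in>snd p. fst x)} = frobenius_pairs k N n"
  proof -
    have eq: "card A + (k * N - card B) = k * N \<longleftrightarrow> card A = card B" if "B \<subseteq> ?S" for A B :: "(nat \<times> nat) set"
    proof -
      have "card B \<le> k * N" using card_mono[OF _ that] by (simp add: mult.commute)
      then show ?thesis by arith
    qed
    show ?thesis
    proof (intro set_eqI)
      fix p :: "(nat \<times> nat) set \<times> (nat \<times> nat) set"
      obtain A B where p: "p = (A, B)" by fastforce
      show "p \<in> {p \<in> Pow ?S \<times> Pow ?S. card (fst p) + (k * N - card (snd p)) = k * N \<and>
        n = (\<Sum>x\<in>fst p. Suc (fst x)) + (\<Sum>x\<in>snd p. fst x)} \<longleftrightarrow> p \<in> frobenius_pairs k N n"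
        unfolding p frobenius_pairs_def using eq[of B A] by (cases "B \<subseteq> ?S") (simp_all add: eq_commute[of n])
    qed
  qed
  finally show ?thesis .
qed

theorem cphi3_generating_function:
  "Abs_fps (\<lambda>n. of_nat (cphi 3 n)) * euler ^ 3 = qsum UNIV hexa (\<lambda>_. 1 :: 'a::idom)"
proof (rule agree_eqI)
  fix N
  let ?c = "coeff (triple_poly fps_X N ^ 3) (3 * N) :: 'a fps"
  have c: "agree N (?c * euler ^ 3) (qsum UNIV hexa (chi 1))"
    using constant_term_limit[of "1 :: 'a" N] by (simp add: twist_1 power3_eq_cube)
  have "agree N (Abs_fps (\<lambda>n. of_nat (cphi 3 n)) * euler ^ 3) (?c * euler ^ 3)"
    by (rule agree_mult[OF _ agree_refl])
       (simp add: agree_def coeff_triple_poly_power cphi_frobenius_pairs[where N = N])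
  from this c
  have "agree N (Abs_fps (\<lambda>n. of_nat (cphi 3 n)) * euler ^ 3) (qsum UNIV hexa (chi (1 :: 'a)))"
    by (rule agree_trans)
  moreover have "chi 1 = (\<lambda>_. 1 :: 'a)" by (auto simp: chi_def)
  ultimately show "agree N (Abs_fps (\<lambda>n. of_nat (cphi 3 n)) * euler ^ 3) (qsum UNIV hexa (\<lambda>_. 1 :: 'a))"
    by simp
qed

section \<open>Cubic theta series\<close>

text \<open>The norm on the hexagonal lattice shifted by (1/3, 1/3), minus 1/3.\<close>

definition hexc :: "int \<times> int \<Rightarrow> int" where
  "hexc = (\<lambda>(m, n). m * m + m * n + n * n + m + n)"

definition cubic_a :: "'a::comm_ring_1 fps" where
  "cubic_a = qsum UNIV hexa (\<lambda>_. 1)"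

text \<open>This is Borweins' theta function $c(q)$ without its factor $q^{1/3}$.\<close>

definition cubic_c :: "'a::comm_ring_1 fps" where
  "cubic_c = qsum UNIV hexc (\<lambda>_. 1)"

lemma hexa_hexc: "hexa (- x - 2 * y - 1, 2 * x + y + 1) = 3 * hexc (x, y) + 1"
  by (simp add: hexa_def hexc_def algebra_simps)

lemma admissible_hexc: "admissible UNIV hexc"
proof (rule admissibleI[where B = "\<lambda>n. {- 9 * int n - 9..9 * int n + 9} \<times> {- 9 * int n - 9..9 * int n + 9}"])
  fix n i assume *: "hexc i = int n"
  obtain x y where i: "i = (x, y)" by fastforce
  from hexa_bounds[where m = "- x - 2 * y - 1" and n = "2 * x + y + 1"] * i
  show "i \<in> {- 9 * int n - 9..9 * int n + 9} \<times> {- 9 * int n - 9..9 * int n + 9}"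
    unfolding hexa_hexc by auto
next
  fix i
  show "0 \<le> hexc i"
    using hexa_bounds(1)[where m = "- fst i - 2 * snd i - 1" and n = "2 * fst i + snd i + 1"]
    unfolding hexa_hexc by simp
qed auto

text \<open>Multiplication by sqrt(-3) maps the lattice onto the class of m - n = 0 modulo 3 and
  triples the norm. The other two classes are mirror images of each other, and each is a copy of the
  shifted lattice by \<open>hexa_hexc\<close>.\<close>

lemma hexa_chi_split:
  "qsum UNIV hexa (chi u) =
    subq 3 cubic_a + fps_const (u + u ^ 2) * (fps_X * subq 3 (cubic_c :: 'a::idom fps))"
proof -
  define S where "S r = {(m, n). (m - n) mod 3 = (r::int)}" for r
  have U: "UNIV = (S 0 \<union> S 1) \<union> S 2" unfolding S_def by auto
  have adm: "admissible T hexa" for T by (rule admissible_subset[OF admissible_hexa]) simp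
  have "qsum UNIV hexa (chi u) = qsum (S 0 \<union> S 1) hexa (chi u) + qsum (S 2) hexa (chi u)"
    by (subst U, rule qsum_Un[OF adm]) (auto simp: S_def)
  also have "qsum (S 0 \<union> S 1) hexa (chi u) = qsum (S 0) hexa (chi u) + qsum (S 1) hexa (chi u)"
    by (rule qsum_Un[OF adm]) (auto simp: S_def)
  also have "qsum (S 0) hexa (chi u) = qsum UNIV (\<lambda>i. int 3 * hexa i) (\<lambda>_. 1)"
  proof (rule qsum_reindex[of "\<lambda>(x, y). (x - y, x + 2 * y)"])
    show "bij_betw (\<lambda>(x, y). (x - y, x + 2 * y)) UNIV (S 0)"
      by (rule bij_betw_byWitness[where f' = "\<lambda>(m, n). ((n + 2 * m) div 3, (n - m) div 3)"])
         (auto simp: S_def algebra_simps, presburger+)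
  qed (auto simp: hexa_def chi_def algebra_simps)
  also have "\<dots> = subq 3 cubic_a" by (simp add: cubic_a_def qsum_subq)
  also have "qsum (S 1) hexa (chi u) = qsum UNIV (\<lambda>i. int 3 * hexc i + int 1) (\<lambda>_. u)"
  proof (rule qsum_reindex[of "\<lambda>(x, y). (- x - 2 * y - 1, 2 * x + y + 1)"])
    show "bij_betw (\<lambda>(x, y). (- x - 2 * y - 1, 2 * x + y + 1)) UNIV (S 1)"
      by (rule bij_betw_byWitness[where f' = "\<lambda>(m, n). ((m + 2 * n - 1) div 3, (- n - 2 * m - 1) div 3)"])
         (auto simp: S_def algebra_simps, presburger+)
    have "(- x - 2 * y - 1 - (2 * x + y + 1)) mod 3 = 1" for x y :: int by presburger
    then show "chi u (case i of (x, y) \<Rightarrow> (- x - 2 * y - 1, 2 * x + y + 1)) = u" for i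
      by (cases i) (simp add: chi_def)
  qed (auto simp: hexa_hexc)
  also have "\<dots> = fps_X ^ 1 * qsum UNIV (\<lambda>i. int 3 * hexc i) (\<lambda>_. u)"
    by (rule qsum_shift[symmetric]) (use admissible_hexc in \<open>auto simp: admissible_def\<close>)
  also have "qsum UNIV (\<lambda>i. int 3 * hexc i) (\<lambda>_. u) = subq 3 (fps_const u * cubic_c)"
    by (simp add: cubic_c_def qsum_cmult qsum_subq)
  also have "qsum (S 2) hexa (chi u) = qsum UNIV (\<lambda>i. int 3 * hexc i + int 1) (\<lambda>_. u ^ 2)"
  proof (rule qsum_reindex[of "\<lambda>(x, y). (2 * x + y + 1, - x - 2 * y - 1)"])
    show "bij_betw (\<lambda>(x, y). (2 * x + y + 1, - x - 2 * y - 1)) UNIV (S 2)"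
      by (rule bij_betw_byWitness[where f' = "\<lambda>(n, m). ((m + 2 * n - 1) div 3, (- n - 2 * m - 1) div 3)"])
         (auto simp: S_def algebra_simps, presburger+)
    have "((2 * x + y + 1) - (- x - 2 * y - 1)) mod 3 = 2" for x y :: int by presburger
    then show "chi u (case i of (x, y) \<Rightarrow> (2 * x + y + 1, - x - 2 * y - 1)) = u ^ 2" for i
      by (cases i) (simp add: chi_def)
    have sym: "hexa (n, m) = hexa (m, n)" for m n by (simp add: hexa_def algebra_simps)
    show "hexa (case i of (x, y) \<Rightarrow> (2 * x + y + 1, - x - 2 * y - 1)) = int 3 * hexc i + int 1" for i
      using sym[of "2 * fst i + snd i + 1" "- fst i - 2 * snd i - 1"] hexa_hexc[of "fst i" "snd i"]
      by (simp add: case_prod_unfold)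
  qed
  also have "\<dots> = fps_X ^ 1 * qsum UNIV (\<lambda>i. int 3 * hexc i) (\<lambda>_. u ^ 2)"
    by (rule qsum_shift[symmetric]) (use admissible_hexc in \<open>auto simp: admissible_def\<close>)
  also have "qsum UNIV (\<lambda>i. int 3 * hexc i) (\<lambda>_. u ^ 2) = subq 3 (fps_const (u ^ 2) * cubic_c)"
    by (simp add: cubic_c_def qsum_cmult qsum_subq)
  finally show ?thesis
    by (simp add: subq_simps fps_const_add[symmetric] algebra_simps del: fps_const_add)
qed

lemma cubic_a_split: "cubic_a = subq 3 cubic_a + 2 * (fps_X * subq 3 (cubic_c :: 'a::idom fps))"
proof -
  have "chi 1 = (\<lambda>_. 1 :: 'a)" by (auto simp: chi_def)
  then show ?thesis using hexa_chi_split[of "1 :: 'a"] by (simp add: cubic_a_def numeral_fps_const)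
qed

section \<open>Change of coefficient ring\<close>

text \<open>Used for two target rings: the complex numbers, where the map is injective and cube
  roots of unity exist, and the field with five elements.\<close>

definition cmap :: "int fps \<Rightarrow> 'a::comm_ring_1 fps" where
  "cmap F = Abs_fps (\<lambda>n. of_int (F $ n))"

lemma cmap_nth [simp]: "cmap F $ n = of_int (F $ n)"
  by (simp add: cmap_def)

lemma cmap_mult: "cmap (F * G) = cmap F * cmap G"
  by (simp add: fps_eq_iff fps_mult_nth)

lemma cmap_simps:
  "cmap (F + G) = cmap F + cmap G" "cmap (F - G) = cmap F - cmap G" "cmap 1 = 1"
  "cmap fps_X = fps_X" "cmap (fps_const c) = fps_const (of_int c)"
  by (simp_all add: fps_eq_iff fps_X_nth)

lemma cmap_numeral: "cmap (numeral k) = numeral k"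
  unfolding numeral_fps_const cmap_simps by simp

lemma cmap_power: "cmap (F ^ n) = cmap F ^ n"
  by (induction n) (simp_all add: cmap_simps cmap_mult)

lemma cmap_XD: "cmap (fps_XD F) = fps_XD (cmap F)"
  by (simp add: fps_eq_iff)

lemma cmap_subq: "cmap (subq k F) = subq k (cmap F :: 'a::idom fps)"
  by (simp add: fps_eq_iff fps_nth_compose_X_power)

lemma cmap_inj: "cmap F = (cmap G :: 'a::{ring_char_0, comm_ring_1} fps) \<Longrightarrow> F = G"
  by (simp add: fps_eq_iff)

lemma cmap_qfact: "cmap (qfact q n) = qfact (cmap q) n"
  by (induction n) (simp_all add: qfact_Suc cmap_simps cmap_mult cmap_power del: power_Suc)

lemma cmap_euler: "cmap euler = euler"
proof (rule fps_ext)
  fix n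
  show "cmap euler $ n = (euler :: 'a fps) $ n"
    using arg_cong[OF cmap_qfact[of fps_X n, where 'a = 'a], of "\<lambda>F. F $ n"]
    by (simp add: euler_def cmap_simps)
qed

lemma cmap_qsum: "cmap (qsum S Q w) = qsum S Q (\<lambda>i. of_int (w i))"
  by (simp add: fps_eq_iff qsum_nth)

lemma cmap_cubic: "cmap cubic_a = cubic_a" "cmap cubic_c = cubic_c"
  by (simp_all add: cubic_a_def cubic_c_def cmap_qsum)

section \<open>Product formulas for the cubic theta series\<close>

lemma exists_cube_root_of_unity: "\<exists>w :: complex. 1 + w + w * w = 0"
proof (intro exI)
  show "1 + Complex (-1/2) (sqrt 3 / 2) + Complex (-1/2) (sqrt 3 / 2) * Complex (-1/2) (sqrt 3 / 2) = 0"
    by (simp add: complex_eq_iff)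
qed

lemma euler_cube_cubic_complex:
  "euler ^ 3 = subq 3 euler * (subq 3 cubic_a - fps_X * subq 3 (cubic_c :: complex fps))"
proof -
  obtain w :: complex where w: "1 + w + w * w = 0" using exists_cube_root_of_unity by blast
  then have "w + w ^ 2 = - 1" by (simp add: power2_eq_square eq_neg_iff_add_eq_0 algebra_simps)
  then show ?thesis
    using euler_cube_twisted[of w] w hexa_chi_split[of w] by (simp add: power2_eq_square flip: fps_const_neg)
qed

theorem euler_cube_cubic:
  "euler ^ 3 = subq 3 euler * (subq 3 cubic_a - fps_X * subq 3 (cubic_c :: int fps))"
proof (rule cmap_inj)
  show "cmap (euler ^ 3) =
      (cmap (subq 3 euler * (subq 3 cubic_a - fps_X * subq 3 (cubic_c :: int fps))) :: complex fps)"
    using euler_cube_cubic_complex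
    by (simp add: cmap_mult cmap_simps cmap_power cmap_subq cmap_euler cmap_cubic)
qed

lemma parity_sign_simps: "parity_sign (- 1 - k) = - parity_sign k" "parity_sign (3 * k + 1) = - parity_sign k"
  "parity_sign (5 * k - 1) = - parity_sign k"
  by (simp_all add: parity_sign_def)

lemma bij_neg: "bij_betw (\<lambda>k. - 1 - k) UNIV (UNIV :: int set)"
  by (rule bij_betw_byWitness[where f' = "\<lambda>k. - 1 - k"]) auto

lemma tri_neg: "tri (- 1 - k) = tri k"
  by (simp add: tri_def algebra_simps)

lemma qsum_tri_parity: "qsum UNIV tri (parity_sign :: int \<Rightarrow> int) = 0"
proof -
  have "qsum UNIV tri (parity_sign :: int \<Rightarrow> int) = qsum UNIV tri (\<lambda>k. - 1 * parity_sign k)"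
    by (rule qsum_reindex[OF bij_neg]) (simp_all add: tri_neg parity_sign_simps)
  also have "\<dots> = - qsum UNIV tri parity_sign"
    unfolding qsum_cmult[symmetric] by (simp flip: fps_const_neg)
  finally have "2 * qsum UNIV tri (parity_sign :: int \<Rightarrow> int) = 0" by simp
  then show ?thesis by simp
qed

lemma jacobi_double: "2 * euler ^ 3 = qsum UNIV tri (\<lambda>k. parity_sign k * (2 * k + 1) :: int)"
proof -
  have "qsum UNIV tri (\<lambda>k. parity_sign k * (2 * k + 1) :: int) =
      fps_const 2 * qsum UNIV tri (\<lambda>k. parity_sign k * k) + qsum UNIV tri parity_sign"
    unfolding qsum_cmult qsum_add by (rule qsum_cong) (simp_all add: algebra_simps)
  then show ?thesis unfolding qsum_tri_parity jacobi by (simp add: numeral_fps_const)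
qed

lemma tri_mod_3: "tri k mod 3 = (if k mod 3 = 1 then 1 else 0)"
proof -
  have "2 * tri k mod 3 = (k mod 3) * ((k mod 3 + 1) mod 3) mod 3"
    unfolding two_tri by (simp add: mod_simps)
  moreover have "k mod 3 = 0 \<or> k mod 3 = 1 \<or> k mod 3 = 2" by presburger
  ultimately show ?thesis by (elim disjE) (simp_all; presburger)+
qed

lemma tri_3: "tri (3 * m + 1) = 9 * tri m + 1"
proof -
  have "2 * tri (3 * m + 1) = 2 * (9 * tri m + 1)"
    unfolding distrib_left mult.left_commute[of 2 9] two_tri by (simp add: algebra_simps)
  then show ?thesis by simp
qed

text \<open>A triangular number is 1 modulo 3 only for k = 3 m + 1, where it is
  \<open>9 * tri m + 1\<close>, so this part of Jacobi's series reproduces the whole series at q^9.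
  In the weight 3 m + 1 the summand 1 cancels by \<open>qsum_tri_parity\<close>.\<close>

lemma euler_cube_nth_1_mod_3:
  "euler ^ 3 $ (3 * n + 1) = - 3 * (subq 3 (euler ^ 3) :: int fps) $ n"
proof -
  let ?S = "{k. k mod 3 = (1::int)}"
  have "euler ^ 3 $ (3 * n + 1) = qsum ?S tri (\<lambda>k. parity_sign k * k :: int) $ (3 * n + 1)"
  proof -
    have "k mod 3 = 1" if "tri k = int (3 * n + 1)" for k
    proof (rule ccontr)
      assume "k mod 3 \<noteq> 1"
      then have "tri k mod 3 = 0" by (simp add: tri_mod_3)
      moreover have "(3 * int n + 1) mod 3 = 1" by presburger
      ultimately show False unfolding that by simp
    qed
    then have "{i. i \<in> UNIV \<and> tri i = int (3 * n + 1)} = {i. i \<in> ?S \<and> tri i = int (3 * n + 1)}" by auto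
    then show ?thesis unfolding jacobi qsum_nth by simp
  qed
  also have "qsum ?S tri (\<lambda>k. parity_sign k * k :: int) =
      qsum UNIV (\<lambda>m. int 9 * tri m + int 1) (\<lambda>m. - 1 * (parity_sign m * (3 * m + 1)))"
  proof (rule qsum_reindex[of "\<lambda>m. 3 * m + 1"])
    show "bij_betw (\<lambda>m. 3 * m + 1) UNIV ?S"
      by (rule bij_betw_byWitness[where f' = "\<lambda>k. k div 3"]) (auto, presburger+)
  qed (simp_all add: tri_3 parity_sign_simps)
  also have "\<dots> = fps_X ^ 1 * subq 9 (- 1 * qsum UNIV tri (\<lambda>m. parity_sign m * (3 * m + 1)))"
  proof -
    have "qsum UNIV tri (\<lambda>m. - 1 * (parity_sign m * (3 * m + 1)) :: int) = - 1 * qsum UNIV tri (\<lambda>m. parity_sign m * (3 * m + 1))"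
      unfolding qsum_cmult[symmetric] by (simp flip: fps_const_neg)
    then show ?thesis
      by (subst qsum_shift[symmetric], simp add: tri_bounds, subst qsum_subq[symmetric], simp, simp only:)
  qed
  also have "qsum UNIV tri (\<lambda>m. parity_sign m * (3 * m + 1)) = 3 * (euler ^ 3 :: int fps)"
  proof -
    have "qsum UNIV tri (\<lambda>k. parity_sign k * (3 * k + 1) :: int) =
        fps_const 3 * qsum UNIV tri (\<lambda>k. parity_sign k * k) + qsum UNIV tri parity_sign"
      unfolding qsum_cmult qsum_add by (rule qsum_cong) (simp_all add: algebra_simps)
    then show ?thesis unfolding qsum_tri_parity jacobi by (simp add: numeral_fps_const)
  qed
  finally have "euler ^ 3 $ (3 * n + 1) = (fps_X * subq 9 (- 1 * (3 * euler ^ 3)) :: int fps) $ (3 * n + 1)"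
    by simp
  also have "\<dots> = subq 9 (- 1 * (3 * euler ^ 3)) $ (3 * n)" by simp
  also have "\<dots> = (subq 3 (subq 3 (- 1 * (3 * euler ^ 3)))) $ (3 * n)" by (simp add: subq_subq)
  also have "\<dots> = subq 3 (- 1 * (3 * euler ^ 3)) $ n" by (rule subq_nth_mult) simp
  also have "- 1 * (3 * euler ^ 3) = fps_const (- 3) * (euler ^ 3 :: int fps)" by (simp add: numeral_fps_const flip: fps_const_neg)
  finally show ?thesis by (simp add: subq_simps)
qed

text \<open>Compare the exponents 1 modulo 3 in \<open>euler_cube_cubic\<close>: on the right only
  the summand with \<open>cubic_c\<close> has any.\<close>

theorem euler_mult_cubic_c: "euler * cubic_c = 3 * (subq 3 euler ^ 3 :: int fps)"
proof (rule fps_ext)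
  fix n
  let ?E = "euler :: int fps"
  have "?E ^ 3 = subq 3 (?E * cubic_a) - fps_X * subq 3 (?E * cubic_c)"
    using euler_cube_cubic by (simp add: subq_simps algebra_simps)
  then have "?E ^ 3 $ (3 * n + 1) = subq 3 (?E * cubic_a) $ (3 * n + 1) - (fps_X * subq 3 (?E * cubic_c)) $ (3 * n + 1)"
    by (metis fps_sub_nth)
  moreover have "\<not> 3 dvd 3 * n + 1" by presburger
  then have "subq 3 (?E * cubic_a) $ (3 * n + 1) = 0" by (simp only: fps_nth_compose_X_power if_False)
  moreover have "(fps_X * subq 3 (?E * cubic_c)) $ (3 * n + 1) = (?E * cubic_c) $ n"
    using subq_nth_mult[of 3 "?E * cubic_c" n] by simp
  ultimately show "(?E * cubic_c) $ n = (3 * subq 3 ?E ^ 3) $ n"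
    unfolding euler_cube_nth_1_mod_3 by (simp add: subq_simps numeral_fps_const)
qed

section \<open>The norm over the cube roots of unity and the relation of the cubes\<close>

lemma cube_root_of_unity:
  fixes w :: "'a::comm_ring_1"
  assumes "1 + w + w * w = 0"
  shows "w * w = - 1 - w" "w * (w * x) = - x - w * x" "w ^ 3 = 1" "(w * w) ^ 3 = 1" "w * w * (w * w) = w"
proof -
  show 1: "w * w = - 1 - w" using assms by (simp add: eq_neg_iff_add_eq_0 algebra_simps)
  show "w * (w * x) = - x - w * x" for x
    unfolding mult.assoc[symmetric] 1 by (simp add: algebra_simps)
  have "w ^ 3 - 1 = (w - 1) * (1 + w + w * w)" by (simp add: algebra_simps power3_eq_cube)
  then show 3: "w ^ 3 = 1" unfolding assms by simp
  show "(w * w) ^ 3 = 1" unfolding power_mult_distrib 3 by simp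
  have "w * w * (w * w) = w * w ^ 3" by (simp add: power3_eq_cube mult_ac)
  then show "w * w * (w * w) = w" unfolding 3 by simp
qed

text \<open>For each exponent n the three factors multiply to 1 - q^(3 n), except that they are
  equal and give (1 - q^n)^3 if 3 divides n. Hence the induction advances by three exponents at a
  time.\<close>

lemma qfact_cubic_norm:
  fixes w q :: "'a::comm_ring_1"
  assumes "1 + w + w * w = 0"
  shows "qfact q (3 * K) * qfact (w * q) (3 * K) * qfact (w * w * q) (3 * K) * qfact (q ^ 9) K =
    qfact (q ^ 3) (3 * K) * qfact (q ^ 3) K ^ 3"
proof (induction K)
  case (Suc K)
  note W = cube_root_of_unity[OF assms]
  have f: "(1 - a) * (1 - w * a) * (1 - w * w * a) = 1 - a ^ 3" for a
    by (simp add: algebra_simps W(1,2) power3_eq_cube)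
  define x y z where "x = q ^ Suc (3 * K)" and "y = q ^ Suc (Suc (3 * K))" and "z = q ^ Suc (Suc (Suc (3 * K)))"
  have p3: "w ^ (3 * K) = 1" by (simp add: power_mult W(3))
  have p: "w ^ Suc (3 * K) = w" "w ^ Suc (Suc (3 * K)) = w * w" "w ^ Suc (Suc (Suc (3 * K))) = 1"
    unfolding power_Suc p3 using W(3) by (simp_all add: power3_eq_cube mult_ac)
  have 1: "(w * q) ^ Suc (3 * K) = w * x" "(w * w * q) ^ Suc (3 * K) = w * w * x"
    unfolding x_def power_mult_distrib p by simp_all
  have 2: "(w * q) ^ Suc (Suc (3 * K)) = w * w * y" "(w * w * q) ^ Suc (Suc (3 * K)) = w * y"
    unfolding y_def power_mult_distrib p W(5) by simp_all
  have 3: "(w * q) ^ Suc (Suc (Suc (3 * K))) = z" "(w * w * q) ^ Suc (Suc (Suc (3 * K))) = z"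
    unfolding z_def power_mult_distrib p by simp_all
  have S: "3 * Suc K = Suc (Suc (Suc (3 * K)))" by simp
  have q: "(q ^ 3) ^ Suc (3 * K) = x ^ 3" "(q ^ 3) ^ Suc (Suc (3 * K)) = y ^ 3" "(q ^ 3) ^ Suc (Suc (Suc (3 * K))) = z ^ 3"
    unfolding x_def y_def z_def power_mult[symmetric] by (simp_all only: mult.commute)
  have q': "(q ^ 3) ^ Suc K = z" unfolding z_def S[symmetric] power_mult ..
  have q9: "(q ^ 9) ^ Suc K = z ^ 3"
    unfolding z_def S[symmetric] power_mult[symmetric] by (simp add: algebra_simps)
  have "qfact q (3 * Suc K) * qfact (w * q) (3 * Suc K) * qfact (w * w * q) (3 * Suc K) * qfact (q ^ 9) (Suc K) =
      (qfact q (3 * K) * qfact (w * q) (3 * K) * qfact (w * w * q) (3 * K) * qfact (q ^ 9) K) *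
      (((1 - x) * (1 - w * x) * (1 - w * w * x)) * ((1 - y) * (1 - w * y) * (1 - w * w * y)) * (1 - z) ^ 3 * (1 - z ^ 3))"
    unfolding S qfact_Suc 1 2 3 q9 x_def[symmetric] y_def[symmetric] z_def[symmetric]
    by (simp only: power3_eq_cube mult_ac)
  also have "\<dots> = (qfact (q ^ 3) (3 * K) * qfact (q ^ 3) K ^ 3) * ((1 - x ^ 3) * (1 - y ^ 3) * (1 - z) ^ 3 * (1 - z ^ 3))"
    unfolding Suc.IH f ..
  also have "\<dots> = qfact (q ^ 3) (3 * Suc K) * qfact (q ^ 3) (Suc K) ^ 3"
    unfolding S qfact_Suc q q' by (simp only: power_mult_distrib mult_ac)
  finally show ?case .
qed simp

text \<open>The norm of \<open>euler_cube_cubic\<close> under the rotations of q by cube roots of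
  unity: these fix every series in q^3, so the right side becomes a difference of cubes, and the
  left side is known from the product.\<close>

theorem cubic_cubes: "euler ^ 9 = subq 3 euler ^ 3 * (cubic_a ^ 3 - fps_X * (cubic_c :: int fps) ^ 3)"
proof (rule cmap_inj)
  obtain w :: complex where w: "1 + w + w * w = 0" using exists_cube_root_of_unity by blast
  define rot where "rot u F = F oo (fps_const u * fps_X)" for u :: complex and F :: "complex fps"
  let ?E = "euler :: complex fps" and ?a = "subq 3 cubic_a :: complex fps" and ?c = "subq 3 cubic_c :: complex fps"
  note w3 = cube_root_of_unity(3,4)[OF w]
  have rot_simps: "rot u (F * G) = rot u F * rot u G" "rot u (F ^ n) = rot u F ^ n" "rot u (F - G) = rot u F - rot u G"
    "rot u fps_X = fps_const u * fps_X" for u F G n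
    by (simp_all add: rot_def fps_compose_mult_distrib fps_compose_power fps_compose_sub_distrib)
  have rot_subq: "rot u (subq 3 F) = subq 3 F" if "u ^ 3 = 1" for u F
  proof (rule fps_ext)
    fix n
    show "rot u (subq 3 F) $ n = subq 3 F $ n"
    proof (cases "3 dvd n")
      case True
      then obtain k where "n = 3 * k" by blast
      then show ?thesis using that by (simp add: rot_def power_mult)
    next
      case False
      then show ?thesis by (simp add: rot_def fps_nth_compose_X_power)
    qed
  qed
  have rot_qfact: "rot u (qfact fps_X n) = qfact (fps_const u * fps_X) n" for u n
    by (induction n) (simp_all add: qfact_Suc rot_simps del: power_Suc, simp_all add: rot_def)
  have agree_rot: "agree (Suc M) (rot u ?E) (qfact (fps_const u * fps_X) M)" for u M
    unfolding rot_qfact[symmetric] using agree_euler[of M, where 'a = complex] by (simp add: agree_def rot_def)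
  have norm: "?E * rot w ?E * rot (w * w) ?E * subq 9 ?E = subq 3 ?E ^ 4"
  proof (rule agree_eqI)
    fix M
    let ?W = "fps_const w" and ?X = "fps_X :: complex fps"
    have W: "1 + ?W + ?W * ?W = 0" using arg_cong[OF w, of fps_const] by (simp flip: fps_const_add fps_const_mult)
    have "agree M (?E * rot w ?E * rot (w * w) ?E * subq 9 ?E)
        (qfact ?X (3 * M) * qfact (fps_const w * ?X) (3 * M) * qfact (fps_const (w * w) * ?X) (3 * M) * qfact (?X ^ 9) M)"
      by (intro agree_mult agree_mono[OF agree_euler] agree_mono[OF agree_rot] agree_mono[OF agree_subq_euler]) auto
    also have "fps_const (w * w) = ?W * ?W" by simp
    also have "qfact ?X (3 * M) * qfact (fps_const w * ?X) (3 * M) * qfact (?W * ?W * ?X) (3 * M) * qfact (?X ^ 9) M =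
        qfact (?X ^ 3) (3 * M) * qfact (?X ^ 3) M ^ 3"
      by (rule qfact_cubic_norm[OF W])
    also have "agree M \<dots> (subq 3 ?E * subq 3 ?E ^ 3)"
      by (intro agree_mult agree_power agree_mono[OF agree_sym[OF agree_subq_euler]]) auto
    finally show "agree M (?E * rot w ?E * rot (w * w) ?E * subq 9 ?E) (subq 3 ?E ^ 4)"
      using power_Suc[of "subq 3 ?E" 3] by simp
  qed
  have e0: "?E ^ 3 = subq 3 ?E * (?a - fps_X * ?c)" by (rule euler_cube_cubic_complex)
  have e: "rot u ?E ^ 3 = subq 3 ?E * (?a - fps_const u * (fps_X * ?c))" if "u ^ 3 = 1" for u
    using arg_cong[OF e0, of "rot u"] by (simp add: rot_simps rot_subq[OF that] mult.assoc)
  have fac: "(x - y) * (x - fps_const w * y) * (x - fps_const (w * w) * y) = x ^ 3 - y ^ 3" for x y :: "complex fps"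
  proof -
    have W: "1 + fps_const w + fps_const w * fps_const w = 0"
      using arg_cong[OF w, of fps_const] by (simp flip: fps_const_add fps_const_mult)
    show ?thesis
      unfolding fps_const_mult[symmetric]
      by (simp add: algebra_simps cube_root_of_unity(1,2)[OF W] power3_eq_cube del: fps_const_mult)
  qed
  have "(?E * rot w ?E * rot (w * w) ?E) ^ 3 = ?E ^ 3 * rot w ?E ^ 3 * rot (w * w) ?E ^ 3"
    by (simp only: power_mult_distrib)
  also have "\<dots> = subq 3 ?E ^ 3 * ((?a - fps_X * ?c) * (?a - fps_const w * (fps_X * ?c)) * (?a - fps_const (w * w) * (fps_X * ?c)))"
    unfolding e0 e[OF w3(1)] e[OF w3(2)] by (simp only: power3_eq_cube mult_ac)
  also have "\<dots> = subq 3 ?E ^ 3 * (?a ^ 3 - (fps_X * ?c) ^ 3)" unfolding fac ..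
  finally have 1: "(?E * rot w ?E * rot (w * w) ?E) ^ 3 = subq 3 ?E ^ 3 * (?a ^ 3 - (fps_X * ?c) ^ 3)" .
  have "subq 3 ?E ^ 3 * subq 3 ?E ^ 9 = (subq 3 ?E ^ 4) ^ 3"
    by (simp flip: power_add power_mult)
  also have "\<dots> = (?E * rot w ?E * rot (w * w) ?E) ^ 3 * subq 9 ?E ^ 3"
    unfolding norm[symmetric] by (simp only: power_mult_distrib)
  also have "\<dots> = subq 3 ?E ^ 3 * (subq 9 ?E ^ 3 * (?a ^ 3 - (fps_X * ?c) ^ 3))"
    unfolding 1 by (simp only: mult_ac)
  finally have 2: "subq 3 ?E ^ 3 * subq 3 ?E ^ 9 = subq 3 ?E ^ 3 * (subq 9 ?E ^ 3 * (?a ^ 3 - (fps_X * ?c) ^ 3))" .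
  have "subq 3 ?E $ 0 = 1" by (rule subq_euler_nth_0) simp
  then have "subq 3 ?E \<noteq> 0" by (metis fps_zero_nth zero_neq_one)
  then have "subq 3 ?E ^ 3 \<noteq> 0" by simp
  then have "subq 3 ?E ^ 9 = subq 9 ?E ^ 3 * (?a ^ 3 - (fps_X * ?c) ^ 3)"
    using 2 mult_left_cancel by blast
  also have "\<dots> = subq 3 (subq 3 ?E ^ 3 * (cubic_a ^ 3 - fps_X * cubic_c ^ 3))"
    by (simp add: subq_simps subq_subq power_mult_distrib)
  finally have "subq 3 (?E ^ 9) = subq 3 (subq 3 ?E ^ 3 * (cubic_a ^ 3 - fps_X * cubic_c ^ 3))"
    by (simp add: subq_simps)
  then have "?E ^ 9 = subq 3 ?E ^ 3 * (cubic_a ^ 3 - fps_X * cubic_c ^ 3)" by (rule subq_inj[rotated]) simp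
  then show "cmap (euler ^ 9) = (cmap (subq 3 euler ^ 3 * (cubic_a ^ 3 - fps_X * (cubic_c :: int fps) ^ 3)) :: complex fps)"
    by (simp add: cmap_mult cmap_simps cmap_power cmap_subq cmap_euler cmap_cubic)
qed

section \<open>The Wronskian of the cubic theta series\<close>

text \<open>Sum and difference of the indices separate the variables of a symmetric quadratic
  exponent, at the price of a distinction by parity.\<close>

lemma qsum_parity_split:
  assumes "admissible UNIV Q"
    "\<And>l j. Q (l + j, l - j) = F0 l + G0 j" "\<And>l j. Q (l + j + 1, l - j) = F1 l + G1 j"
  shows "qsum UNIV Q v = qsum UNIV (\<lambda>(l, j). F0 l + G0 j) (\<lambda>(l, j). v (l + j, l - j :: int)) +
    qsum UNIV (\<lambda>(l, j). F1 l + G1 j) (\<lambda>(l, j). v (l + j + 1, l - j))"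
proof -
  let ?S = "{(m, n). even (m - n :: int)}" and ?T = "{(m, n). odd (m - n :: int)}"
  have U: "UNIV = ?S \<union> ?T" by auto
  have "qsum UNIV Q v = qsum ?S Q v + qsum ?T Q v"
    by (subst U, rule qsum_Un) (use assms(1) U in auto)
  also have "qsum ?S Q v = qsum UNIV (\<lambda>(l, j). F0 l + G0 j) (\<lambda>(l, j). v (l + j, l - j))"
  proof (rule qsum_reindex[of "\<lambda>(l, j). (l + j, l - j)"])
    show "bij_betw (\<lambda>(l, j). (l + j, l - j)) UNIV ?S"
      by (rule bij_betw_byWitness[where f' = "\<lambda>(m, n). ((m + n) div 2, (m - n) div 2)"]) (auto, presburger+)
  qed (auto simp: assms(2))
  also have "qsum ?T Q v = qsum UNIV (\<lambda>(l, j). F1 l + G1 j) (\<lambda>(l, j). v (l + j + 1, l - j))"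
  proof (rule qsum_reindex[of "\<lambda>(l, j). (l + j + 1, l - j)"])
    show "bij_betw (\<lambda>(l, j). (l + j + 1, l - j)) UNIV ?T"
      by (rule bij_betw_byWitness[where f' = "\<lambda>(m, n). ((m + n - 1) div 2, (m - n - 1) div 2)"]) (auto, presburger+)
  qed (auto simp: assms(3))
  finally show ?thesis .
qed

lemma qsum_prod:
  assumes "admissible UNIV F" "admissible UNIV G"
  shows "qsum UNIV (\<lambda>(l, j). F l + G j) (\<lambda>(l, j). a l * b j) = qsum UNIV F a * qsum UNIV G b"
  using qsum_mult[OF assms, of a b] by simp

lemma qsum_prod':
  assumes "admissible UNIV F" "admissible UNIV G"
  shows "qsum UNIV (\<lambda>(l, j). F l + G j) (\<lambda>(l, j). b j) = qsum UNIV F (\<lambda>_. 1) * qsum UNIV G b"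
    "qsum UNIV (\<lambda>(l, j). F l + G j) (\<lambda>(l, j). a l) = qsum UNIV F a * qsum UNIV G (\<lambda>_. 1)"
  using qsum_prod[OF assms, of "\<lambda>_. 1"] qsum_prod[OF assms, of _ "\<lambda>_. 1"] by simp_all

lemma admissible_linear_bound:
  assumes "\<And>l. \<bar>l\<bar> \<le> F l + 1" "\<And>l. 0 \<le> F l"
  shows "admissible UNIV (F :: int \<Rightarrow> int)"
proof (rule admissibleI[where B = "\<lambda>n. {- int n - 1..int n + 1}"])
  fix n i assume "F i = int n"
  then show "i \<in> {- int n - 1..int n + 1}" using assms(1)[of i] by auto
qed (use assms in auto)

lemma admissible_quadratics:
  "admissible UNIV (\<lambda>j::int. j * j)" "admissible UNIV (\<lambda>j::int. j * j + j)"
  "admissible UNIV (\<lambda>j::int. 3 * (j * j))" "admissible UNIV (\<lambda>j::int. 3 * (j * j) + 3 * j + 1)"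
  "admissible UNIV (\<lambda>j::int. 3 * (j * j) + 2 * j)" "admissible UNIV (\<lambda>j::int. 3 * (j * j) - j)"
  "admissible UNIV (\<lambda>j::int. j * j + 2 * j + 1)" "admissible UNIV (\<lambda>j::int. 3 * (j * j) + 5 * j + 2)"
proof -
  note sq = abs_le_square
  show "admissible UNIV (\<lambda>j::int. j * j)"
    by (rule admissible_linear_bound) (use sq in \<open>simp_all add: add_increasing2\<close>)
  have 2: "\<bar>j\<bar> \<le> j * j + j + 1" "0 \<le> j * j + j" for j :: int
    using sq[of "j + 1"] sq[of j] by (auto simp: algebra_simps abs_if split: if_splits)
  then show "admissible UNIV (\<lambda>j::int. j * j + j)" by (intro admissible_linear_bound)
  have "\<bar>j\<bar> \<le> 3 * (j * j) + 1" "0 \<le> 3 * (j * j)" for j :: int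
    using sq[of j] by (auto simp: abs_if split: if_splits)
  then show "admissible UNIV (\<lambda>j::int. 3 * (j * j))" by (intro admissible_linear_bound)
  have "\<bar>j\<bar> \<le> 3 * (j * j) + 3 * j + 1 + 1" "0 \<le> 3 * (j * j) + 3 * j + 1" for j :: int
    using 2[of j] by (auto simp: abs_if split: if_splits)
  then show "admissible UNIV (\<lambda>j::int. 3 * (j * j) + 3 * j + 1)" by (intro admissible_linear_bound)
  have "\<bar>j\<bar> \<le> 3 * (j * j) + 2 * j + 1" "0 \<le> 3 * (j * j) + 2 * j" for j :: int
    using sq[of j] by (auto simp: abs_if split: if_splits)
  then show "admissible UNIV (\<lambda>j::int. 3 * (j * j) + 2 * j)" by (intro admissible_linear_bound)
  have "\<bar>j\<bar> \<le> 3 * (j * j) - j + 1" "0 \<le> 3 * (j * j) - j" for j :: int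
    using sq[of j] by (auto simp: abs_if split: if_splits)
  then show "admissible UNIV (\<lambda>j::int. 3 * (j * j) - j)" by (intro admissible_linear_bound)
  have 7: "\<bar>j\<bar> \<le> j * j + 2 * j + 1 + 1" "0 \<le> j * j + 2 * j + 1" for j :: int
    using sq[of "j + 1"] by (auto simp: algebra_simps abs_if split: if_splits)
  then show "admissible UNIV (\<lambda>j::int. j * j + 2 * j + 1)" by (intro admissible_linear_bound)
  have "\<bar>j\<bar> \<le> 3 * (j * j) + 5 * j + 2 + 1" "0 \<le> 3 * (j * j) + 5 * j + 2" for j :: int
    using sq[of "j + 1"] by (auto simp: algebra_simps abs_if split: if_splits)
  then show "admissible UNIV (\<lambda>j::int. 3 * (j * j) + 5 * j + 2)" by (intro admissible_linear_bound)
qed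

abbreviation "theta_even w \<equiv> qsum UNIV (\<lambda>j::int. j * j) (w :: int \<Rightarrow> int)"
abbreviation "theta_odd w \<equiv> qsum UNIV (\<lambda>j::int. j * j + j) (w :: int \<Rightarrow> int)"

lemma cubic_a_parity:
  "qsum UNIV hexa (\<lambda>(m, n). w (m - n)) =
     qsum UNIV (\<lambda>l. 3 * (l * l)) (\<lambda>_. 1) * theta_even (\<lambda>j. w (2 * j)) +
     qsum UNIV (\<lambda>l. 3 * (l * l) + 3 * l + 1) (\<lambda>_. 1) * theta_odd (\<lambda>j. w (2 * j + 1))"
proof -
  have "qsum UNIV hexa (\<lambda>(m, n). w (m - n)) =
    qsum UNIV (\<lambda>(l, j). 3 * (l * l) + j * j) (\<lambda>(l, j). w (2 * j)) +
    qsum UNIV (\<lambda>(l, j). (3 * (l * l) + 3 * l + 1) + (j * j + j)) (\<lambda>(l, j). w (2 * j + 1))"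
    by (subst qsum_parity_split[OF admissible_hexa, where ?F0.0 = "\<lambda>l. 3 * (l * l)" and ?G0.0 = "\<lambda>j. j * j"
        and ?F1.0 = "\<lambda>l. 3 * (l * l) + 3 * l + 1" and ?G1.0 = "\<lambda>j. j * j + j"])
       (simp_all add: hexa_def algebra_simps)
  then show ?thesis by (simp only: qsum_prod' admissible_quadratics)
qed

lemma cubic_c_parity:
  "qsum UNIV hexc (\<lambda>(m, n). w (m - n)) =
     qsum UNIV (\<lambda>l. 3 * (l * l) + 2 * l) (\<lambda>_. 1) * theta_even (\<lambda>j. w (2 * j)) +
     qsum UNIV (\<lambda>l. 3 * (l * l) - l) (\<lambda>_. 1) * theta_odd (\<lambda>j. w (2 * j + 1))"
proof -
  have "qsum UNIV hexc (\<lambda>(m, n). w (m - n)) =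
    qsum UNIV (\<lambda>(l, j). (3 * (l * l) + 2 * l) + j * j) (\<lambda>(l, j). w (2 * j)) +
    qsum UNIV (\<lambda>(l, j). (3 * (l * l) + 5 * l + 2) + (j * j + j)) (\<lambda>(l, j). w (2 * j + 1))"
    by (subst qsum_parity_split[OF admissible_hexc, where ?F0.0 = "\<lambda>l. 3 * (l * l) + 2 * l" and ?G0.0 = "\<lambda>j. j * j"
        and ?F1.0 = "\<lambda>l. 3 * (l * l) + 5 * l + 2" and ?G1.0 = "\<lambda>j. j * j + j"])
       (simp_all add: hexc_def algebra_simps)
  moreover have "qsum UNIV (\<lambda>l::int. 3 * (l * l) - l) (\<lambda>_. 1 :: int) = qsum UNIV (\<lambda>l. 3 * (l * l) + 5 * l + 2) (\<lambda>_. 1)"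
  proof (rule qsum_reindex[of "\<lambda>l. l + 1"])
    show "bij_betw (\<lambda>l. l + 1) UNIV (UNIV :: int set)"
      by (rule bij_betw_byWitness[where f' = "\<lambda>l. l - 1"]) auto
  qed (simp_all add: algebra_simps)
  ultimately show ?thesis by (simp only: qsum_prod' admissible_quadratics)
qed

lemma admissible_pair_sum:
  assumes "admissible UNIV F" "admissible UNIV G"
  shows "admissible UNIV (\<lambda>(i, j). F i + G j)"
proof (rule admissibleI[where B = "\<lambda>n. (\<Union>k\<in>{..n}. {i. F i = int k}) \<times> (\<Union>k\<in>{..n}. {j. G j = int k})"])
  fix n p assume *: "(case p of (i, j) \<Rightarrow> F i + G j) = int n"
  obtain i j where p: "p = (i, j)" by fastforce
  have "0 \<le> F i" "0 \<le> G j" using assms by (auto simp: admissible_def)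
  then have "nat (F i) \<le> n" "nat (G j) \<le> n" "F i = int (nat (F i))" "G j = int (nat (G j))"
    using * p by auto
  then show "p \<in> (\<Union>k\<in>{..n}. {i. F i = int k}) \<times> (\<Union>k\<in>{..n}. {j. G j = int k})"
    unfolding p by blast
next
  show "finite ((\<Union>k\<in>{..n}. {i. F i = int k}) \<times> (\<Union>k\<in>{..n}. {j. G j = int k}))" for n
    using assms unfolding admissible_def by auto
qed (use assms in \<open>auto simp: admissible_def\<close>)

lemma parity_sign_mult: "parity_sign j * parity_sign k = (parity_sign (j + k) :: 'a::comm_ring_1)"
  by (auto simp: parity_sign_def)

text \<open>The four series are the coefficients in \<open>cubic_a_parity\<close> and
  \<open>cubic_c_parity\<close>, and this is their determinant.\<close>

lemma euler_square:
  "euler ^ 2 = qsum UNIV (\<lambda>l. 3 * (l * l)) (\<lambda>_. 1) * qsum UNIV (\<lambda>l. 3 * (l * l) - l) (\<lambda>_. 1) -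
    qsum UNIV (\<lambda>l. 3 * (l * l) + 3 * l + 1) (\<lambda>_. 1) * (qsum UNIV (\<lambda>l. 3 * (l * l) + 2 * l) (\<lambda>_. 1) :: int fps)"
proof -
  have p0: "penta (l + j) + penta (l - j) = (3 * (l * l) - l) + 3 * (j * j)" for l j
  proof -
    have "2 * (penta (l + j) + penta (l - j)) = 2 * ((3 * (l * l) - l) + 3 * (j * j))"
      unfolding distrib_left[of 2] two_penta by (simp add: algebra_simps)
    then show ?thesis by simp
  qed
  have p1: "penta (l + j + 1) + penta (l - j) = (3 * (l * l) + 2 * l) + (3 * (j * j) + 3 * j + 1)" for l j
  proof -
    have "2 * (penta (l + j + 1) + penta (l - j)) = 2 * ((3 * (l * l) + 2 * l) + (3 * (j * j) + 3 * j + 1))"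
      unfolding distrib_left[of 2] two_penta by (simp add: algebra_simps)
    then show ?thesis by simp
  qed
  have "euler ^ 2 = qsum UNIV (\<lambda>(k, l). penta k + penta l) (\<lambda>(k, l). parity_sign (k + l) :: int)"
    unfolding power2_eq_square pentagonal qsum_mult[OF admissible_penta admissible_penta] by (simp add: parity_sign_mult)
  also have "\<dots> = qsum UNIV (\<lambda>(l, j). (3 * (l * l) - l) + 3 * (j * j)) (\<lambda>(l, j). 1) +
      qsum UNIV (\<lambda>(l, j). (3 * (l * l) + 2 * l) + (3 * (j * j) + 3 * j + 1)) (\<lambda>(l, j). - 1)"
    by (subst qsum_parity_split[OF admissible_pair_sum[OF admissible_penta admissible_penta],
        where ?F0.0 = "\<lambda>l. 3 * (l * l) - l" and ?G0.0 = "\<lambda>j. 3 * (j * j)"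
        and ?F1.0 = "\<lambda>l. 3 * (l * l) + 2 * l" and ?G1.0 = "\<lambda>j. 3 * (j * j) + 3 * j + 1"])
       (simp_all only: case_prod_conv p0 p1, simp add: parity_sign_def case_prod_unfold)
  also have "qsum UNIV (\<lambda>(l, j). (3 * (l * l) - l) + 3 * (j * j)) (\<lambda>(l, j). 1 :: int) =
      qsum UNIV (\<lambda>l. 3 * (l * l) - l) (\<lambda>_. 1) * qsum UNIV (\<lambda>l. 3 * (l * l)) (\<lambda>_. 1)"
    by (simp only: qsum_prod' admissible_quadratics)
  also have "qsum UNIV (\<lambda>(l, j). (3 * (l * l) + 2 * l) + (3 * (j * j) + 3 * j + 1)) (\<lambda>(l, j). - 1 :: int) =
      qsum UNIV (\<lambda>l. 3 * (l * l) + 2 * l) (\<lambda>_. 1) * qsum UNIV (\<lambda>l. 3 * (l * l) + 3 * l + 1) (\<lambda>_. - 1)"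
    by (simp only: qsum_prod' admissible_quadratics)
  also have "qsum UNIV (\<lambda>l. 3 * (l * l) + 3 * l + 1) (\<lambda>_. - 1 :: int) = - qsum UNIV (\<lambda>l. 3 * (l * l) + 3 * l + 1) (\<lambda>_. 1)"
    using qsum_cmult[of "- 1 :: int" UNIV "\<lambda>l. 3 * (l * l) + 3 * l + 1" "\<lambda>_. 1"] by (simp flip: fps_const_neg)
  finally show ?thesis by (simp add: mult.commute)
qed

text \<open>In the square of Jacobi's series the weights multiply to (2 l + 1)^2 - (2 j)^2 for an
  even difference of the indices, and similarly for an odd one. So each parity yields the same
  determinant of theta series and second moments.\<close>

lemma euler_sixth:
  "2 * euler ^ 6 = theta_even (\<lambda>_. 1) * theta_odd (\<lambda>j. (2 * j + 1) ^ 2) -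
    theta_even (\<lambda>j. (2 * j) ^ 2) * theta_odd (\<lambda>_. 1)"
proof -
  have p0: "tri (l + j) + tri (l - j) = (l * l + l) + j * j" for l j
  proof -
    have "2 * (tri (l + j) + tri (l - j)) = 2 * ((l * l + l) + j * j)"
      unfolding distrib_left[of 2] two_tri by (simp add: algebra_simps)
    then show ?thesis by simp
  qed
  have p1: "tri (l + j + 1) + tri (l - j) = (l * l + 2 * l + 1) + (j * j + j)" for l j
  proof -
    have "2 * (tri (l + j + 1) + tri (l - j)) = 2 * ((l * l + 2 * l + 1) + (j * j + j))"
      unfolding distrib_left[of 2] two_tri by (simp add: algebra_simps)
    then show ?thesis by simp
  qed
  let ?v = "\<lambda>(k, l). parity_sign (k + l) * ((2 * k + 1) * (2 * l + 1)) :: int"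
  have "(2 * euler ^ 3) ^ 2 = qsum UNIV (\<lambda>(k, l). tri k + tri l) ?v"
    unfolding power2_eq_square jacobi_double qsum_mult[OF admissible_tri admissible_tri] UNIV_Times_UNIV
    by (rule qsum_cong) (auto simp: mult_ac simp flip: parity_sign_mult)
  also have "\<dots> = qsum UNIV (\<lambda>(l, j). (l * l + l) + j * j) (\<lambda>(l, j). (2 * l + 1) ^ 2 - (2 * j) ^ 2) +
      qsum UNIV (\<lambda>(l, j). (l * l + 2 * l + 1) + (j * j + j)) (\<lambda>(l, j). (2 * j + 1) ^ 2 - (2 * (l + 1)) ^ 2)"
    by (subst qsum_parity_split[OF admissible_pair_sum[OF admissible_tri admissible_tri],
        where ?F0.0 = "\<lambda>l. l * l + l" and ?G0.0 = "\<lambda>j. j * j"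
        and ?F1.0 = "\<lambda>l. l * l + 2 * l + 1" and ?G1.0 = "\<lambda>j. j * j + j"])
       (simp_all only: case_prod_conv p0 p1, simp add: parity_sign_def case_prod_unfold power2_eq_square algebra_simps)
  also have "qsum UNIV (\<lambda>(l, j). (l * l + l) + j * j) (\<lambda>(l, j). (2 * l + 1) ^ 2 - (2 * j) ^ 2 :: int) =
      theta_odd (\<lambda>j. (2 * j + 1) ^ 2) * theta_even (\<lambda>_. 1) - theta_odd (\<lambda>_. 1) * theta_even (\<lambda>j. (2 * j) ^ 2)"
    unfolding qsum_prod'[OF admissible_quadratics(2,1), symmetric] qsum_diff by (simp add: case_prod_unfold)
  also have "qsum UNIV (\<lambda>(l, j). (l * l + 2 * l + 1) + (j * j + j)) (\<lambda>(l, j). (2 * j + 1) ^ 2 - (2 * (l + 1)) ^ 2 :: int) =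
      qsum UNIV (\<lambda>l. l * l + 2 * l + 1) (\<lambda>_. 1) * theta_odd (\<lambda>j. (2 * j + 1) ^ 2) -
      qsum UNIV (\<lambda>l. l * l + 2 * l + 1) (\<lambda>l. (2 * (l + 1)) ^ 2) * theta_odd (\<lambda>_. 1)"
    unfolding qsum_prod'[OF admissible_quadratics(7,2), symmetric] qsum_diff by (simp add: case_prod_unfold)
  also have shift: "qsum UNIV (\<lambda>l. l * l + 2 * l + 1) (\<lambda>l. w (l + 1)) = theta_even w" for w
  proof (rule qsum_reindex[of "\<lambda>l. l + 1", symmetric])
    show "bij_betw (\<lambda>l. l + 1) UNIV (UNIV :: int set)"
      by (rule bij_betw_byWitness[where f' = "\<lambda>l. l - 1"]) auto
  qed (simp_all add: algebra_simps)
  note shift[of "\<lambda>_. 1"]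
  finally have "2 * (2 * euler ^ 6) = 2 * (theta_even (\<lambda>_. 1) * theta_odd (\<lambda>j. (2 * j + 1) ^ 2) -
    theta_even (\<lambda>j. (2 * j) ^ 2) * theta_odd (\<lambda>_. 1))"
    unfolding shift[of "\<lambda>_. 1"] shift[of "\<lambda>l. (2 * l) ^ 2"] by (simp add: power_mult_distrib algebra_simps flip: power_mult)
  then show ?thesis by (rule mult_left_cancel[of 2, THEN iffD1, rotated]) simp
qed

text \<open>The rotations of order 3 of the hexagonal lattice average the square of a linear form
  to a multiple of the norm, so the second moments are derivatives.\<close>

lemma cubic_a_moment: "qsum UNIV hexa (\<lambda>(m, n). (m - n) ^ 2) = 2 * fps_XD (cubic_a :: int fps)"
proof -
  let ?h = "\<lambda>(m, n). (- n, m + n) :: int \<times> int"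
  have bij: "bij_betw ?h UNIV UNIV"
    by (rule bij_betw_byWitness[where f' = "\<lambda>(m, n). (m + n, - m)"]) auto
  have rot: "qsum UNIV hexa w = qsum UNIV hexa (w \<circ> ?h)" for w :: "_ \<Rightarrow> int"
    by (rule qsum_reindex[OF bij]) (auto simp: hexa_def algebra_simps)
  let ?w = "\<lambda>(m, n). (m - n) ^ 2 :: int"
  have 1: "qsum UNIV hexa ?w = qsum UNIV hexa (?w \<circ> ?h)" by (rule rot)
  have 2: "qsum UNIV hexa (?w \<circ> ?h) = qsum UNIV hexa (?w \<circ> ?h \<circ> ?h)" by (rule rot)
  have "3 * qsum UNIV hexa ?w = qsum UNIV hexa ?w + qsum UNIV hexa (?w \<circ> ?h) + qsum UNIV hexa (?w \<circ> ?h \<circ> ?h)"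
    using 1 2 by simp
  also have "\<dots> = qsum UNIV hexa (\<lambda>i. 6 * (hexa i * 1))"
    unfolding qsum_add by (rule qsum_cong) (auto simp: hexa_def power2_eq_square algebra_simps)
  also have "\<dots> = 3 * (2 * fps_XD cubic_a)"
    unfolding qsum_cmult[symmetric] cubic_a_def qsum_XD by (simp add: numeral_fps_const)
  finally show ?thesis by (rule mult_left_cancel[of 3, THEN iffD1, rotated]) simp
qed

lemma cubic_c_moment: "3 * qsum UNIV hexc (\<lambda>(m, n). (m - n) ^ 2) = 2 * (3 * fps_XD cubic_c + (cubic_c :: int fps))"
proof -
  let ?h = "\<lambda>(m, n). (n, - m - n - 1) :: int \<times> int"
  have bij: "bij_betw ?h UNIV UNIV"
    by (rule bij_betw_byWitness[where f' = "\<lambda>(m, n). (- m - n - 1, m)"]) auto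
  have rot: "qsum UNIV hexc w = qsum UNIV hexc (w \<circ> ?h)" for w :: "_ \<Rightarrow> int"
    by (rule qsum_reindex[OF bij]) (auto simp: hexc_def algebra_simps)
  let ?w = "\<lambda>(m, n). (m - n) ^ 2 :: int"
  have 1: "qsum UNIV hexc ?w = qsum UNIV hexc (?w \<circ> ?h)" by (rule rot)
  have 2: "qsum UNIV hexc (?w \<circ> ?h) = qsum UNIV hexc (?w \<circ> ?h \<circ> ?h)" by (rule rot)
  have "3 * qsum UNIV hexc ?w = qsum UNIV hexc ?w + qsum UNIV hexc (?w \<circ> ?h) + qsum UNIV hexc (?w \<circ> ?h \<circ> ?h)"
    using 1 2 by simp
  also have "\<dots> = qsum UNIV hexc (\<lambda>i. 6 * (hexc i * 1)) + qsum UNIV hexc (\<lambda>i. 2 * 1)"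
    unfolding qsum_add by (rule qsum_cong) (auto simp: hexc_def power2_eq_square algebra_simps)
  also have "\<dots> = 2 * (3 * fps_XD cubic_c + cubic_c)"
    unfolding qsum_cmult[symmetric] cubic_c_def qsum_XD by (simp add: numeral_fps_const algebra_simps)
  finally show ?thesis .
qed

text \<open>One and the same 2 x 2 matrix takes the theta series to a and c and their second moments
  to the derivatives, so the Wronskian is the product of the determinants \<open>euler ^ 2\<close>
  and \<open>2 * euler ^ 6\<close>. The combination \<open>3 * fps_XD cubic_c + cubic_c\<close>
  differentiates c together with its factor q^(1/3).\<close>

theorem cubic_wronskian:
  "cubic_a * (3 * fps_XD cubic_c + cubic_c) - 3 * (cubic_c * fps_XD cubic_a) = 3 * (euler ^ 8 :: int fps)"
proof -
  define f0 f1 g0 g1 where "f0 = qsum UNIV (\<lambda>l::int. 3 * (l * l)) (\<lambda>_. 1 :: int)"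
    and "f1 = qsum UNIV (\<lambda>l::int. 3 * (l * l) + 3 * l + 1) (\<lambda>_. 1 :: int)"
    and "g0 = qsum UNIV (\<lambda>l::int. 3 * (l * l) + 2 * l) (\<lambda>_. 1 :: int)"
    and "g1 = qsum UNIV (\<lambda>l::int. 3 * (l * l) - l) (\<lambda>_. 1 :: int)"
  define A1 A2 B1 B2 where "A1 = theta_even (\<lambda>_. 1)" and "A2 = theta_even (\<lambda>j. (2 * j) ^ 2)"
    and "B1 = theta_odd (\<lambda>_. 1)" and "B2 = theta_odd (\<lambda>j. (2 * j + 1) ^ 2)"
  note defs = f0_def f1_def g0_def g1_def A1_def A2_def B1_def B2_def
  have a: "cubic_a = f0 * A1 + f1 * B1"
    using cubic_a_parity[of "\<lambda>_. 1"] by (simp add: cubic_a_def defs case_prod_unfold)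
  have c: "cubic_c = g0 * A1 + g1 * B1"
    using cubic_c_parity[of "\<lambda>_. 1"] by (simp add: cubic_c_def defs case_prod_unfold)
  have a2: "2 * fps_XD cubic_a = f0 * A2 + f1 * B2"
    using cubic_a_parity[of "\<lambda>d. d ^ 2"] unfolding cubic_a_moment defs .
  have c2: "2 * (3 * fps_XD cubic_c + cubic_c) = 3 * (g0 * A2 + g1 * B2)"
    using cubic_c_parity[of "\<lambda>d. d ^ 2"] unfolding cubic_c_moment[symmetric] defs by simp
  have e2: "euler ^ 2 = f0 * g1 - f1 * g0" unfolding defs by (rule euler_square)
  have e6: "2 * euler ^ 6 = A1 * B2 - A2 * B1" unfolding defs by (rule euler_sixth)
  have "2 * (cubic_a * (3 * fps_XD cubic_c + cubic_c) - 3 * (cubic_c * fps_XD cubic_a)) =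
      cubic_a * (2 * (3 * fps_XD cubic_c + cubic_c)) - 3 * (cubic_c * (2 * fps_XD cubic_a))"
    by (simp add: algebra_simps)
  also have "\<dots> = 3 * ((f0 * A1 + f1 * B1) * (g0 * A2 + g1 * B2) - (g0 * A1 + g1 * B1) * (f0 * A2 + f1 * B2))"
    unfolding a2 c2 unfolding a c by (simp add: algebra_simps)
  also have "\<dots> = 3 * ((f0 * g1 - f1 * g0) * (A1 * B2 - A2 * B1))"
    by (simp add: algebra_simps)
  also have "\<dots> = 2 * (3 * euler ^ 8)"
    unfolding e2[symmetric] e6[symmetric] by (simp add: mult_ac flip: power_add)
  finally show ?thesis by (rule mult_left_cancel[of 2, THEN iffD1, rotated]) simp
qed

section \<open>The partition function\<close>

definition bounded_partitions :: "nat \<Rightarrow> nat \<Rightarrow> nat multiset set" where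
  "bounded_partitions m n = {M. set_mset M \<subseteq> {1..m} \<and> sum_mset M = n}"

lemma finite_bounded_partitions: "finite (bounded_partitions m n)"
  by (rule finite_subset[OF _ finite_partitions[of n]]) (auto simp: bounded_partitions_def)

lemma card_bounded_partitions_Suc:
  "card (bounded_partitions (Suc m) n) =
    card (bounded_partitions m n) + (if Suc m \<le> n then card (bounded_partitions (Suc m) (n - Suc m)) else 0)"
proof -
  let ?T = "{M \<in> bounded_partitions (Suc m) n. Suc m \<in># M}"
  have "bounded_partitions (Suc m) n = bounded_partitions m n \<union> ?T"
    by (force simp: bounded_partitions_def atLeastAtMostSuc_conv)
  moreover have "bounded_partitions m n \<inter> ?T = {}" by (auto simp: bounded_partitions_def)
  ultimately have 1: "card (bounded_partitions (Suc m) n) = card (bounded_partitions m n) + card ?T"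
    using card_Un_disjoint[of "bounded_partitions m n" ?T] finite_bounded_partitions
    by (metis (no_types, lifting) finite_Un)
  show ?thesis
  proof (cases "Suc m \<le> n")
    case True
    have "bij_betw (add_mset (Suc m)) (bounded_partitions (Suc m) (n - Suc m)) ?T"
      by (rule bij_betw_byWitness[where f' = "\<lambda>M. M - {#Suc m#}"])
         (use True in \<open>auto simp: bounded_partitions_def sum_mset_diff dest: in_diffD\<close>)
    then have "card ?T = card (bounded_partitions (Suc m) (n - Suc m))"
      by (metis bij_betw_same_card)
    then show ?thesis using 1 True by simp
  next
    case False
    have e: "?T = {}"
    proof -
      have "Suc m \<le> sum_mset M" if "Suc m \<in># M" for M using that by (auto dest!: multi_member_split)
      then show ?thesis using False by (auto simp: bounded_partitions_def)
    qed
    show ?thesis using 1 False unfolding e by simp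
  qed
qed

lemma bounded_partitions_series:
  "Abs_fps (\<lambda>n. of_nat (card (bounded_partitions m n))) * qfact fps_X m = (1 :: 'a::comm_ring_1 fps)"
proof (induction m)
  case 0
  have "bounded_partitions 0 n = (if n = 0 then {{#}} else {})" for n
    by (auto simp: bounded_partitions_def)
  then show ?case by (auto simp: fps_eq_iff)
next
  case (Suc m)
  let ?P = "\<lambda>m. Abs_fps (\<lambda>n. of_nat (card (bounded_partitions m n))) :: 'a fps"
  have "?P (Suc m) = ?P m + fps_X ^ Suc m * ?P (Suc m)"
    by (rule fps_ext) (simp add: card_bounded_partitions_Suc[of m] fps_X_power_mult_nth not_less_eq_eq not_le del: power_Suc)
  then have "?P (Suc m) * (1 - fps_X ^ Suc m) = ?P m"
    by (simp add: algebra_simps)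
  then have "?P (Suc m) * qfact fps_X (Suc m) = ?P m * qfact fps_X m"
    by (simp add: qfact_Suc mult_ac)
  then show ?case using Suc.IH by simp
qed

theorem partition_series: "euler * Abs_fps (\<lambda>n. of_nat (partition_number n)) = (1 :: 'a::comm_ring_1 fps)"
proof (rule agree_eqI)
  fix M
  have "partition_number n = card (bounded_partitions M n)" if "n \<le> M" for n
  proof -
    have "x \<le> sum_mset A" if "x \<in># A" for x and A :: "nat multiset"
      using that by (auto dest!: multi_member_split)
    then have "{A :: nat multiset. 0 \<notin># A \<and> sum_mset A = n} = bounded_partitions M n"
      using that by (fastforce simp: bounded_partitions_def Suc_le_eq intro: gr0I)
    then show ?thesis by (simp add: partition_number_def)
  qed
  then have "agree M (Abs_fps (\<lambda>n. of_nat (partition_number n)))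
      (Abs_fps (\<lambda>n. of_nat (card (bounded_partitions M n))) :: 'a fps)"
    by (simp add: agree_def)
  moreover have "agree M (euler :: 'a fps) (qfact fps_X M)" by (rule agree_mono[OF agree_euler]) simp
  ultimately have "agree M (euler * Abs_fps (\<lambda>n. of_nat (partition_number n)))
      (qfact fps_X M * Abs_fps (\<lambda>n. of_nat (card (bounded_partitions M n))) :: 'a fps)"
    by (intro agree_mult)
  then show "agree M (euler * Abs_fps (\<lambda>n. of_nat (partition_number n))) (1 :: 'a fps)"
    by (simp add: bounded_partitions_series mult.commute[of "qfact fps_X M"])
qed

definition euler_inv :: "int fps" where
  "euler_inv = Abs_fps (\<lambda>n. int (partition_number n))"

lemma euler_inv: "euler * euler_inv = 1"
  using partition_series[where 'a = int] by (simp add: euler_inv_def)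

section \<open>Logarithmic derivatives\<close>

abbreviation E3 :: "int fps" where "E3 \<equiv> subq 3 euler"
abbreviation J3 :: "int fps" where "J3 \<equiv> subq 3 euler_inv"

definition log_euler :: "int fps" where
  "log_euler = fps_XD euler * euler_inv"

abbreviation log_euler3 :: "int fps" where "log_euler3 \<equiv> subq 3 log_euler"

text \<open>These are the cubes $c^3$ and $b^3 = a^3 - c^3$ of Borweins' functions.\<close>

definition cubic_Y :: "int fps" where "cubic_Y = fps_X * cubic_c ^ 3"
definition cubic_U :: "int fps" where "cubic_U = cubic_a ^ 3 - cubic_Y"

lemma E3_J3: "E3 * J3 = 1"
  using arg_cong[OF euler_inv, of "subq 3"] by (simp add: subq_simps)

lemma E3_nonzero: "E3 \<noteq> 0"
  using E3_J3 by auto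

lemma XD_euler: "fps_XD euler = log_euler * euler"
  using euler_inv by (simp add: log_euler_def mult.assoc mult.commute[of euler_inv])

lemma XD_E3: "fps_XD E3 = 3 * log_euler3 * E3"
  by (simp add: fps_XD_subq XD_euler subq_simps mult.assoc)

lemma XD_power: "fps_XD (F ^ n) = of_nat n * F ^ (n - 1) * fps_XD (F :: 'a::comm_ring_1 fps)"
  by (cases n) (simp_all add: fps_XD_power fps_XD_of_const del: power_Suc)

lemma XD_E3_power: "fps_XD (E3 ^ n) = of_nat n * (3 * log_euler3) * E3 ^ n"
  unfolding XD_power XD_E3 by (cases n) (simp_all add: mult_ac)

lemma XD_euler_power: "fps_XD (euler ^ n) = of_nat n * log_euler * euler ^ n"
  unfolding XD_power XD_euler by (cases n) (simp_all add: mult_ac)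

lemma XD_euler_inv_power: "fps_XD (euler_inv ^ n) = - (of_nat n * log_euler * euler_inv ^ n)"
proof -
  have 1: "euler ^ n * euler_inv ^ n = 1" using euler_inv by (simp flip: power_mult_distrib)
  then have "fps_XD (euler ^ n * euler_inv ^ n) = 0" by (simp add: fps_XD_of_const)
  then have "euler ^ n * (of_nat n * log_euler * euler_inv ^ n + fps_XD (euler_inv ^ n)) = 0"
    by (simp add: fps_XD_mult XD_euler_power algebra_simps)
  then show ?thesis by (simp add: eq_neg_iff_add_eq_0 add.commute)
qed

lemma cubic_c_eq: "cubic_c = 3 * (E3 ^ 3 * euler_inv)"
proof -
  have "cubic_c = euler * cubic_c * euler_inv" using euler_inv by (simp add: mult.commute mult.left_commute)
  then show ?thesis unfolding euler_mult_cubic_c by (simp add: mult.assoc)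
qed

lemma XD_cubic_c: "fps_XD cubic_c = cubic_c * (9 * log_euler3 - log_euler)"
proof -
  have "fps_XD euler_inv = - (log_euler * euler_inv)" using XD_euler_inv_power[of 1] by simp
  then show ?thesis unfolding cubic_c_eq fps_XD_mult XD_E3_power by (simp add: fps_XD_of_const algebra_simps)
qed

lemma cubic_U_eq: "E3 ^ 3 * cubic_U = euler ^ 9"
  unfolding cubic_U_def cubic_Y_def by (rule cubic_cubes[symmetric])

text \<open>The Wronskian relation multiplied by E: on the right E^9 is U times E(q^3)^3, and E c on
  the left supplies the same power of E(q^3). The factor next to \<open>cubic_a\<close> is the
  logarithmic derivative of \<open>cubic_Y\<close>.\<close>

lemma XD_cubic_a:
  "3 * fps_XD cubic_a = cubic_a * (1 + 27 * log_euler3 - 3 * log_euler) - cubic_U"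
proof -
  let ?t = "cubic_a * (1 + 27 * log_euler3 - 3 * log_euler) - 3 * fps_XD cubic_a"
  have "cubic_c * ?t = 3 * euler ^ 8"
    using cubic_wronskian unfolding XD_cubic_c by (simp add: algebra_simps)
  then have "(euler * cubic_c) * ?t = 3 * euler ^ 9"
    by (metis (no_types, lifting) mult.assoc mult.left_commute power_Suc eval_nat_numeral(3) numeral_nat(2))
  then have "3 * E3 ^ 3 * ?t = 3 * E3 ^ 3 * cubic_U"
    unfolding euler_mult_cubic_c cubic_U_eq[symmetric] by (simp only: mult.assoc)
  moreover have "3 * E3 ^ 3 \<noteq> 0" using E3_nonzero by simp
  ultimately have "?t = cubic_U" using mult_left_cancel by blast
  then show ?thesis by (simp add: algebra_simps)
qed

lemma XD_cubic_U: "fps_XD cubic_U = 9 * (log_euler - log_euler3) * cubic_U"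
proof -
  have "fps_XD (euler ^ 9) = 9 * log_euler * (E3 ^ 3 * cubic_U)"
    unfolding XD_euler_power cubic_U_eq by simp
  moreover have "fps_XD (E3 ^ 3 * cubic_U) = E3 ^ 3 * (9 * log_euler3 * cubic_U + fps_XD cubic_U)"
    unfolding fps_XD_mult XD_E3_power by (simp add: algebra_simps)
  ultimately have "E3 ^ 3 * (9 * log_euler3 * cubic_U + fps_XD cubic_U) = 9 * log_euler * (E3 ^ 3 * cubic_U)"
    unfolding cubic_U_eq by simp
  then have "E3 ^ 3 * fps_XD cubic_U = E3 ^ 3 * (9 * (log_euler - log_euler3) * cubic_U)"
    by (simp add: algebra_simps)
  then show ?thesis using E3_nonzero by simp
qed

lemma XD_cubic_Y: "fps_XD cubic_Y = (1 + 27 * log_euler3 - 3 * log_euler) * cubic_Y"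
  unfolding cubic_Y_def fps_XD_mult fps_XD_X XD_power XD_cubic_c
  by (simp add: algebra_simps power3_eq_cube power2_eq_square)

lemma cubic_a_nth_0: "(cubic_a :: int fps) $ 0 = 1"
proof -
  have "hexa p = 0 \<longleftrightarrow> p = (0, 0)" for p
    using hexa_bounds[where m = "fst p" and n = "snd p"] by (cases p) (auto simp: hexa_def)
  then show ?thesis by (simp add: cubic_a_def qsum_nth)
qed

text \<open>Differentiate a^3 = U + Y on both sides by the rules above; everything that remains is a
  multiple of U. In terms of E_2 the result is 2 a^2 = 3 E_2(q^3) - E_2(q).\<close>

theorem cubic_a_square: "cubic_a ^ 2 = 1 + 36 * log_euler3 - 12 * log_euler"
proof -
  let ?g = "1 + 27 * log_euler3 - 3 * log_euler"
  have "fps_XD (cubic_a ^ 3) = cubic_a ^ 2 * (3 * fps_XD cubic_a)"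
    unfolding XD_power by (simp add: mult_ac)
  also have "\<dots> = (cubic_U + cubic_Y) * ?g - cubic_a ^ 2 * cubic_U"
    unfolding XD_cubic_a cubic_U_def by (simp add: algebra_simps power3_eq_cube power2_eq_square)
  also have "fps_XD (cubic_a ^ 3) = fps_XD cubic_U + fps_XD cubic_Y"
    by (simp add: cubic_U_def flip: fps_XD_add)
  finally have "cubic_U * cubic_a ^ 2 = cubic_U * (1 + 36 * log_euler3 - 12 * log_euler)"
    unfolding XD_cubic_U XD_cubic_Y by (simp add: algebra_simps)
  moreover have "cubic_U $ 0 \<noteq> 0"
    using arg_cong[OF cubic_U_eq, of "\<lambda>F. F $ 0"] by auto
  then have "cubic_U \<noteq> 0" by auto
  ultimately show ?thesis using mult_left_cancel by blast
qed

section \<open>Dissection modulo 3\<close>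

definition cphi_series :: "int fps" where
  "cphi_series = Abs_fps (\<lambda>n. int (cphi 3 n))"

text \<open>With x = a(q^3) and v = q c(q^3) the series is (x + 2 v) / (E(q^3) (x - v)). Expanding
  the fraction by x^2 + x v + v^2 turns the denominator into a series in q^3, by
  \<open>cubic_cubes\<close>, and the powers of v then display the classes.\<close>

lemma cphi_series_dissection:
  "cphi_series = subq 3 ((cubic_a ^ 3 + 2 * cubic_Y) * (E3 ^ 3 * euler_inv ^ 10)) +
    fps_X * subq 3 (3 * cubic_a ^ 2 * cubic_c * (E3 ^ 3 * euler_inv ^ 10)) +
    fps_X ^ 2 * subq 3 (3 * cubic_a * cubic_c ^ 2 * (E3 ^ 3 * euler_inv ^ 10))"
proof -
  let ?a = "subq 3 cubic_a :: int fps" and ?v = "fps_X * subq 3 cubic_c :: int fps" and ?E9 = "subq 3 E3"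
  have 1: "cphi_series * (E3 * (?a - ?v)) = ?a + 2 * ?v"
    using cphi3_generating_function[where 'a = int] euler_cube_cubic cubic_a_split[where 'a = int]
    by (simp add: cphi_series_def cubic_a_def)
  have "E3 ^ 9 = subq 3 (euler ^ 9)" by (simp add: subq_simps)
  also have "\<dots> = ?E9 ^ 3 * (?a ^ 3 - ?v ^ 3)"
    unfolding cubic_cubes by (simp add: subq_simps power_mult_distrib)
  also have "\<dots> = ?E9 ^ 3 * ((?a - ?v) * (?a ^ 2 + ?a * ?v + ?v ^ 2))"
    by (simp add: algebra_simps power3_eq_cube power2_eq_square)
  finally have 2: "E3 ^ 9 = ?E9 ^ 3 * ((?a - ?v) * (?a ^ 2 + ?a * ?v + ?v ^ 2))" .
  have "E3 ^ 10 * J3 ^ 10 = 1" using E3_J3 by (simp flip: power_mult_distrib)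
  moreover have "E3 * E3 ^ 9 = E3 ^ 10" by (simp flip: power_Suc)
  ultimately have "cphi_series = cphi_series * (E3 * E3 ^ 9) * J3 ^ 10"
    by (simp only: mult.assoc mult_1_right)
  also have "\<dots> = cphi_series * (E3 * (?a - ?v)) * (?a ^ 2 + ?a * ?v + ?v ^ 2) * (?E9 ^ 3 * J3 ^ 10)"
    unfolding 2 by (simp only: mult_ac)
  also have "\<dots> = (?a ^ 3 + 2 * ?v ^ 3 + 3 * ?a ^ 2 * ?v + 3 * ?a * ?v ^ 2) * (?E9 ^ 3 * J3 ^ 10)"
    unfolding 1 by (simp add: algebra_simps power3_eq_cube power2_eq_square)
  also have "\<dots> = subq 3 ((cubic_a ^ 3 + 2 * cubic_Y) * (E3 ^ 3 * euler_inv ^ 10)) +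
    fps_X * subq 3 (3 * cubic_a ^ 2 * cubic_c * (E3 ^ 3 * euler_inv ^ 10)) +
    fps_X ^ 2 * subq 3 (3 * cubic_a * cubic_c ^ 2 * (E3 ^ 3 * euler_inv ^ 10))"
    unfolding cubic_Y_def by (simp add: subq_simps power_mult_distrib algebra_simps)
  finally show ?thesis .
qed

lemma subq_3_nth:
  "subq 3 F $ (3 * n) = F $ n" "subq 3 F $ (3 * n + 1) = 0" "(fps_X * subq 3 F) $ (3 * n + 1) = F $ n"
  "(fps_X * subq 3 F) $ (3 * n) = 0" "(fps_X ^ 2 * subq 3 F) $ (3 * n) = 0" "(fps_X ^ 2 * subq 3 F) $ (3 * n + 1) = 0"
proof -
  have d: "\<not> 3 dvd 3 * n + 1" by presburger
  show "subq 3 F $ (3 * n) = F $ n" by (rule subq_nth_mult) simp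
  then show "(fps_X * subq 3 F) $ (3 * n + 1) = F $ n" by simp
  show "subq 3 F $ (3 * n + 1) = 0" using d by (simp only: fps_nth_compose_X_power if_False)
  have "\<not> 3 dvd 3 * n - 1" if "n > 0" using that by presburger
  then show "(fps_X * subq 3 F) $ (3 * n) = 0"
    by (cases n) (simp_all add: fps_nth_compose_X_power)
  have "\<not> 3 dvd 3 * n - 2" if "n > 0" using that by presburger
  then show "(fps_X ^ 2 * subq 3 F) $ (3 * n) = 0"
    by (cases n) (simp_all add: fps_X_power_mult_nth fps_nth_compose_X_power)
  have "\<not> 3 dvd 3 * n + 1 - 2" if "n > 0" using that by presburger
  then show "(fps_X ^ 2 * subq 3 F) $ (3 * n + 1) = 0"
    by (cases n) (simp_all add: fps_X_power_mult_nth fps_nth_compose_X_power)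
qed

lemma cphi_1_mod_3: "int (cphi 3 (3 * n + 1)) = 9 * (cubic_a ^ 2 * (E3 ^ 6 * euler_inv ^ 11)) $ n"
proof -
  have "int (cphi 3 (3 * n + 1)) = cphi_series $ (3 * n + 1)" by (simp add: cphi_series_def)
  also have "\<dots> = (3 * cubic_a ^ 2 * cubic_c * (E3 ^ 3 * euler_inv ^ 10)) $ n"
    unfolding cphi_series_dissection fps_add_nth by (simp only: subq_3_nth)
  also have "3 * cubic_a ^ 2 * cubic_c * (E3 ^ 3 * euler_inv ^ 10) = fps_const 9 * (cubic_a ^ 2 * (E3 ^ 6 * euler_inv ^ 11))"
    unfolding cubic_c_eq by (simp add: numeral_fps_const[symmetric] mult_ac power_add[symmetric] flip: power_Suc power_Suc2)
  finally show ?thesis by simp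
qed

text \<open>The partition series is 1 / E = U E(q^3)^3 / E^10, so subtracting it turns a^3 + 2 Y
  into 3 Y, which is a product.\<close>

lemma cphi_0_mod_3:
  "cphi3_bar (3 * n) = 81 * (fps_X * (E3 ^ 12 * euler_inv ^ 13)) $ n"
proof -
  have "int (cphi 3 (3 * n)) = cphi_series $ (3 * n)" by (simp add: cphi_series_def)
  also have "\<dots> = ((cubic_a ^ 3 + 2 * cubic_Y) * (E3 ^ 3 * euler_inv ^ 10)) $ n"
    unfolding cphi_series_dissection fps_add_nth by (simp only: subq_3_nth)
  finally have "cphi3_bar (3 * n) = ((cubic_a ^ 3 + 2 * cubic_Y) * (E3 ^ 3 * euler_inv ^ 10) - euler_inv) $ n"
    by (simp add: cphi3_bar_def euler_inv_def)
  also have "(cubic_a ^ 3 + 2 * cubic_Y) * (E3 ^ 3 * euler_inv ^ 10) - euler_inv =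
      (cubic_a ^ 3 + 2 * cubic_Y) * (E3 ^ 3 * euler_inv ^ 10) - cubic_U * (E3 ^ 3 * euler_inv ^ 10)"
  proof (rule arg_cong2[where f = "(-)", OF refl])
    have "euler_inv = (euler ^ 9 * euler_inv ^ 9) * euler_inv"
      using euler_inv by (simp flip: power_mult_distrib)
    also have "\<dots> = cubic_U * (E3 ^ 3 * euler_inv ^ 10)"
      unfolding cubic_U_eq[symmetric] by (simp add: mult_ac flip: power_Suc power_Suc2)
    finally show "euler_inv = cubic_U * (E3 ^ 3 * euler_inv ^ 10)" .
  qed
  also have "\<dots> =
      3 * cubic_Y * (E3 ^ 3 * euler_inv ^ 10)"
    unfolding cubic_U_def by (simp add: algebra_simps)
  also have "\<dots> = fps_const 81 * (fps_X * (E3 ^ 12 * euler_inv ^ 13))"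
    unfolding cubic_Y_def cubic_c_eq
    by (simp add: numeral_fps_const[symmetric] power_mult_distrib mult_ac power_add[symmetric] power_mult[symmetric])
  finally show ?thesis by simp
qed

section \<open>Power series modulo 5\<close>

\<comment> \<open>Residues modulo 5 form a type of their own because substitution into power series
  is used over integral domains.\<close>
quotient_type gf5 = int / "\<lambda>x y :: int. x mod 5 = y mod 5"
  by (rule equivpI) (auto simp: reflp_def symp_def transp_def)

instantiation gf5 :: idom
begin

lift_definition zero_gf5 :: gf5 is 0 .
lift_definition one_gf5 :: gf5 is 1 .
lift_definition plus_gf5 :: "gf5 \<Rightarrow> gf5 \<Rightarrow> gf5" is "(+)" by (rule mod_add_cong)
lift_definition minus_gf5 :: "gf5 \<Rightarrow> gf5 \<Rightarrow> gf5" is "(-)" by (rule mod_diff_cong)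
lift_definition times_gf5 :: "gf5 \<Rightarrow> gf5 \<Rightarrow> gf5" is "(*)" by (rule mod_mult_cong)
lift_definition uminus_gf5 :: "gf5 \<Rightarrow> gf5" is uminus by (rule mod_minus_cong)

instance
proof
  fix x y :: gf5
  show "x \<noteq> 0 \<Longrightarrow> y \<noteq> 0 \<Longrightarrow> x * y \<noteq> 0"
    by transfer (auto simp: prime_dvd_mult_iff simp flip: dvd_eq_mod_eq_0)
qed (transfer; simp add: algebra_simps)+

end

lemma of_int_gf5: "of_int x = abs_gf5 x"
proof -
  have "of_nat n = abs_gf5 (int n)" for n
    by (induction n) (simp_all add: zero_gf5.abs_eq one_gf5.abs_eq plus_gf5.abs_eq)
  then show ?thesis
    by (cases x rule: int_cases2) (simp_all add: uminus_gf5.abs_eq)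
qed

lemma of_int_eq_0_iff_5: "of_int x = (0 :: gf5) \<longleftrightarrow> 5 dvd x"
  unfolding of_int_gf5 zero_gf5_def gf5.abs_eq_iff by (simp add: dvd_eq_mod_eq_0)

lemma char_gf5 [simp]: "CHAR(gf5) = 5"
proof (rule CHAR_eqI)
  have "of_int (int x) = (0 :: gf5) \<longleftrightarrow> 5 dvd int x" for x by (rule of_int_eq_0_iff_5)
  then have *: "of_nat x = (0 :: gf5) \<longleftrightarrow> 5 dvd x" for x
    by (metis int_dvd_int_iff of_int_of_nat_eq of_nat_numeral)
  show "of_nat 5 = (0 :: gf5)" unfolding * by simp
  show "5 dvd x" if "of_nat x = (0 :: gf5)" for x using that unfolding * .
qed

lemma five_eq_0: "(5 :: gf5 fps) = 0"
  using of_nat_CHAR[where 'a = "gf5 fps"] by simp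

lemma six_gf5: "(6 :: gf5) = 1"
proof -
  have "(6 :: gf5) = of_nat CHAR(gf5) + 1" by simp
  then show ?thesis by (simp only: of_nat_CHAR add_0_left)
qed

lemma cmap_uminus: "cmap (- F) = - cmap F"
  by (simp add: fps_eq_iff)

lemma five_mult: "5 * F = (0 :: gf5 fps)"
  by (simp add: five_eq_0)

lemma of_nat_5_mult [simp]: "of_nat (5 * m) = (0 :: gf5)"
  unfolding of_nat_eq_0_iff_char_dvd by simp

lemma cmap_5_mult: "cmap (5 * F) = (0 :: gf5 fps)"
  by (simp add: cmap_mult cmap_numeral five_mult)

text \<open>With the quotient \<open>Q\<close> written out, a congruence modulo 5 becomes an
  identity with integer coefficients modulo the given relations. This is where the long multiples of
  5 below come from.\<close>

lemma eq_mod_5I: "F = G + 5 * Q \<Longrightarrow> F = (G :: gf5 fps)"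
  by (simp add: five_mult)

lemma five_dvd_power_diff: "5 dvd x ^ 5 - (x :: int)"
proof -
  have "(x ^ 5 - x) mod 5 = ((x mod 5) ^ 5 - x mod 5) mod 5"
    by (rule mod_diff_cong) (simp_all add: power_mod)
  moreover have "x mod 5 \<in> {0, 1, 2, 3, 4}" using pos_mod_bound[of 5 x] pos_mod_sign[of 5 x] by auto
  ultimately have "(x ^ 5 - x) mod 5 = 0" by auto
  then show ?thesis by (rule mod_0_imp_dvd)
qed

lemma of_int_power_5: "of_int x ^ 5 = (of_int x :: gf5)"
  using five_dvd_power_diff[of x] of_int_eq_0_iff_5[of "x ^ 5 - x"] by simp

lemma power_5_add: "(F + G) ^ 5 = F ^ 5 + (G :: gf5 fps) ^ 5"
  by (rule freshmans_dream) simp_all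

lemma fps_power_5_nth:
  fixes F :: "gf5 fps"
  shows "F ^ 5 $ n = (if 5 dvd n then (F $ (n div 5)) ^ 5 else 0)"
proof -
  let ?T = "\<Sum>k\<le>n. fps_const (F $ k) * fps_X ^ k"
  have "agree (Suc n) F ?T"
    by (simp add: agree_def fps_sum_nth fps_X_power_nth mult_delta_right)
  then have "F ^ 5 $ n = ?T ^ 5 $ n"
    using agree_power[of "Suc n" F ?T 5] by (simp add: agree_def)
  also have "?T ^ 5 = (\<Sum>k\<le>n. (fps_const (F $ k) * fps_X ^ k) ^ 5)"
    by (rule freshmans_dream_sum) simp_all
  also have "\<dots> $ n = (\<Sum>k\<le>n. if n = 5 * k then (F $ k) ^ 5 else 0)"
    unfolding fps_sum_nth
    by (intro sum.cong) (auto simp: power_mult_distrib fps_const_power fps_X_power_nth simp flip: power_mult)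
  also have "\<dots> = (if 5 dvd n then (F $ (n div 5)) ^ 5 else 0)"
  proof (cases "5 dvd n")
    case True
    then obtain m where "n = 5 * m" by blast
    then show ?thesis by simp
  next
    case False
    then have "n \<noteq> 5 * k" for k by auto
    then show ?thesis using False by simp
  qed
  finally show ?thesis .
qed

lemma fps_power_25_nth:
  fixes F :: "gf5 fps"
  shows "F ^ 25 $ n = (if 25 dvd n then (F $ (n div 25)) ^ 25 else 0)"
proof -
  have 1: "F ^ 25 = (F ^ 5) ^ 5" by (simp flip: power_mult)
  have "25 dvd n \<longleftrightarrow> 5 dvd n \<and> 5 dvd n div 5" by presburger
  moreover have "n div 5 div 5 = n div 25" by (simp add: div_mult2_eq[symmetric])
  moreover have "(x ^ 5) ^ 5 = x ^ 25" for x :: gf5 by (simp flip: power_mult)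
  ultimately show ?thesis unfolding 1 fps_power_5_nth by auto
qed

text \<open>By Frobenius a 25th power is a series in q^25, so a product with it mixes only exponents
  of one class modulo 25.\<close>

lemma mult_power_25_nth_eq_0:
  fixes F G :: "gf5 fps"
  assumes "\<And>j. F $ (25 * j + r) = 0" "r < 25"
  shows "(F * G ^ 25) $ (25 * k + r) = 0"
  unfolding fps_mult_nth
proof (rule sum.neutral, rule ballI)
  fix i assume i: "i \<in> {0..25 * k + r}"
  show "F $ i * G ^ 25 $ (25 * k + r - i) = 0"
  proof (cases "25 dvd 25 * k + r - i")
    case True
    then obtain l where "25 * k + r - i = 25 * l" by blast
    then have "i = 25 * (k - l) + r" using i assms(2) by auto
    then show ?thesis using assms(1) by simp
  next
    case False
    then show ?thesis by (simp add: fps_power_25_nth)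
  qed
qed

section \<open>Ramanujan's relations modulo 5\<close>

text \<open>The quasimodular Eisenstein series $E_2$.\<close>

definition eisen :: "int fps" where "eisen = 1 + 24 * log_euler"
abbreviation eisen3 :: "int fps" where "eisen3 \<equiv> subq 3 eisen"

lemma eisen_euler: "euler * eisen = 24 * fps_XD euler + euler"
  by (simp add: eisen_def XD_euler algebra_simps)

lemma eisen_euler_cube: "euler ^ 3 * eisen = 8 * fps_XD (euler ^ 3) + euler ^ 3"
  unfolding XD_euler_power eisen_def by (simp add: algebra_simps)

text \<open>Applying $8 q \frac{d}{dq} + 1$ twice multiplies the terms of Jacobi's series by
  $(2k+1)^4$, and $(2k+1)^5$ is congruent to $2k+1$.\<close>

lemma eisen_riccati_int: "\<exists>W. eisen ^ 2 + 8 * fps_XD eisen - 1 = 5 * W"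
proof -
  let ?D = "\<lambda>F :: int fps. 8 * fps_XD F + F"
  define v where "v k = parity_sign k * (((2 * k + 1) ^ 5 - (2 * k + 1)) div 5)" for k :: int
  have D: "?D (qsum UNIV tri w) = qsum UNIV tri (\<lambda>k. (2 * k + 1) ^ 2 * w k)" for w
  proof -
    have "?D (qsum UNIV tri w) = qsum UNIV tri (\<lambda>k. 8 * (tri k * w k) + w k)"
      unfolding qsum_XD qsum_add[symmetric] qsum_cmult[symmetric] by (simp add: numeral_fps_const)
    also have "\<dots> = qsum UNIV tri (\<lambda>k. (2 * k + 1) ^ 2 * w k)"
    proof (rule qsum_cong)
      fix k
      have "8 * (tri k * w k) + w k = (4 * (2 * tri k) + 1) * w k" by (simp add: algebra_simps)
      then show "8 * (tri k * w k) + w k = (2 * k + 1) ^ 2 * w k"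
        unfolding two_tri by (simp add: algebra_simps power2_eq_square)
    qed simp
    finally show ?thesis .
  qed
  have "?D (?D (2 * euler ^ 3)) = qsum UNIV tri (\<lambda>k. parity_sign k * (2 * k + 1) + 5 * v k)"
    unfolding jacobi_double D
  proof (rule qsum_cong)
    fix k :: int
    have "5 * (((2 * k + 1) ^ 5 - (2 * k + 1)) div 5) = (2 * k + 1) ^ 5 - (2 * k + 1)"
      by (rule dvd_mult_div_cancel[OF five_dvd_power_diff])
    moreover have "5 * v k = parity_sign k * (5 * (((2 * k + 1) ^ 5 - (2 * k + 1)) div 5))"
      unfolding v_def by (rule mult.left_commute)
    ultimately have "5 * v k = parity_sign k * ((2 * k + 1) ^ 5 - (2 * k + 1))" by (simp only:)
    then show "(2 * k + 1) ^ 2 * ((2 * k + 1) ^ 2 * (parity_sign k * (2 * k + 1))) = parity_sign k * (2 * k + 1) + 5 * v k"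
      by (simp add: algebra_simps eval_nat_numeral)
  qed simp
  also have "\<dots> = 2 * euler ^ 3 + 5 * qsum UNIV tri v"
    unfolding jacobi_double qsum_add[symmetric] qsum_cmult[symmetric] by (simp add: numeral_fps_const)
  finally have 1: "?D (?D (2 * euler ^ 3)) = 2 * euler ^ 3 + 5 * qsum UNIV tri v" .
  have "?D (2 * euler ^ 3) = 2 * (euler ^ 3 * eisen)"
    unfolding eisen_euler_cube fps_XD_numeral_mult by (simp add: algebra_simps)
  moreover have "?D (2 * (euler ^ 3 * eisen)) = 2 * ((8 * fps_XD (euler ^ 3) + euler ^ 3) * eisen + 8 * (euler ^ 3 * fps_XD eisen))"
    by (simp add: fps_XD_mult fps_XD_of_const algebra_simps)
  ultimately have "?D (?D (2 * euler ^ 3)) = 2 * (euler ^ 3 * (eisen ^ 2 + 8 * fps_XD eisen))"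
    unfolding eisen_euler_cube[symmetric] by (simp add: algebra_simps power2_eq_square)
  with 1 have "euler ^ 3 * (2 * (eisen ^ 2 + 8 * fps_XD eisen - 1)) = 5 * qsum UNIV tri v"
    by (simp add: algebra_simps)
  then have "euler_inv ^ 3 * (euler ^ 3 * (2 * (eisen ^ 2 + 8 * fps_XD eisen - 1))) = euler_inv ^ 3 * (5 * qsum UNIV tri v)"
    by (simp only:)
  moreover have "euler_inv ^ 3 * (euler ^ 3 * F) = F" for F
  proof -
    have "euler_inv ^ 3 * (euler ^ 3 * F) = (euler * euler_inv) ^ 3 * F"
      by (simp only: power_mult_distrib mult_ac)
    then show ?thesis by (simp add: euler_inv)
  qed
  ultimately have "2 * (eisen ^ 2 + 8 * fps_XD eisen - 1) = euler_inv ^ 3 * (5 * qsum UNIV tri v)" by (simp only:)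
  \<comment> \<open>From 2 T = 5 V follows T = 5 T - 4 T = 5 (T - 2 V).\<close>
  then have "eisen ^ 2 + 8 * fps_XD eisen - 1 =
      5 * ((eisen ^ 2 + 8 * fps_XD eisen - 1) - 2 * (euler_inv ^ 3 * qsum UNIV tri v))"
    by algebra
  then show ?thesis by blast
qed

lemma qsum_if:
  assumes "admissible S Q"
  shows "qsum S Q (\<lambda>i. if P i then w i else 0) = qsum {i \<in> S. P i} Q w"
proof (rule fps_ext)
  fix n
  have "finite {i. i \<in> S \<and> Q i = int n}" using assms by (simp add: admissible_def)
  then have "qsum S Q (\<lambda>i. if P i then w i else 0) $ n = sum w {i \<in> {i. i \<in> S \<and> Q i = int n}. P i}"
    unfolding qsum_nth by (rule sum.inter_filter[symmetric])
  also have "{i \<in> {i. i \<in> S \<and> Q i = int n}. P i} = {i. i \<in> {i \<in> S. P i} \<and> Q i = int n}" by auto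
  finally show "qsum S Q (\<lambda>i. if P i then w i else 0) $ n = qsum {i \<in> S. P i} Q w $ n"
    by (simp add: qsum_nth)
qed

text \<open>These are the indices for which 5 divides 6 k - 1, whose square is
  \<open>24 * penta k + 1\<close>. For k = 1 - 5 m the pentagonal numbers recur, scaled by
  25.\<close>

lemma pentagonal_1_mod_5:
  "qsum {k. k mod 5 = 1} penta parity_sign = - (fps_X * subq 25 (euler :: int fps))"
proof -
  have penta5: "penta (1 - 5 * m) = 25 * penta m + 1" for m
  proof -
    have "2 * penta (1 - 5 * m) = 2 * (25 * penta m + 1)"
      unfolding distrib_left mult.left_commute[of 2 25] two_penta by (simp add: algebra_simps)
    then show ?thesis by simp
  qed
  have "qsum {k. k mod 5 = 1} penta (parity_sign :: int \<Rightarrow> int) =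
      qsum UNIV (\<lambda>m. int 25 * penta m + int 1) (\<lambda>m. - 1 * parity_sign m)"
  proof (rule qsum_reindex[of "\<lambda>m. 1 - 5 * m"])
    show "bij_betw (\<lambda>m. 1 - 5 * m) UNIV {k. k mod 5 = (1::int)}"
      by (rule bij_betw_byWitness[where f' = "\<lambda>k. (1 - k) div 5"]) (auto, presburger+)
  qed (simp_all add: penta5 parity_sign_def)
  also have "\<dots> = fps_X ^ 1 * subq 25 (- qsum UNIV penta parity_sign)"
  proof -
    have "qsum UNIV penta (\<lambda>m. - 1 * parity_sign m :: int) = - qsum UNIV penta parity_sign"
      unfolding qsum_cmult[symmetric] by (simp flip: fps_const_neg)
    then show ?thesis
      by (subst qsum_shift[symmetric], simp add: penta_bounds, subst qsum_subq[symmetric], simp, simp only:)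
  qed
  finally show ?thesis unfolding pentagonal[symmetric] by (simp add: fps_compose_uminus)
qed

lemma cmap_subq_25_euler: "cmap (subq 25 euler) = (euler ^ 25 :: gf5 fps)"
proof (rule fps_ext)
  fix n
  have 1: "(euler :: gf5 fps) $ m = of_int ((euler :: int fps) $ m)" for m
    using arg_cong[OF cmap_euler[where 'a = gf5], of "\<lambda>F. F $ m"] by simp
  have "(of_int x :: gf5) ^ 25 = of_int x" for x
  proof -
    have "((of_int x :: gf5) ^ 5) ^ 5 = of_int x" by (simp only: of_int_power_5)
    then show ?thesis by (simp flip: power_mult)
  qed
  then show "cmap (subq 25 euler) $ n = (euler ^ 25 :: gf5 fps) $ n"
    by (simp add: fps_power_25_nth fps_nth_compose_X_power 1)
qed

section \<open>The differential ring of the cubic theta series modulo 5\<close>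

definition a5 :: "gf5 fps" where "a5 = cmap cubic_a"
definition c5 :: "gf5 fps" where "c5 = cmap cubic_c"
definition U5 :: "gf5 fps" where "U5 = cmap cubic_U"
definition Y5 :: "gf5 fps" where "Y5 = cmap cubic_Y"
definition e5 :: "gf5 fps" where "e5 = cmap eisen"
text \<open>As 9 = -1 modulo 5, this is the cofactor b^3 + 9 c^3 of a in E_4; by \<open>A_b\<close>
  it is 1 / a.\<close>

definition b5 :: "gf5 fps" where "b5 = U5 - Y5"

lemma A_cube: "a5 ^ 3 = U5 + Y5"
  by (simp add: a5_def U5_def Y5_def cubic_U_def cmap_power cmap_simps)

lemma two_cubic_a_square: "2 * cubic_a ^ 2 = 3 * eisen3 - eisen"
  unfolding cubic_a_square eisen_def by (simp add: subq_simps algebra_simps)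

lemma XD_cubic_a': "12 * fps_XD cubic_a = cubic_a * (3 * cubic_a ^ 2 + eisen) - 4 * cubic_U"
  using arg_cong[OF XD_cubic_a, of "\<lambda>F. 4 * F"] unfolding cubic_a_square eisen_def by (simp add: algebra_simps)

lemma XD_cubic_c': "4 * (3 * fps_XD cubic_c + cubic_c) = cubic_c * (3 * cubic_a ^ 2 + eisen)"
  unfolding cubic_a_square eisen_def XD_cubic_c by (simp add: algebra_simps)

lemma XD_cubic_U': "4 * fps_XD cubic_U = (eisen - cubic_a ^ 2) * cubic_U"
  unfolding cubic_a_square eisen_def XD_cubic_U by (simp add: algebra_simps)

lemma XD_cubic_Y': "4 * fps_XD cubic_Y = (3 * cubic_a ^ 2 + eisen) * cubic_Y"
  unfolding cubic_a_square eisen_def XD_cubic_Y by (simp add: algebra_simps)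

lemma XD_A: "12 * fps_XD a5 = a5 * (3 * a5 ^ 2 + e5) - 4 * U5"
  using arg_cong[OF XD_cubic_a', of "cmap :: _ \<Rightarrow> gf5 fps"]
  by (simp add: a5_def e5_def U5_def cmap_mult cmap_simps cmap_power cmap_numeral cmap_XD)

lemma XD_C: "4 * (3 * fps_XD c5 + c5) = c5 * (3 * a5 ^ 2 + e5)"
  using arg_cong[OF XD_cubic_c', of "cmap :: _ \<Rightarrow> gf5 fps"]
  by (simp add: a5_def e5_def c5_def cmap_mult cmap_simps cmap_power cmap_numeral cmap_XD)

lemma eisen_riccati:
  "e5 ^ 2 + 8 * fps_XD e5 = 1"
  "3 * cmap eisen3 ^ 2 + 8 * fps_XD (cmap eisen3) = (3 :: gf5 fps)"
proof -
  obtain W where W: "eisen ^ 2 + 8 * fps_XD eisen - 1 = 5 * W" using eisen_riccati_int by blast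
  have "cmap (eisen ^ 2 + 8 * fps_XD eisen - 1) = (0 :: gf5 fps)" unfolding W by (rule cmap_5_mult)
  then show "e5 ^ 2 + 8 * fps_XD e5 = 1"
    by (simp add: e5_def cmap_mult cmap_simps cmap_power cmap_numeral cmap_XD)
  have "3 * eisen3 ^ 2 + 8 * fps_XD eisen3 - 3 = 3 * subq 3 (eisen ^ 2 + 8 * fps_XD eisen - 1)"
    by (simp add: fps_XD_subq subq_simps algebra_simps)
  also have "\<dots> = 5 * (3 * subq 3 W)" unfolding W by (simp add: subq_simps)
  finally have "cmap (3 * eisen3 ^ 2 + 8 * fps_XD eisen3 - 3) = (0 :: gf5 fps)" by (simp only: cmap_5_mult)
  then show "3 * cmap eisen3 ^ 2 + 8 * fps_XD (cmap eisen3) = (3 :: gf5 fps)"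
    by (simp add: cmap_mult cmap_simps cmap_power cmap_numeral cmap_XD)
qed

text \<open>The modular form $E_4 = a (b^3 + 9 c^3)$ is 1 modulo 5; here this is read off from the
  derivative of $2 a(q)^2 = 3 E_2(q^3) - E_2(q)$.\<close>

lemma A_b: "a5 * b5 = 1"
proof -
  define e3 where "e3 = (cmap eisen3 :: gf5 fps)"
  have 1: "2 * a5 ^ 2 = 3 * e3 - e5"
    using arg_cong[OF two_cubic_a_square, of "cmap :: _ \<Rightarrow> gf5 fps"]
    by (simp add: a5_def e5_def e3_def cmap_mult cmap_simps cmap_power cmap_numeral)
  have "fps_XD (2 * a5 ^ 2) = fps_XD (3 * e3 - e5)" unfolding 1 ..
  then have 2: "4 * (a5 * fps_XD a5) = 3 * fps_XD e3 - fps_XD e5"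
    by (simp add: fps_XD_diff power2_eq_square fps_XD_mult fps_XD_of_const algebra_simps)
  have 3: "3 * e3 ^ 2 + 8 * fps_XD e3 = 3" unfolding e3_def by (rule eisen_riccati)
  \<comment> \<open>Modulo 5 the term with \<open>e5\<close> drops out because of its coefficient
    20, and the rest is 1 - a (U - Y), by a^3 = U + Y.\<close>
  have "36 * (a5 * a5 ^ 3) + 20 * (a5 ^ 2 * e5) - 32 * (a5 * U5) - 24 = 0"
    using 1 2 3 eisen_riccati(1) XD_A by algebra
  then have "a5 * b5 = 1 + 5 * (a5 * U5 + 7 * (a5 * Y5) + 4 * (a5 ^ 2 * e5) - 5)"
    unfolding A_cube b5_def by (simp add: algebra_simps)
  then show ?thesis by (rule eq_mod_5I)
qed

text \<open>The sum of U and Y is a^3, their difference is \<open>b5\<close>, and 3 is the inverse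
  of 2.\<close>

lemma U_eq: "U5 = 3 * (a5 ^ 3 + b5)" and Y_eq: "Y5 = 3 * (a5 ^ 3 - b5)"
  by (rule eq_mod_5I[where Q = "- U5"], simp add: A_cube b5_def algebra_simps)
     (rule eq_mod_5I[where Q = "- Y5"], simp add: A_cube b5_def algebra_simps)

text \<open>This is 27 times the discriminant form; it expresses the term q E^24 left over by the
  pentagonal series in U and Y.\<close>

lemma U_cube_Y: "cubic_U ^ 3 * cubic_Y = 27 * (fps_X * euler ^ 24)"
proof -
  have "E3 ^ 9 * (cubic_U ^ 3 * cubic_Y) = (E3 ^ 3 * cubic_U) ^ 3 * cubic_Y"
    by (simp add: power_mult_distrib mult.assoc flip: power_mult)
  also have "\<dots> = euler ^ 24 * fps_X * (euler * cubic_c) ^ 3"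
    unfolding cubic_U_eq cubic_Y_def
    by (simp add: power_mult_distrib mult_ac power_add[symmetric] flip: power_mult)
  also have "\<dots> = E3 ^ 9 * (27 * (fps_X * euler ^ 24))"
    unfolding euler_mult_cubic_c by (simp add: power_mult_distrib mult_ac flip: power_mult)
  finally show ?thesis using E3_nonzero by simp
qed

text \<open>The exponents of the pentagonal series are those $n$ for which $24 n + 1$ is a square, so
  $(24 q \frac{d}{dq} + 1)^2$ acts modulo 5 as the identity except on the class of 1.\<close>

lemma eisen_discriminant: "e5 ^ 2 = 1 + U5 ^ 3 * Y5"
proof -
  let ?D = "\<lambda>F :: int fps. 24 * fps_XD F + F"
  have D: "?D (qsum UNIV penta w) = qsum UNIV penta (\<lambda>k. (6 * k - 1) ^ 2 * w k)" for w
  proof -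
    have "?D (qsum UNIV penta w) = qsum UNIV penta (\<lambda>k. 24 * (penta k * w k) + w k)"
      unfolding qsum_XD qsum_add[symmetric] qsum_cmult[symmetric] by (simp add: numeral_fps_const)
    also have "\<dots> = qsum UNIV penta (\<lambda>k. (6 * k - 1) ^ 2 * w k)"
    proof (rule qsum_cong)
      fix k
      have "24 * (penta k * w k) + w k = (12 * (2 * penta k) + 1) * w k" by (simp add: algebra_simps)
      then show "24 * (penta k * w k) + w k = (6 * k - 1) ^ 2 * w k"
        unfolding two_penta by (simp add: algebra_simps power2_eq_square)
    qed simp
    finally show ?thesis .
  qed
  have 1: "?D euler = euler * eisen" by (rule eisen_euler[symmetric])
  have "?D (euler * eisen) = ?D euler * eisen + 24 * (euler * fps_XD eisen)"
    unfolding fps_XD_mult by (simp only: algebra_simps)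
  then have "?D (?D euler) = euler * (eisen ^ 2 + 24 * fps_XD eisen)"
    unfolding 1 by (simp only: algebra_simps power2_eq_square)
  then have "euler * (1 - (eisen ^ 2 + 24 * fps_XD eisen)) = euler - ?D (?D euler)"
    by (simp only: right_diff_distrib mult_1_right)
  also have "\<dots> = qsum UNIV penta (\<lambda>k. parity_sign k * (1 - (6 * k - 1) ^ 4))"
    unfolding pentagonal D qsum_diff by (rule qsum_cong) (simp_all add: algebra_simps eval_nat_numeral)
  finally have "cmap (euler * (1 - (eisen ^ 2 + 24 * fps_XD eisen))) =
      qsum UNIV penta (\<lambda>k. of_int (parity_sign k * (1 - (6 * k - 1) ^ 4)) :: gf5)"
    by (simp only: cmap_qsum)
  also have "\<dots> = qsum UNIV penta (\<lambda>k. if k mod 5 = 1 then of_int (parity_sign k) else 0)"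
  proof (rule qsum_cong)
    fix k :: int
    show "of_int (parity_sign k * (1 - (6 * k - 1) ^ 4)) = (if k mod 5 = 1 then of_int (parity_sign k) else 0 :: gf5)"
    proof (cases "k mod 5 = 1")
      case True
      then have "5 dvd 6 * k - 1" by presburger
      then have "5 dvd (6 * k - 1) ^ 4" by (rule dvd_trans) simp
      then have "of_int ((6 * k - 1) ^ 4) = (0 :: gf5)" by (simp only: of_int_eq_0_iff_5)
      then show ?thesis using True by (simp only: of_int_mult of_int_diff) simp
    next
      case False
      then have "\<not> 5 dvd 6 * k - 1" by presburger
      moreover have "5 dvd (6 * k - 1) * (1 - (6 * k - 1) ^ 4)"
        using five_dvd_power_diff[of "6 * k - 1"] by (simp add: right_diff_distrib dvd_diff_commute flip: power_Suc)
      ultimately have "5 dvd 1 - (6 * k - 1) ^ 4"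
        using prime_dvd_mult_iff[of "5 :: int"] by simp
      then have "of_int (1 - (6 * k - 1) ^ 4) = (0 :: gf5)" by (simp only: of_int_eq_0_iff_5)
      then show ?thesis using False by (simp only: of_int_mult) simp
    qed
  qed simp
  also have "\<dots> = cmap (qsum {k. k mod 5 = 1} penta parity_sign)"
    unfolding qsum_if[OF admissible_penta] cmap_qsum by simp
  also have "\<dots> = - (fps_X * euler ^ 25)"
    unfolding pentagonal_1_mod_5 by (simp only: cmap_uminus cmap_mult cmap_simps cmap_subq_25_euler)
  finally have "euler * (1 - (e5 ^ 2 + 24 * fps_XD e5)) = euler * (- (fps_X * euler ^ 24))"
    by (simp add: e5_def cmap_mult cmap_simps cmap_power cmap_numeral cmap_XD cmap_euler mult_ac flip: power_Suc)
  then have "cmap euler_inv * euler * (1 - (e5 ^ 2 + 24 * fps_XD e5)) = cmap euler_inv * euler * (- (fps_X * euler ^ 24))"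
    by (simp only: mult.assoc)
  moreover have "cmap euler_inv * euler = (1 :: gf5 fps)"
    using arg_cong[OF euler_inv, of "cmap :: _ \<Rightarrow> gf5 fps"] by (simp add: cmap_mult cmap_simps cmap_euler mult.commute)
  ultimately have 1: "1 - (e5 ^ 2 + 24 * fps_XD e5) = - (fps_X * euler ^ 24)" by simp
  have "U5 ^ 3 * Y5 = 27 * (fps_X * euler ^ 24)"
    using arg_cong[OF U_cube_Y, of "cmap :: _ \<Rightarrow> gf5 fps"]
    by (simp add: U5_def Y5_def cmap_mult cmap_simps cmap_power cmap_numeral cmap_euler)
  \<comment> \<open>Eliminating the derivative leaves 2 (e5^2 - 1) = - q E^24. This is multiplied by
    27, where 54 = -1 modulo 5.\<close>
  with 1 eisen_riccati(1) have "e5 ^ 2 = 1 + U5 ^ 3 * Y5 + 5 * (11 * e5 ^ 2 - 11)"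
    by algebra
  then show ?thesis by (rule eq_mod_5I)
qed

text \<open>In terms of a and 1 / a, 1 + U^3 Y is a perfect square modulo 5. The root is decided by
  the constant terms: \<open>e5\<close> and \<open>?P\<close> both start with 1, so
  \<open>3 * (e5 + ?P)\<close> has constant term 6 = 1 and can be cancelled.\<close>

lemma e_eq: "e5 = - (a5 ^ 6) - a5 ^ 2 + 3 * b5 ^ 2"
proof -
  let ?P = "- (a5 ^ 6) - a5 ^ 2 + 3 * b5 ^ 2"
  have "?P ^ 2 = 1 + U5 ^ 3 * Y5 + 5 * (31 - 16 * a5 ^ 12 - 32 * a5 ^ 8 - a5 ^ 4 + 18 * b5 ^ 4)"
    unfolding U_eq Y_eq using A_b by algebra
  then have "?P ^ 2 = e5 ^ 2" unfolding eisen_discriminant by (rule eq_mod_5I)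
  then have *: "e5 * (3 * (e5 + ?P)) = ?P * (3 * (e5 + ?P))"
    by algebra
  have A0: "a5 $ 0 = 1" by (simp add: a5_def cubic_a_nth_0)
  then have "b5 $ 0 = 1" using arg_cong[OF A_b, of "\<lambda>F. F $ 0"] by simp
  moreover have "log_euler $ 0 = 0" by (simp add: log_euler_def)
  then have "e5 $ 0 = 1" by (simp add: e5_def eisen_def)
  ultimately have "(3 * (e5 + ?P)) $ 0 = 1" using A0 six_gf5 by (simp add: numeral_fps_const fps_power_zeroth)
  then show ?thesis using * by (intro agree_eqI) (rule agree_cancel[where U = "3 * (e5 + ?P)"], auto)
qed

definition s5 :: "gf5 fps" where "s5 = a5 ^ 2"
definition t5 :: "gf5 fps" where "t5 = b5 ^ 2"

lemma s_t: "s5 * t5 = 1"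
  using A_b by (simp add: s5_def t5_def flip: power_mult_distrib)

lemma XD_A': "fps_XD a5 = a5 * (2 * (s5 ^ 3 - t5))"
proof (rule eq_mod_5I)
  show "fps_XD a5 = a5 * (2 * (s5 ^ 3 - t5)) + 5 * (- (a5 ^ 7) - 6 * a5 ^ 3 - 5 * b5 - 7 * fps_XD a5)"
    using XD_A unfolding U_eq e_eq s5_def t5_def using A_b by algebra
qed

lemma XD_s: "fps_XD s5 = 1 - s5 ^ 4"
proof (rule eq_mod_5I)
  show "fps_XD s5 = 1 - s5 ^ 4 + 5 * (s5 ^ 4 - 1)"
    using XD_A' A_b unfolding s5_def t5_def power2_eq_square[of a5] fps_XD_mult by algebra
qed

lemma XD_t: "fps_XD t5 = s5 ^ 2 - t5 ^ 2"
proof -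
  have "fps_XD (s5 * t5) = 0" unfolding s_t by (rule fps_XD_of_const)
  then have "s5 * fps_XD t5 + fps_XD s5 * t5 = 0" by (simp add: fps_XD_mult add.commute mult.commute)
  then show ?thesis using s_t XD_s by algebra
qed

lemma XD_s_power: "fps_XD (s5 ^ n) = of_nat n * s5 ^ (n - 1) * (1 - s5 ^ 4)"
  and XD_t_power: "fps_XD (t5 ^ n) = of_nat n * t5 ^ (n - 1) * (s5 ^ 2 - t5 ^ 2)"
  by (simp_all add: XD_power XD_s XD_t)

section \<open>Vanishing on classes modulo 25\<close>

lemma XD_nth_5: "fps_XD F $ (5 * n) = (0 :: gf5)"
  unfolding fps_XD_nth of_nat_5_mult by simp

text \<open>The form that is multiplied by 10 in \<open>cubic_identity\<close>, reduced modulo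
  5.\<close>

definition H5 :: "gf5 fps" where "H5 = a5 * e5 * (U5 ^ 3 + 3 * U5 ^ 2 * Y5) - U5 ^ 4"

text \<open>In characteristic 5 the coefficients of a series whose index is divisible by 5 are found by
  writing it as a derivative plus a fifth power. Here the fifth power is that of a derivative
  again, whence the coefficients vanish even at the multiples of 25.\<close>

lemma H5_nth: "H5 $ (25 * k) = 0"
proof -
  \<comment> \<open>The derivative of s^n is n (s^(n - 1) - s^(n + 3)), so up to derivatives the
    exponent of s may be moved by 4 unless 5 divides n; t counts as s^(-1). Thus s^8 is moved to
    s^20 and s^4 to 1, while t^2, s^2 and s^6 are identified and their coefficients add up to 10.
    What remains is 2 s^20 + 3.\<close>
  let ?G = "s5 ^ 17 + 4 * s5 ^ 13 + 3 * s5 ^ 9 + 2 * s5 + 2 * s5 ^ 3 + 3 * t5 + 2 * t5 ^ 5 + 3 * s5 ^ 15"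
  have 1: "H5 = 2 * s5 ^ 8 + 3 * s5 ^ 4 + 2 * t5 ^ 2 + 4 * s5 ^ 6 + 4 * s5 ^ 2"
  proof (rule eq_mod_5I)
    show "H5 = 2 * s5 ^ 8 + 3 * s5 ^ 4 + 2 * t5 ^ 2 + 4 * s5 ^ 6 + 4 * s5 ^ 2 +
      5 * (- 22 * a5 ^ 16 - 71 * a5 ^ 12 - 33 * a5 ^ 8 + 10 * a5 ^ 4 - 54 - 49 * b5 ^ 4)"
      unfolding H5_def U_eq Y_eq e_eq s5_def t5_def using A_b by algebra
  qed
  have G: "fps_XD ?G = (17 * s5 ^ 16 + 52 * s5 ^ 12 + 27 * s5 ^ 8 + 2 + 6 * s5 ^ 2 + 45 * s5 ^ 14) * (1 - s5 ^ 4) +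
      (3 + 10 * t5 ^ 4) * (s5 ^ 2 - t5 ^ 2)"
    unfolding fps_XD_add fps_XD_numeral_mult XD_s_power XD_t_power XD_s XD_t by (simp add: algebra_simps)
  have "3 * fps_XD s5 = 2 * s5 ^ 4 + 3"
    by (rule eq_mod_5I[where Q = "- (s5 ^ 4)"]) (simp add: XD_s)
  then have "(3 * fps_XD s5) ^ 5 = 32 * s5 ^ 20 + 243"
    by (simp add: power_5_add power_mult_distrib flip: power_mult)
  moreover have "H5 = fps_XD ?G + (32 * s5 ^ 20 + 243)"
  proof (rule eq_mod_5I)
    show "H5 = fps_XD ?G + (32 * s5 ^ 20 + 243) + 5 * (- 3 * s5 ^ 20 + 9 * s5 ^ 18 + 7 * s5 ^ 16 - 9 * s5 ^ 14 - 5 * s5 ^ 12 -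
        5 * s5 ^ 8 + 2 * s5 ^ 6 + 1 * s5 ^ 4 - 1 * s5 ^ 2 - 49 - 1 * t5 ^ 2 + 2 * t5 ^ 6)"
      unfolding 1 G using s_t by algebra
  qed
  ultimately have "H5 = fps_XD ?G + (3 * fps_XD s5) ^ 5" by simp
  then have "H5 $ (5 * (5 * k)) = (fps_XD ?G + (3 * fps_XD s5) ^ 5) $ (5 * (5 * k))"
    by (rule arg_cong)
  also have "\<dots> = fps_XD ?G $ (5 * (5 * k)) + ((3 * fps_XD s5) ^ 5) $ (5 * (5 * k))"
    by (rule fps_add_nth)
  also have "((3 * fps_XD s5) ^ 5) $ (5 * (5 * k)) = ((3 * fps_XD s5) $ (5 * k)) ^ 5"
    unfolding fps_power_5_nth by simp
  also have "(3 * fps_XD s5) $ (5 * k) = 0"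
    unfolding numeral_fps_const fps_mult_left_const_nth XD_nth_5 by simp
  finally show ?thesis unfolding XD_nth_5 by simp
qed

text \<open>The twisted derivation 3 q d/dq + 1 annihilates the exponent 25 k + 8 modulo 5. In q^3
  Z^5 this exponent leads to the coefficient of \<open>Z\<close> at 5 k + 1, and as \<open>Z\<close>
  comes from c^2, it is built with 3 q d/dq + 2, which annihilates 5 k + 1.\<close>

lemma M_nth: "(e5 * U5 ^ 2 * Y5 * c5) $ (25 * k + 8) = 0"
proof -
  \<comment> \<open>The primitive: 3 q d/dq + 1 applied to c a \<open>?k\<close> accounts for the
    form up to q^3 Z^5, as \<open>id\<close> confirms.\<close>
  let ?k = "3 * s5 ^ 2 + 3 * t5 ^ 2 + s5 ^ 10 + 4 * t5 ^ 4 + 2 * s5 ^ 4 + s5 ^ 12 + 3 * s5 ^ 16 + 2 * t5 ^ 6 + s5 ^ 14"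
  define Z where "Z = 2 * (3 * fps_XD (c5 ^ 2) + 2 * c5 ^ 2)"
  have e5: "e5 = - (s5 ^ 3) - s5 + 3 * t5" unfolding e_eq s5_def t5_def by (simp flip: power_mult)
  have DC: "3 * fps_XD c5 + c5 = c5 * (s5 ^ 3 - 2 * s5 - 3 * t5)"
  proof (rule eq_mod_5I)
    show "3 * fps_XD c5 + c5 = c5 * (s5 ^ 3 - 2 * s5 - 3 * t5) + 5 * (c5 * (3 * s5 + e5) - 3 * (3 * fps_XD c5 + c5))"
      using XD_C unfolding s5_def[symmetric] e5 by algebra
  qed
  have Z: "Z = c5 ^ 2 * (4 * s5 ^ 3 + 2 * s5 + 3 * t5)"
  proof (rule eq_mod_5I)
    have "Z = 4 * c5 * (3 * fps_XD c5 + c5)"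
      unfolding Z_def power2_eq_square fps_XD_mult by (simp add: algebra_simps)
    then show "Z = c5 ^ 2 * (4 * s5 ^ 3 + 2 * s5 + 3 * t5) + 5 * (c5 ^ 2 * (- 2 * s5 - 3 * t5))"
      unfolding DC by (simp add: algebra_simps power2_eq_square)
  qed
  have Z5: "Z ^ 5 = c5 ^ 10 * (1024 * s5 ^ 15 + 32 * s5 ^ 5 + 243 * t5 ^ 5)"
    unfolding Z power_mult_distrib power_5_add by (simp flip: power_mult)
  have bA: "b5 = a5 * t5" using A_b unfolding t5_def by algebra
  have YA: "Y5 = a5 * (3 * (s5 - t5))" unfolding Y_eq bA s5_def by (simp add: algebra_simps power2_eq_square power3_eq_cube)
  have UY: "e5 * U5 ^ 2 * Y5 = a5 * (3 * s5 ^ 7 + s5 ^ 5 + s5 ^ 3 + t5 + 4 * t5 ^ 3)"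
  proof (rule eq_mod_5I)
    show "e5 * U5 ^ 2 * Y5 = a5 * (3 * s5 ^ 7 + s5 ^ 5 + s5 ^ 3 + t5 + 4 * t5 ^ 3) +
      5 * (- 6 * a5 ^ 15 - 11 * a5 ^ 11 + 16 * a5 ^ 7 + 27 * a5 ^ 3 - 11 * b5 - 17 * b5 ^ 5)"
      unfolding U_eq Y_eq e_eq s5_def t5_def using A_b by algebra
  qed
  have Dk: "fps_XD ?k = (6 * s5 + 10 * s5 ^ 9 + 8 * s5 ^ 3 + 12 * s5 ^ 11 + 48 * s5 ^ 15 + 14 * s5 ^ 13) * (1 - s5 ^ 4) +
      (6 * t5 + 16 * t5 ^ 3 + 12 * t5 ^ 5) * (s5 ^ 2 - t5 ^ 2)"
    unfolding fps_XD_add fps_XD_numeral_mult XD_s_power XD_t_power by (simp add: algebra_simps)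
  \<comment> \<open>The power c^10 in Z^5 is reduced to a single factor c, as it occurs in the form,
    by q^3 c^10 = (q c^3)^3 c.\<close>
  have XC: "fps_X ^ 3 * c5 ^ 10 = Y5 ^ 3 * c5"
    by (simp add: Y5_def c5_def cubic_Y_def cmap_mult cmap_power cmap_simps power_mult_distrib mult_ac flip: power_mult power_Suc)
  have "3 * fps_XD (c5 * (a5 * ?k)) + c5 * (a5 * ?k) =
      (3 * fps_XD c5 + c5) * (a5 * ?k) + 3 * (c5 * (fps_XD a5 * ?k + a5 * fps_XD ?k))"
    unfolding fps_XD_mult by (simp add: algebra_simps)
  also have "\<dots> = c5 * a5 * ((s5 ^ 3 - 2 * s5 - 3 * t5) * ?k + 6 * (s5 ^ 3 - t5) * ?k + 3 * fps_XD ?k)"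
    unfolding DC XD_A' by (simp add: algebra_simps)
  finally have D: "3 * fps_XD (c5 * (a5 * ?k)) + c5 * (a5 * ?k) =
      c5 * a5 * ((7 * s5 ^ 3 - 2 * s5 - 9 * t5) * ?k + 3 * fps_XD ?k)" by (simp add: algebra_simps)
  have id: "3 * s5 ^ 7 + s5 ^ 5 + s5 ^ 3 + t5 + 4 * t5 ^ 3 = (7 * s5 ^ 3 - 2 * s5 - 9 * t5) * ?k + 3 * fps_XD ?k +
      2 * s5 * (s5 - t5) ^ 3 * (1024 * s5 ^ 15 + 32 * s5 ^ 5 + 243 * t5 ^ 5)"
  proof (rule eq_mod_5I)
    show "3 * s5 ^ 7 + s5 ^ 5 + s5 ^ 3 + t5 + 4 * t5 ^ 3 = (7 * s5 ^ 3 - 2 * s5 - 9 * t5) * ?k + 3 * fps_XD ?k +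
      2 * s5 * (s5 - t5) ^ 3 * (1024 * s5 ^ 15 + 32 * s5 ^ 5 + 243 * t5 ^ 5) +
      5 * (- 382 * s5 ^ 19 + 1238 * s5 ^ 17 - 1251 * s5 ^ 15 + 407 * s5 ^ 13 - 7 * s5 ^ 11 - 19 * s5 ^ 9 + 43 * s5 ^ 7 -
        35 * s5 ^ 5 + 9 * s5 ^ 3 - 9 * s5 - 107 * t5 + 289 * t5 ^ 3 - 282 * t5 ^ 5 + 104 * t5 ^ 7 - (s5 ^ 3 - 2 * t5) * ?k)"
      unfolding Dk using s_t by algebra
  qed
  have "fps_X ^ 3 * Z ^ 5 = c5 * a5 * (27 * s5 * (s5 - t5) ^ 3 * (1024 * s5 ^ 15 + 32 * s5 ^ 5 + 243 * t5 ^ 5))"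
  proof -
    have "a5 ^ 3 = a5 * s5" by (simp add: s5_def power2_eq_square power3_eq_cube)
    then show ?thesis
      unfolding Z5 mult.assoc[symmetric] XC unfolding YA power_mult_distrib by (simp add: mult_ac)
  qed
  also have "\<dots> = c5 * a5 * (2 * s5 * (s5 - t5) ^ 3 * (1024 * s5 ^ 15 + 32 * s5 ^ 5 + 243 * t5 ^ 5))"
    by (rule eq_mod_5I[where Q = "5 * c5 * a5 * (s5 * (s5 - t5) ^ 3 * (1024 * s5 ^ 15 + 32 * s5 ^ 5 + 243 * t5 ^ 5))"])
       (simp add: algebra_simps)
  finally have XZ: "fps_X ^ 3 * Z ^ 5 = c5 * a5 * (2 * s5 * (s5 - t5) ^ 3 * (1024 * s5 ^ 15 + 32 * s5 ^ 5 + 243 * t5 ^ 5))" .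
  have "e5 * U5 ^ 2 * Y5 * c5 = (3 * fps_XD (c5 * (a5 * ?k)) + c5 * (a5 * ?k)) + fps_X ^ 3 * Z ^ 5"
    unfolding UY D XZ id by (simp only: distrib_left distrib_right mult_ac)
  then have "(e5 * U5 ^ 2 * Y5 * c5) $ (25 * k + 8) = (3 * fps_XD (c5 * (a5 * ?k)) + c5 * (a5 * ?k)) $ (25 * k + 8) +
      (fps_X ^ 3 * Z ^ 5) $ (25 * k + 8)"
    by (simp only: fps_add_nth)
  also have "(3 * fps_XD F + F) $ (25 * k + 8) = 0" for F :: "gf5 fps"
  proof -
    have "(3 * fps_XD F + F) $ (25 * k + 8) = of_nat (5 * (15 * k + 5)) * F $ (25 * k + 8)"
      by (simp add: numeral_fps_const algebra_simps)
    then show ?thesis unfolding of_nat_5_mult by simp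
  qed
  also have "(fps_X ^ 3 * Z ^ 5) $ (25 * k + 8) = (Z ^ 5) $ (5 * (5 * k + 1))"
    by (simp add: fps_X_power_mult_nth)
  also have "\<dots> = (Z $ (5 * k + 1)) ^ 5" unfolding fps_power_5_nth by simp
  also have "Z $ (5 * k + 1) = of_nat (5 * (6 * k + 2)) * (c5 ^ 2) $ (5 * k + 1)"
    unfolding Z_def by (simp add: numeral_fps_const algebra_simps)
  also have "\<dots> = 0" unfolding of_nat_5_mult by simp
  finally show ?thesis by simp
qed

section \<open>Congruences modulo 25\<close>

text \<open>A form f of weight k satisfies 12 q df/dq = k E_2 f plus a form of weight k + 2. Here a,
  U and Y have weights 1, 3 and 3, so the form differentiated has weight 10 and its E_2 term is
  divisible by 5. The ratio 1 : 3 of its two terms makes U^3 Y cancel, and U^4 is left with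
  coefficient 10.\<close>

lemma cubic_identity:
  "18 * (cubic_U ^ 2 * cubic_Y ^ 2) = 12 * fps_XD (cubic_a * cubic_U ^ 3 + 3 * (cubic_a * cubic_U ^ 2 * cubic_Y)) -
    10 * (cubic_a * eisen * (cubic_U ^ 3 + 3 * cubic_U ^ 2 * cubic_Y) - cubic_U ^ 4)"
proof -
  define a U Y e where "a = (cubic_a :: int fps)" and "U = cubic_U" and "Y = cubic_Y" and "e = eisen"
  note defs = a_def[symmetric] U_def[symmetric] Y_def[symmetric] e_def[symmetric]
  have a3: "a ^ 3 = U + Y" unfolding a_def U_def Y_def cubic_U_def by simp
  have "fps_XD (a * U ^ 3 + 3 * (a * U ^ 2 * Y)) =
      fps_XD a * (U ^ 3 + 3 * U ^ 2 * Y) + a * (3 * U ^ 2 + 6 * U * Y) * fps_XD U + 3 * a * U ^ 2 * fps_XD Y"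
    unfolding fps_XD_add fps_XD_mult XD_power
    by (simp add: fps_XD_of_const algebra_simps power2_eq_square power3_eq_cube)
  then show ?thesis
    unfolding defs using a3 XD_cubic_a'[unfolded defs] XD_cubic_U'[unfolded defs] XD_cubic_Y'[unfolded defs]
    by algebra
qed

lemma euler_inv_25_nth:
  assumes "\<And>j. cmap F $ (25 * j + r) = (0 :: gf5)" "r < 25"
  shows "5 dvd (F * euler_inv ^ 25) $ (25 * k + r)"
proof -
  have "(cmap F * cmap euler_inv ^ 25 :: gf5 fps) $ (25 * k + r) = 0"
    by (rule mult_power_25_nth_eq_0) (use assms in auto)
  then have "of_int ((F * euler_inv ^ 25) $ (25 * k + r)) = (0 :: gf5)"
    by (simp flip: cmap_nth add: cmap_mult cmap_power)
  then show ?thesis by (simp only: of_int_eq_0_iff_5)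
qed

lemma cphi3_bar_25:
  "25 dvd (E3 ^ 12 * euler_inv ^ 13) $ (25 * m + 23)"
proof -
  define F where "F = E3 ^ 12 * euler_inv ^ 13"
  define D where "D = cubic_a * cubic_U ^ 3 + 3 * (cubic_a * cubic_U ^ 2 * (cubic_Y :: int fps))"
  define K where "K = cubic_a * eisen * (cubic_U ^ 3 + 3 * cubic_U ^ 2 * cubic_Y) - cubic_U ^ 4"
  \<comment> \<open>The factor q^2 moves the index 25 m + 23 to a multiple of 25, where derivatives
    have coefficients divisible by 25.\<close>
  define N where "N = 25 * (m + 1)"
  have N: "(fps_X ^ 2 * F) $ N = F $ (25 * m + 23)"
    by (simp add: N_def fps_X_power_mult_nth add.commute)
  have Y: "cubic_Y = 27 * (fps_X * E3 ^ 9 * euler_inv ^ 3)"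
    unfolding cubic_Y_def cubic_c_eq by algebra
  have "cubic_U ^ 2 * cubic_Y ^ 2 * euler_inv ^ 25 =
      729 * (fps_X ^ 2 * (E3 ^ 12 * ((E3 ^ 3 * cubic_U) ^ 2 * euler_inv ^ 31)))"
    unfolding Y by algebra
  also have "\<dots> = 729 * (fps_X ^ 2 * (E3 ^ 12 * ((euler * euler_inv) ^ 18 * euler_inv ^ 13)))"
    unfolding cubic_U_eq by algebra
  finally have UY: "cubic_U ^ 2 * cubic_Y ^ 2 * euler_inv ^ 25 = 729 * (fps_X ^ 2 * F)"
    unfolding euler_inv F_def by simp
  \<comment> \<open>E^(-25) has a logarithmic derivative divisible by 25, so moving it under the
    derivation costs only a multiple of 25.\<close>
  define D' where "D' = fps_XD (D * euler_inv ^ 25) + 25 * (log_euler * D * euler_inv ^ 25)"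
  have D': "fps_XD D * euler_inv ^ 25 = D'"
    unfolding D'_def fps_XD_mult XD_euler_inv_power by simp
  have "18 * (cubic_U ^ 2 * cubic_Y ^ 2) = 12 * fps_XD D - 10 * K"
    unfolding D_def K_def by (rule cubic_identity)
  with UY D' have *: "13122 * (fps_X ^ 2 * F) = 12 * D' - 10 * (K * euler_inv ^ 25)"
    by algebra
  have "(13122 * (fps_X ^ 2 * F)) $ N = (12 * D' - 10 * (K * euler_inv ^ 25)) $ N"
    unfolding * ..
  then have 1: "13122 * F $ (25 * m + 23) = 12 * D' $ N - 10 * (K * euler_inv ^ 25) $ N"
    by (simp add: numeral_fps_const N)
  have 2: "D' $ N = int N * (D * euler_inv ^ 25) $ N + 25 * (log_euler * D * euler_inv ^ 25) $ N"
    by (simp add: D'_def numeral_fps_const mult.assoc)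
  have 3: "int N = 25 * int (m + 1)" by (simp add: N_def)
  have "5 dvd (K * euler_inv ^ 25) $ (25 * (m + 1) + 0)"
  proof (rule euler_inv_25_nth)
    have "cmap K = H5"
      by (simp add: K_def H5_def a5_def U5_def Y5_def e5_def cmap_mult cmap_simps cmap_power cmap_numeral)
    then show "cmap K $ (25 * j + 0) = (0 :: gf5)" for j using H5_nth by simp
  qed simp
  then have "5 dvd (K * euler_inv ^ 25) $ N" by (simp add: N_def)
  then obtain z where z: "(K * euler_inv ^ 25) $ N = 5 * z" by (rule dvdE)
  with 1 2 3 have "13122 * F $ (25 * m + 23) =
      25 * (12 * (int (m + 1) * (D * euler_inv ^ 25) $ N + (log_euler * D * euler_inv ^ 25) $ N) - 2 * z)"
    by algebra
  then have "25 dvd 13122 * F $ (25 * m + 23)" by (rule dvdI)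
  \<comment> \<open>The factor 13122 = 18 * 729 is a unit modulo 25, since 8 * 13122 = 1 + 25 *
    4199.\<close>
  moreover have "25 dvd z" if "25 dvd 13122 * z" for z :: int
  proof -
    from that obtain k where "13122 * z = 25 * k" by (rule dvdE)
    then have "z = 25 * (8 * k - 4199 * z)" by simp
    then show ?thesis by (rule dvdI)
  qed
  ultimately show ?thesis unfolding F_def[symmetric] by blast
qed

lemma cphi_25: "25 dvd (cubic_a ^ 2 * (E3 ^ 6 * euler_inv ^ 11)) $ (25 * m + 7)"
proof -
  define F where "F = E3 ^ 6 * euler_inv ^ 11"
  let ?n = "25 * m + 7"
  have "fps_XD F = (18 * log_euler3 - 11 * log_euler) * F"
    unfolding F_def fps_XD_mult XD_E3_power XD_euler_inv_power by (simp add: algebra_simps)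
  \<comment> \<open>Twice the logarithmic derivative of \<open>F\<close> differs from a^2 - 1 only
    by -10 L, where L is \<open>log_euler\<close>. At n = 25 m + 7 the factor 2 n + 1 is 15 modulo
    25, and 15 F + 10 L F is 15 E_2 F modulo 25, so that E_2 F is needed only modulo 5.\<close>
  then have aF: "cubic_a ^ 2 * F = 2 * fps_XD F + F + 10 * (log_euler * F)"
    using cubic_a_square by algebra
  have 1: "(cubic_a ^ 2 * F) $ ?n = 2 * (int ?n * F $ ?n) + F $ ?n + 10 * (log_euler * F) $ ?n"
    unfolding aF by (simp add: numeral_fps_const)
  have 2: "(eisen * F) $ ?n = F $ ?n + 24 * (log_euler * F) $ ?n"
    by (simp add: eisen_def distrib_right numeral_fps_const mult.assoc)
  have "5 dvd 81 * (eisen * F) $ ?n"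
  proof -
    let ?G = "eisen * cubic_U ^ 2 * cubic_Y * cubic_c"
    have "cmap ?G = e5 * U5 ^ 2 * Y5 * c5"
      by (simp add: c5_def U5_def Y5_def e5_def cmap_mult cmap_simps cmap_power)
    then have "5 dvd (?G * euler_inv ^ 25) $ (25 * m + 8)"
      by (intro euler_inv_25_nth) (simp_all add: M_nth)
    moreover have "?G * euler_inv ^ 25 = 81 * (fps_X * (eisen * F))"
    proof -
      have "E3 ^ 6 * (?G * euler_inv ^ 25) = (E3 ^ 3 * cubic_U) ^ 2 * (eisen * cubic_Y * cubic_c * euler_inv ^ 25)"
        by algebra
      also have "\<dots> = (euler * euler_inv) ^ 18 * (fps_X * cubic_c ^ 4 * eisen * euler_inv ^ 7)"
        unfolding cubic_U_eq cubic_Y_def by algebra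
      also have "\<dots> = E3 ^ 6 * (81 * (fps_X * (eisen * F)))"
        unfolding cubic_c_eq F_def euler_inv power_one by algebra
      finally show ?thesis using E3_nonzero by simp
    qed
    ultimately have "5 dvd (81 * (fps_X * (eisen * F))) $ (25 * m + 8)" by simp
    then show ?thesis by (simp add: numeral_fps_const add.commute)
  qed
  moreover have "5 dvd z" if "5 dvd 81 * z" for z :: int
  proof -
    from that obtain k where "81 * z = 5 * k" by (rule dvdE)
    then have "z = 5 * (k - 16 * z)" by simp
    then show ?thesis by (rule dvdI)
  qed
  ultimately have "5 dvd (eisen * F) $ ?n" by blast
  then obtain z where "(eisen * F) $ ?n = 5 * z" by (rule dvdE)
  moreover have "int ?n = 25 * int m + 7" by simp
  ultimately have "(cubic_a ^ 2 * F) $ ?n = 25 * (2 * (int m * F $ ?n) + 3 * z - 14 * (log_euler * F) $ ?n)"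
    using 1 2 by algebra
  then show ?thesis unfolding F_def by (rule dvdI)
qed

theorem theorem1p2:
  fixes n :: nat
  shows "[cphi 3 (75 * n + 22) = 0] (mod 25) \<and> [cphi3_bar (75 * n + 72) = 0] (mod 25)"
proof
  have eq: "75 * n + 22 = 3 * (25 * n + 7) + 1" "75 * n + 72 = 3 * (25 * n + 24)" by simp_all
  have "25 dvd int (cphi 3 (75 * n + 22))"
    unfolding eq cphi_1_mod_3 by (rule dvd_mult[OF cphi_25])
  then have "25 dvd cphi 3 (75 * n + 22)" by presburger
  then show "[cphi 3 (75 * n + 22) = 0] (mod 25)" by (simp add: cong_0_iff)
  have "(fps_X * (E3 ^ 12 * euler_inv ^ 13)) $ (25 * n + 24) = (E3 ^ 12 * euler_inv ^ 13) $ (25 * n + 23)"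
    by (simp add: add.commute)
  then have "25 dvd cphi3_bar (75 * n + 72)"
    unfolding eq cphi_0_mod_3 using cphi3_bar_25[of n] by (simp only: dvd_mult)
  then show "[cphi3_bar (75 * n + 72) = 0] (mod 25)" by (simp add: cong_0_iff)
qed

end
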